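(* Let $f(z)=\sum_{n=0}^{\infty}f_{2n}z^n$ and $g(z)=\sum_{n=0}^{\infty}f_{2n+1}z^n$ be entire functions of genus $0$ having only negative zeros, and put $$h(z)=\sum_{k=0}^\infty i^{\frac{k(k-1)}2}f_kz^k,\qquad \overline h(z)=\sum_{k=0}^\infty i^{-\frac{k(k-1)}2}f_kz^k .$$ Let $\mu=\sqrt i=e^{i\pi/4}$. Then the zeros of $h(\overline\mu z)$ with $\alpha=-\overline\mu f_1/f_0$, and likewise the zeros of $\overline h(\mu z)$ with $\alpha=-\mu f_1/f_0$, denoted in each case by $z_1,z_2,\dots$ with $|z_{n-1}|\le|z_n|$ and repeated according to multiplicity, are distributed as follows. (i) If $\Im\alpha^2\ne0$, then all zeros are simple and $0<|z_1|<|z_2|<\cdots$; $\Im z_n^2\ne0$ for every $n$, and $z_n\in Q_l\implies z_{n+1}\in Q_{l+\operatorname{sign}(\Im\alpha^2)}$. Moreover, $\Im\alpha\,\Im z_1<0$ and $\Im\alpha^2\,\Re z_1\,\Im z_1<0$. (ii) If $\Im\alpha=0$, then $0<|z_1|\le|z_2|<|z_3|\le|z_4|<\cdots$, there are no purely imaginary zeros, real zeros can be simple or double, and the other zeros are simple. Moreover, for each natural $n$: $|z_{2n-1}|=|z_{2n}|\implies z_{2n-1}=\overline z_{2n}$; $|z_{2n-1}|<|z_{2n}|\implies\operatorname{Arg}z_{2n-1}=\operatorname{Arg}z_{2n}\in\{0,\pi\}$; $\Re z_{2n}\Re z_{2n+1}<0$; and $\alpha\Re z_1>0$. (iii) If $\Re\alpha=0$,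 then $0<|z_1|<|z_2|\le|z_3|<|z_4|\le\cdots$, there are no real zeros, purely imaginary zeros can be simple or double, and the other zeros are simple. Moreover, for each natural $n$: $|z_{2n}|=|z_{2n+1}|\implies z_{2n}=-\overline z_{2n+1}$; $|z_{2n}|<|z_{2n+1}|\implies\operatorname{Arg}z_{2n}=\operatorname{Arg}z_{2n+1}\in\{-\frac\pi2,\frac\pi2\}$; $\Im z_{2n-1}\Im z_{2n}<0$; $\Im\alpha\,\Im z_1<0$; and $\Re z_1=0$.
   Context: For $l\in\mathbb{Z}$, $Q_l:=\{z\ne0:0<\operatorname{Arg}(z\,i^{-l})<\frac\pi2\}$ are the open quadrants ($Q_{l+4}=Q_l$; $\operatorname{Arg}$ is the principal argument). An entire function $f$ of genus $0$ with only negative zeros has the form $f(0)\prod_\nu(1+z/a_\nu)$, $f(0)\ne0$, $a_\nu>0$, $\sum1/a_\nu<\infty$ (finite, infinite or empty product); in particular $f_0\ne0$ and $f_1\neq0$ here. Each assertion involving particular $z_n$ is made for those indices for which the zeros involved exist. *)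

theory Defs
  imports "HOL-Complex_Analysis.Complex_Analysis" "HOL-Library.Extended_Nat"
begin

text \<open>
  Entire functions of genus 0, in Hadamard form: at most countably many nonzero zeros
  \<open>a n\<close>, \<open>n \<in> I\<close> (with multiplicity; \<open>I\<close> may be finite, infinite or empty), whose reciprocals
  are absolutely summable.
\<close>

definition genus_zero :: "(complex \<Rightarrow> complex) \<Rightarrow> bool" where
  "genus_zero F \<longleftrightarrow>
     (\<exists>c m (I :: nat set) (a :: nat \<Rightarrow> complex).
        c \<noteq> 0 \<and> (\<forall>n\<in>I. a n \<noteq> 0) \<and> (\<lambda>n. 1 / norm (a n)) summable_on I \<and>
        (\<forall>w. F w = c * w ^ m * (\<Prod>n. if n \<in> I then 1 - w / a n else 1)))"

definition h_series :: "(nat \<Rightarrow> complex) \<Rightarrow> complex \<Rightarrow> complex" where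
  "h_series c w = (\<Sum>k. \<i> ^ (k * (k - 1) div 2) * c k * w ^ k)"

text \<open>Only the powers of \<open>\<i>\<close> are conjugated here, not the coefficients.\<close>

definition hbar_series :: "(nat \<Rightarrow> complex) \<Rightarrow> complex \<Rightarrow> complex" where
  "hbar_series c w = (\<Sum>k. \<i> powi (- int (k * (k - 1) div 2)) * c k * w ^ k)"

definition quadrant :: "int \<Rightarrow> complex set" where
  "quadrant l = {w. w \<noteq> 0 \<and> 0 < Arg (w * \<i> powi (- l)) \<and> Arg (w * \<i> powi (- l)) < pi / 2}"

text \<open>
  \<open>z 1, z 2, \<dots>\<close> lists all the zeros of \<open>F\<close> with multiplicity, by nondecreasing modulus; there are
  \<open>N\<close> of them, possibly none or infinitely many. Other values of \<open>z\<close>, in particular \<open>z 0\<close>,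
  are irrelevant.
\<close>

definition enumerates_zeros :: "(complex \<Rightarrow> complex) \<Rightarrow> enat \<Rightarrow> (nat \<Rightarrow> complex) \<Rightarrow> bool" where
  "enumerates_zeros F N z \<longleftrightarrow>
     (\<forall>n. 1 \<le> n \<and> enat n \<le> N \<longrightarrow> F (z n) = 0) \<and>
     (\<forall>w. F w = 0 \<longrightarrow> int (card {n. 1 \<le> n \<and> enat n \<le> N \<and> z n = w}) = zorder F w) \<and>
     (\<forall>n. 2 \<le> n \<and> enat n \<le> N \<longrightarrow> norm (z (n - 1)) \<le> norm (z n))"

end

theory Submission
  imports Defs
begin

text \<open>
  The zeros of \<open>H\<close> are those of \<open>U - \<alpha> V\<close>, where \<open>U z = F (z\<^sup>2)\<close>, \<open>V z = z G (- z\<^sup>2)\<close> and \<open>F\<close>, \<open>G\<close> are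
  canonical products with negative zeros. On the circle \<open>\<bar>z\<bar> = exp \<rho>\<close> the difference \<open>\<bar>U\<bar> - \<bar>\<alpha>\<bar> \<bar>V\<bar>\<close>
  is strictly decreasing in \<open>Arg z \<in> [0, \<pi>/2]\<close>; so, up to reflections in the axes, it vanishes at no
  more than one point, of argument \<open>Th \<rho>\<close> say, and the argument \<open>B \<rho>\<close> of \<open>U / V\<close> at that point
  decides which of its reflections are zeros. As a function of \<open>\<zeta> = log z\<close>, \<open>L = log (U / V)\<close> satisfies
  \<open>Im L' > 0\<close>; integrated along segments (as in the Noshiro-Warschawski theorem) this gives
  \<open>Im ((L \<zeta>2 - L \<zeta>1) * cnj (\<zeta>2 - \<zeta>1)) > 0\<close>, hence \<open>B\<close> is increasing, strictly so while \<open>Th\<close> is in the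
  interior of \<open>[0, \<pi>/2]\<close>. If \<open>\<alpha>\<close> is not on an axis, then \<open>B\<close> takes each of the values
  \<open>m \<pi> \<plusminus> a\<close>, with \<open>\<bar>cos a\<bar> = \<bar>Re \<alpha>\<bar> / \<bar>\<alpha>\<bar>\<close>, at most once, and in succession. If \<open>\<alpha>\<close> is real, the zeros are
  at the values \<open>k \<pi>\<close>; \<open>B\<close> is constant on intervals where \<open>Th = 0\<close>, and there the zeros are real and
  counted by means of the convexity of \<open>ln \<bar>U / V\<bar>\<close> in \<open>\<rho>\<close>. The case of imaginary \<open>\<alpha>\<close> reduces to this
  one by \<open>z = \<i> y\<close>, which exchanges \<open>F\<close> and \<open>G\<close>.
\<close>

subsection \<open>Canonical products with negative zeros\<close>

text \<open>All positivity comes from one computation: with w = exp \<zeta>, the derivative of log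
  (1 + a exp \<zeta>) is a w / (1 + a w), whose imaginary part has the sign of Im w for a > 0. In
  the variable \<zeta> the modulus of z is the horizontal coordinate, so the order of the zeros by
  modulus becomes monotonicity along a curve, and no contour integrals are needed to count them. The
  obstacle is the boundary of the strip: the zeros of U and V lie on its two edges, and the segment
  argument says nothing about two points of the same edge. There Im L is a step function counting
  the zeros passed, so it is nondecreasing but may stay constant. If \<alpha> is off the axes, the
  values of B that belong to zeros never occur on an edge. If \<alpha> is real, they are of the kind
  taken on the real edge, and a whole interval may share one value. The pair F = G = 1 needs
  separate treatment, since Im L' = 0 everywhere in that case; the function then has a single
  zero.\<close>

definition neg_prod :: "(nat \<Rightarrow> real) \<Rightarrow> complex \<Rightarrow> complex" where
  "neg_prod s w = (\<Prod>n. 1 + of_real (s n) * w)"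

definition log_neg_prod :: "(nat \<Rightarrow> real) \<Rightarrow> complex \<Rightarrow> complex" where
  "log_neg_prod s \<zeta> = (\<Sum>n. Ln (1 + of_real (s n) * exp \<zeta>))"

definition log_deriv_neg_prod :: "(nat \<Rightarrow> real) \<Rightarrow> complex \<Rightarrow> complex" where
  "log_deriv_neg_prod s w = (\<Sum>n. of_real (s n) * w / (1 + of_real (s n) * w))"

section \<open>The logarithm of one factor on a closed strip\<close>

lemma Ln_upper_half_plane:
  assumes "Im x \<ge> 0" "x \<noteq> 0"
  shows "Ln x = Ln (- \<i> * x) + \<i> * pi / 2"
proof (rule Ln_unique)
  have nz: "- \<i> * x \<noteq> 0" using assms by simp
  show "exp (Ln (- \<i> * x) + \<i> * pi / 2) = x"
    using nz by (simp add: exp_add exp_Euler[of "pi/2", simplified] cis_conv_exp[symmetric])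
      (metis cis_conv_exp cis_pi_half mult.commute mult_minus_left complex_i_mult_minus times_divide_eq_right of_real_divide of_real_numeral minus_minus)
  have "Re (- \<i> * x) \<ge> 0" using assms by simp
  hence "\<bar>Im (Ln (- \<i> * x))\<bar> \<le> pi/2" using nz Re_Ln_pos_le by blast
  thus "- pi < Im (Ln (- \<i> * x) + \<i> * pi / 2)" "Im (Ln (- \<i> * x) + \<i> * pi / 2) \<le> pi"
    using pi_gt_zero by (auto simp: field_simps abs_le_iff, linarith)
qed

text \<open>Rotation by -\<i> carries the closed upper half-plane to the closed right half-plane,
  away from the branch cut. The negative axis is included because \<open>Ln\<close> gives it the
  argument pi, which is the limit from above.\<close>

lemma continuous_on_Ln_upper_half_plane:
  "continuous_on {x. Im x \<ge> 0 \<and> x \<noteq> 0} Ln"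
proof -
  have "continuous_on {x. Im x \<ge> 0 \<and> x \<noteq> 0} (\<lambda>x. Ln (- \<i> * x) + \<i> * pi / 2)"
    by (intro continuous_intros) (auto simp: complex_nonpos_Reals_iff complex_eq_iff)
  thus ?thesis
    by (rule continuous_on_eq) (use Ln_upper_half_plane in auto)
qed

lemma Im_mult_of_real: "Im (x * of_real r) = Im x * r"
  by simp

lemma Im_exp_nonneg: "0 \<le> Im \<zeta> \<Longrightarrow> Im \<zeta> \<le> pi \<Longrightarrow> Im (exp \<zeta>) \<ge> 0"
  by (simp add: Im_exp sin_ge_zero)

lemma Im_exp_pos: "0 < Im \<zeta> \<Longrightarrow> Im \<zeta> < pi \<Longrightarrow> Im (exp \<zeta>) > 0"
  by (simp add: Im_exp sin_gt_zero)

text \<open>Numerator times conjugated denominator is a w + a^2 |w|^2, whose second term is real.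
  For w = exp \<zeta> the fraction is the derivative of Ln (1 + a exp \<zeta>).\<close>

lemma Im_frac_add_one:
  assumes "1 + of_real a * w \<noteq> (0::complex)"
  shows "Im (of_real a * w / (1 + of_real a * w)) = a * Im w / (norm (1 + of_real a * w))\<^sup>2"
proof -
  have "Im (of_real a * w / (1 + of_real a * w)) = Im (of_real a * w * cnj (1 + of_real a * w)) / (norm (1 + of_real a * w))\<^sup>2"
    by (subst complex_div_cnj) (metis Im_divide_of_real of_real_power)
  also have "Im (of_real a * w * cnj (1 + of_real a * w)) = a * Im w"
    by (simp add: algebra_simps)
  finally show ?thesis .
qed

definition strip_dom :: "(nat \<Rightarrow> real) \<Rightarrow> complex set" where
  "strip_dom s = {\<zeta>. 0 \<le> Im \<zeta> \<and> Im \<zeta> \<le> pi \<and> (\<forall>n. 1 + of_real (s n) * exp \<zeta> \<noteq> 0)}"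

text \<open>Along the segment the derivative of \<open>m\<close> is |\<zeta>2 - \<zeta>1|^2 times
  the imaginary part of the derivative of the logarithm. The hypotheses \<open>nb\<close> keep the
  open segment inside the open strip, where this is positive by \<open>Im_frac_add_one\<close>. The
  end points may lie on an edge; there continuity is enough.\<close>

lemma Ln_factor_pos:
  assumes a: "a > 0" and ne: "\<zeta>1 \<noteq> \<zeta>2"
    and I1: "0 \<le> Im \<zeta>1" "Im \<zeta>1 \<le> pi" and I2: "0 \<le> Im \<zeta>2" "Im \<zeta>2 \<le> pi"
    and nb: "\<not> (Im \<zeta>1 = 0 \<and> Im \<zeta>2 = 0)" "\<not> (Im \<zeta>1 = pi \<and> Im \<zeta>2 = pi)"
    and nz: "1 + of_real a * exp \<zeta>1 \<noteq> 0" "1 + of_real a * exp \<zeta>2 \<noteq> 0"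
  shows "Im ((Ln (1 + of_real a * exp \<zeta>2) - Ln (1 + of_real a * exp \<zeta>1)) * cnj (\<zeta>2 - \<zeta>1)) > 0"
proof -
  define \<gamma> where "\<gamma> = (\<lambda>\<tau>::real. \<zeta>1 + of_real \<tau> * (\<zeta>2 - \<zeta>1))"
  define m where "m = (\<lambda>\<tau>. Im (Ln (1 + of_real a * exp (\<gamma> \<tau>)) * cnj (\<zeta>2 - \<zeta>1)))"
  have Im\<gamma>: "Im (\<gamma> \<tau>) = (1 - \<tau>) * Im \<zeta>1 + \<tau> * Im \<zeta>2" for \<tau>
    by (simp add: \<gamma>_def algebra_simps)
  have int: "0 < Im (\<gamma> \<tau>)" "Im (\<gamma> \<tau>) < pi" if "0 < \<tau>" "\<tau> < 1" for \<tau>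
  proof -
    have "0 < (1 - \<tau>) * Im \<zeta>1 + \<tau> * Im \<zeta>2"
    proof (cases "Im \<zeta>1 = 0")
      case True thus ?thesis using nb I2 that by simp
    next
      case False
      thus ?thesis using I1 I2 that by (intro add_pos_nonneg) auto
    qed
    thus "0 < Im (\<gamma> \<tau>)" by (simp add: Im\<gamma>)
    have "0 < (1 - \<tau>) * (pi - Im \<zeta>1) + \<tau> * (pi - Im \<zeta>2)"
    proof (cases "Im \<zeta>1 = pi")
      case True thus ?thesis using nb I2 that by simp
    next
      case False
      thus ?thesis using I1 I2 that by (intro add_pos_nonneg) auto
    qed
    thus "Im (\<gamma> \<tau>) < pi" by (simp add: Im\<gamma> algebra_simps)
  qed
  have cl: "0 \<le> Im (\<gamma> \<tau>)" "Im (\<gamma> \<tau>) \<le> pi" "1 + of_real a * exp (\<gamma> \<tau>) \<noteq> 0"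
      if tau: "0 \<le> \<tau>" "\<tau> \<le> 1" for \<tau>
  proof -
    consider "\<tau> = 0" | "\<tau> = 1" | "0 < \<tau>" "\<tau> < 1" using tau by linarith
    hence "0 \<le> Im (\<gamma> \<tau>) \<and> Im (\<gamma> \<tau>) \<le> pi \<and> 1 + of_real a * exp (\<gamma> \<tau>) \<noteq> 0"
    proof cases
      case 3
      have "Im (1 + of_real a * exp (\<gamma> \<tau>)) > 0" using Im_exp_pos[OF int[OF 3]] a by simp
      hence "1 + of_real a * exp (\<gamma> \<tau>) \<noteq> 0" by (metis less_irrefl zero_complex.sel(2))
      thus ?thesis using int[OF 3] by linarith
    qed (use I1 I2 nz in \<open>auto simp: \<gamma>_def\<close>)
    thus "0 \<le> Im (\<gamma> \<tau>)" "Im (\<gamma> \<tau>) \<le> pi" "1 + of_real a * exp (\<gamma> \<tau>) \<noteq> 0" by auto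
  qed
  have "m 0 < m 1"
  proof (rule DERIV_pos_imp_increasing_open[where f = m])
    fix \<tau> :: real assume t: "0 < \<tau>" "\<tau> < 1"
    have Ipos: "Im (1 + of_real a * exp (\<gamma> \<tau>)) > 0" using Im_exp_pos[OF int[OF t]] a by simp
    have nn: "1 + of_real a * exp (\<gamma> \<tau>) \<notin> \<real>\<^sub>\<le>\<^sub>0" 
      using Ipos by (auto simp: complex_nonpos_Reals_iff)
    define D where "D = (of_real a * (exp (\<gamma> \<tau>) * (\<zeta>2 - \<zeta>1)) / (1 + of_real a * exp (\<gamma> \<tau>))) * cnj (\<zeta>2 - \<zeta>1)"
    have "(\<gamma> has_vector_derivative (\<zeta>2 - \<zeta>1)) (at \<tau>)"
      unfolding \<gamma>_def by (auto intro!: derivative_eq_intros)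
    moreover have "((\<lambda>x. Ln (1 + of_real a * exp x)) has_field_derivative
        (of_real a * exp (\<gamma> \<tau>) / (1 + of_real a * exp (\<gamma> \<tau>)))) (at (\<gamma> \<tau>))"
      using nn by (auto intro!: derivative_eq_intros simp: field_simps)
    ultimately have "((\<lambda>x. Ln (1 + of_real a * exp (\<gamma> x))) has_vector_derivative
        ((\<zeta>2 - \<zeta>1) * (of_real a * exp (\<gamma> \<tau>) / (1 + of_real a * exp (\<gamma> \<tau>))))) (at \<tau>)"
      using field_vector_diff_chain_at[of \<gamma> "\<zeta>2 - \<zeta>1" \<tau> "\<lambda>x. Ln (1 + of_real a * exp x)"]
      unfolding o_def by blast
    hence "((\<lambda>x. Ln (1 + of_real a * exp (\<gamma> x)) * cnj (\<zeta>2 - \<zeta>1)) has_vector_derivative D) (at \<tau>)"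
      by (rule has_vector_derivative_eq_rhs[OF has_vector_derivative_mult_left]) (simp add: D_def mult_ac)
    hence "(m has_vector_derivative Im D) (at \<tau>)"
      unfolding m_def by (rule bounded_linear.has_vector_derivative[OF bounded_linear_Im])
    hence "(m has_real_derivative Im D) (at \<tau>)"
      by (simp add: has_real_derivative_iff_has_vector_derivative)
    moreover have "Im D > 0"
    proof -
      have "D = (of_real a * exp (\<gamma> \<tau>) / (1 + of_real a * exp (\<gamma> \<tau>))) * ((\<zeta>2 - \<zeta>1) * cnj (\<zeta>2 - \<zeta>1))"
        by (simp add: D_def mult_ac)
      also have "(\<zeta>2 - \<zeta>1) * cnj (\<zeta>2 - \<zeta>1) = of_real ((norm (\<zeta>2 - \<zeta>1))\<^sup>2)"
        by (metis complex_norm_square of_real_power)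
      finally have "Im D = Im (of_real a * exp (\<gamma> \<tau>) / (1 + of_real a * exp (\<gamma> \<tau>))) * (norm (\<zeta>2 - \<zeta>1))\<^sup>2"
        using Im_mult_of_real by metis
      also have "\<dots> > 0"
        using ne a Im_exp_pos[OF int[OF t]] cl[of \<tau>] t
        by (subst Im_frac_add_one) auto
      finally show ?thesis .
    qed
    ultimately show "\<exists>y. DERIV m \<tau> :> y \<and> y > 0" by blast
  next
    have "continuous_on {0..1} (\<lambda>\<tau>. Ln (1 + of_real a * exp (\<gamma> \<tau>)))"
    proof (rule continuous_on_compose2[OF continuous_on_Ln_upper_half_plane])
      show "continuous_on {0..1} (\<lambda>\<tau>. 1 + of_real a * exp (\<gamma> \<tau>))"
        unfolding \<gamma>_def by (intro continuous_intros)
      show "(\<lambda>\<tau>. 1 + of_real a * exp (\<gamma> \<tau>)) ` {0..1} \<subseteq> {x. 0 \<le> Im x \<and> x \<noteq> 0}"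
        using cl Im_exp_nonneg a by (auto simp del: Im_exp)
    qed
    thus "continuous_on {0..1} m"
      unfolding m_def by (intro continuous_on_Im continuous_on_mult continuous_on_const)
  qed simp
  thus ?thesis by (simp add: m_def \<gamma>_def algebra_simps)
qed

section \<open>One product: convergence, logarithm and boundary values\<close>

locale neg_prod_seq =
  fixes s :: "nat \<Rightarrow> real"
  assumes s_nonneg: "s n \<ge> 0" and s_summable: "summable s"
begin

abbreviation fac :: "nat \<Rightarrow> complex \<Rightarrow> complex" where "fac n w \<equiv> 1 + of_real (s n) * w"

lemma eventually_small: "eventually (\<lambda>n. s n * c < 1/2) sequentially"
proof -
  have "(\<lambda>n. s n * c) \<longlonglongrightarrow> 0 * c"
    by (intro tendsto_intros summable_LIMSEQ_zero s_summable)
  thus ?thesis by (rule order_tendstoD) simp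
qed

lemma abs_convergent: "abs_convergent_prod (\<lambda>n. fac n w)"
proof -
  have "summable (\<lambda>n. norm (of_real (s n) * w))"
    using summable_mult2[OF s_summable, of "norm w"] s_nonneg by (simp add: norm_mult)
  thus ?thesis by (simp add: abs_convergent_prod_conv_summable)
qed

lemma convergent: "convergent_prod (\<lambda>n. fac n w)"
  by (rule abs_convergent_prod_imp_convergent_prod[OF abs_convergent])

lemma neg_prod_LIMSEQ: "(\<lambda>n. \<Prod>k<n. fac k w) \<longlonglongrightarrow> neg_prod s w"
  using convergent_prod_LIMSEQ[OF convergent[of w]] unfolding neg_prod_def
  using LIMSEQ_lessThan_iff_atMost by metis

lemma neg_prod_eq_0_iff: "neg_prod s w = 0 \<longleftrightarrow> (\<exists>n. fac n w = 0)"
  using has_prod_eq_0_iff[OF convergent_prod_has_prod[OF convergent[of w]]]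
  unfolding neg_prod_def by (simp only: image_iff bex_UNIV eq_commute[of 0])

lemma uniform_limit_neg_prod:
  "uniform_limit (cball 0 R) (\<lambda>n w. \<Prod>k<n. fac k w) (neg_prod s) sequentially"
proof -
  have "uniformly_convergent_on (cball 0 R) (\<lambda>N w. \<Sum>n<N. norm (of_real (s n) * (w::complex)))"
  proof (rule Weierstrass_m_test')
    show "norm (norm (of_real (s n) * (w::complex))) \<le> s n * \<bar>R\<bar>" if "w \<in> cball 0 R" for n w
      using that s_nonneg[of n] by (auto simp: norm_mult intro!: mult_left_mono)
    show "summable (\<lambda>n. s n * \<bar>R\<bar>)" by (intro summable_mult2 s_summable)
  qed
  hence "uniformly_convergent_on (cball 0 R) (\<lambda>N w. \<Prod>n<N. fac n w)"
    by (intro uniformly_convergent_on_prod) (auto intro!: continuous_intros)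
  then obtain l where l: "uniform_limit (cball 0 R) (\<lambda>N w. \<Prod>n<N. fac n w) l sequentially"
    unfolding uniformly_convergent_on_def by blast
  have "l w = neg_prod s w" if "w \<in> cball 0 R" for w
    using tendsto_uniform_limitI[OF l that] neg_prod_LIMSEQ[of w] LIMSEQ_unique by blast
  with l show ?thesis by (metis (no_types, lifting) uniform_limit_cong')
qed

lemma holomorphic_neg_prod: "neg_prod s holomorphic_on A"
proof -
  have "neg_prod s holomorphic_on ball 0 R" for R
    by (rule holomorphic_uniform_limit[where f = "\<lambda>n w. \<Prod>k<n. fac k w" and F = sequentially])
      (auto intro!: always_eventually continuous_intros holomorphic_intros uniform_limit_neg_prod)
  hence "neg_prod s field_differentiable at w" for w
    by (rule holomorphic_on_imp_differentiable_at[of _ "ball 0 (norm w + 1)"]) auto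
  thus ?thesis by (auto simp: holomorphic_on_def intro: field_differentiable_at_within)
qed

lemma neg_prod_cnj: "neg_prod s (cnj w) = cnj (neg_prod s w)"
proof (rule LIMSEQ_unique[OF neg_prod_LIMSEQ])
  have "(\<lambda>n. cnj (\<Prod>k<n. fac k w)) \<longlonglongrightarrow> cnj (neg_prod s w)"
    by (intro tendsto_intros neg_prod_LIMSEQ)
  thus "(\<lambda>n. \<Prod>k<n. 1 + of_real (s k) * cnj w) \<longlonglongrightarrow> cnj (neg_prod s w)"
    by (simp add: cnj_prod)
qed

lemma neg_prod_0: "neg_prod s 0 = 1"
  by (simp add: neg_prod_def)

lemma strip_dom_iff: "\<zeta> \<in> strip_dom s \<longleftrightarrow> 0 \<le> Im \<zeta> \<and> Im \<zeta> \<le> pi \<and> neg_prod s (exp \<zeta>) \<noteq> 0"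
  by (auto simp: strip_dom_def neg_prod_eq_0_iff)

lemma Im_arg_nonneg: "\<zeta> \<in> strip_dom s \<Longrightarrow> Im (fac n (exp \<zeta>)) \<ge> 0"
  using s_nonneg Im_exp_nonneg by (auto simp: strip_dom_def simp del: Im_exp)

lemma norm_Ln_factor_le:
  assumes "s n * exp c < 1/2" "Re \<zeta> \<le> c"
  shows "norm (Ln (fac n (exp \<zeta>))) \<le> 2 * (s n * exp c)"
proof -
  have "norm (of_real (s n) * exp \<zeta>) \<le> s n * exp c"
    using assms s_nonneg by (auto simp: norm_mult intro!: mult_left_mono)
  moreover have "norm (Ln (fac n (exp \<zeta>))) \<le> 2 * norm (of_real (s n) * exp \<zeta>)"
    by (rule norm_Ln_le) (use calculation assms in linarith)
  ultimately show ?thesis by linarith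
qed

text \<open>For fixed c only finitely many terms fail s n * exp c < 1/2, so the M-test applies
  eventually. The half-plane may contain zeros of the product; they matter only for continuity and
  for \<open>exp_log_neg_prod\<close>.\<close>

lemma uniform_limit_log_neg_prod:
  "uniform_limit {\<zeta>. Re \<zeta> \<le> c} (\<lambda>n \<zeta>. \<Sum>k<n. Ln (fac k (exp \<zeta>))) (log_neg_prod s) sequentially"
  unfolding log_neg_prod_def
proof (rule Weierstrass_m_test_ev)
  show "\<forall>\<^sub>F n in sequentially. \<forall>x\<in>{\<zeta>. Re \<zeta> \<le> c}. norm (Ln (fac n (exp x))) \<le> 2 * (s n * exp c)"
    using eventually_small[of "exp c"] by eventually_elim (use norm_Ln_factor_le in auto)
  show "summable (\<lambda>n. 2 * (s n * exp c))" by (intro summable_mult summable_mult2 s_summable)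
qed

lemma log_neg_prod_sums: "(\<lambda>n. Ln (fac n (exp \<zeta>))) sums log_neg_prod s \<zeta>"
  unfolding sums_def
  by (rule tendsto_uniform_limitI[OF uniform_limit_log_neg_prod[of "Re \<zeta>"]]) simp

lemma exp_log_neg_prod: 
  assumes "neg_prod s (exp \<zeta>) \<noteq> 0"
  shows "exp (log_neg_prod s \<zeta>) = neg_prod s (exp \<zeta>)"
proof -
  have nz: "fac n (exp \<zeta>) \<noteq> 0" for n
    using assms by (auto simp: neg_prod_eq_0_iff)
  have "(\<lambda>n. exp (\<Sum>k<n. Ln (fac k (exp \<zeta>)))) \<longlonglongrightarrow> exp (log_neg_prod s \<zeta>)"
    using log_neg_prod_sums unfolding sums_def by (intro tendsto_intros)
  moreover have "exp (\<Sum>k<n. Ln (fac k (exp \<zeta>))) = (\<Prod>k<n. fac k (exp \<zeta>))" for n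
    by (simp add: exp_sum nz)
  ultimately show ?thesis using neg_prod_LIMSEQ[of "exp \<zeta>"] LIMSEQ_unique by fastforce
qed

text \<open>Each factor stays in the closed upper half-plane and off 0, so the partial sums are
  continuous, and on left half-planes their limit is uniform. Continuity being local, the half-plane
  up to Re \<zeta> + 1 suffices at \<zeta>.\<close>

lemma continuous_on_log_neg_prod: "continuous_on (strip_dom s) (log_neg_prod s)"
proof -
  have c: "continuous_on (strip_dom s \<inter> {\<zeta>. Re \<zeta> \<le> c}) (log_neg_prod s)" for c
  proof (rule uniform_limit_theorem)
    show "uniform_limit (strip_dom s \<inter> {\<zeta>. Re \<zeta> \<le> c}) (\<lambda>n \<zeta>. \<Sum>k<n. Ln (fac k (exp \<zeta>)))
       (log_neg_prod s) sequentially"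
      by (rule uniform_limit_on_subset[OF uniform_limit_log_neg_prod[of c]]) auto
    have "continuous_on (strip_dom s \<inter> {\<zeta>. Re \<zeta> \<le> c}) (\<lambda>\<zeta>. Ln (fac k (exp \<zeta>)))" for k
    proof (rule continuous_on_compose2[OF continuous_on_Ln_upper_half_plane])
      show "(\<lambda>\<zeta>. fac k (exp \<zeta>)) ` (strip_dom s \<inter> {\<zeta>. Re \<zeta> \<le> c}) \<subseteq> {x. 0 \<le> Im x \<and> x \<noteq> 0}"
        using Im_arg_nonneg[of _ k] by (auto simp: strip_dom_def simp del: Im_exp)
    qed (intro continuous_intros)
    thus "\<forall>\<^sub>F n in sequentially. continuous_on (strip_dom s \<inter> {\<zeta>. Re \<zeta> \<le> c})
        (\<lambda>\<zeta>. \<Sum>k<n. Ln (fac k (exp \<zeta>)))"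
      by (intro always_eventually allI continuous_on_sum)
  qed simp
  show ?thesis
    unfolding continuous_on_eq_continuous_within
  proof
    fix \<zeta> assume z: "\<zeta> \<in> strip_dom s"
    have "at \<zeta> within (strip_dom s \<inter> {x. Re x \<le> Re \<zeta> + 1}) = at \<zeta> within strip_dom s"
      by (rule at_within_nhd[of _ "{x. Re x < Re \<zeta> + 1}"]) (auto intro: open_halfspace_Re_lt)
    thus "continuous (at \<zeta> within strip_dom s) (log_neg_prod s)"
      using c[of "Re \<zeta> + 1"] z unfolding continuous_on_eq_continuous_within
      by (metis (mono_tags, lifting) IntI continuous_within less_add_one mem_Collect_eq order_less_imp_le)
  qed
qed

text \<open>A factor with s n > 0 contributes a positive term and one with s n = 0 contributes
  nothing, so the inequality stays strict in the sum as soon as one s n is nonzero.\<close>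

lemma log_neg_prod_pos:
  assumes ex: "\<exists>n. s n \<noteq> 0" and ne: "\<zeta>1 \<noteq> \<zeta>2"
    and d: "\<zeta>1 \<in> strip_dom s" "\<zeta>2 \<in> strip_dom s"
    and nb: "\<not> (Im \<zeta>1 = 0 \<and> Im \<zeta>2 = 0)" "\<not> (Im \<zeta>1 = pi \<and> Im \<zeta>2 = pi)"
  shows "Im ((log_neg_prod s \<zeta>2 - log_neg_prod s \<zeta>1) * cnj (\<zeta>2 - \<zeta>1)) > 0"
proof -
  define t where "t = (\<lambda>n. Im ((Ln (fac n (exp \<zeta>2)) - Ln (fac n (exp \<zeta>1))) * cnj (\<zeta>2 - \<zeta>1)))"
  have S: "t sums Im ((log_neg_prod s \<zeta>2 - log_neg_prod s \<zeta>1) * cnj (\<zeta>2 - \<zeta>1))"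
    unfolding t_def by (intro sums_Im sums_mult2 sums_diff log_neg_prod_sums)
  have pos: "t n > 0" if "s n \<noteq> 0" for n
    unfolding t_def
    by (rule Ln_factor_pos) (use that s_nonneg[of n] ne d nb in \<open>auto simp: strip_dom_def\<close>)
  have "t n \<ge> 0" for n
    using pos[of n] by (cases "s n = 0") (auto simp: t_def)
  moreover obtain i where "s i \<noteq> 0" using ex by blast
  ultimately have "suminf t > 0"
    using pos[of i] S by (intro suminf_pos2[of _ i]) (auto simp: sums_iff)
  thus ?thesis using S by (simp add: sums_iff)
qed

lemma log_neg_prod_zero: "\<forall>n. s n = 0 \<Longrightarrow> log_neg_prod s \<zeta> = 0"
  by (simp add: log_neg_prod_def)

lemma neg_prod_trivial: "\<forall>n. s n = 0 \<Longrightarrow> neg_prod s w = 1"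
  by (simp add: neg_prod_def)

lemma Im_log_neg_prod_real: "Im \<zeta> = 0 \<Longrightarrow> Im (log_neg_prod s \<zeta>) = 0"
proof -
  assume z: "Im \<zeta> = 0"
  have "Im (Ln (fac n (exp \<zeta>))) = 0" for n
  proof -
    have "fac n (exp \<zeta>) = of_real (1 + s n * exp (Re \<zeta>))"
      using z by (simp add: complex_eq_iff Re_exp Im_exp)
    moreover have "1 + s n * exp (Re \<zeta>) > 0" using s_nonneg[of n] by (simp add: add_pos_nonneg)
    ultimately show ?thesis by (metis Im_complex_of_real Ln_of_real)
  qed
  moreover have "(\<lambda>n. Im (Ln (fac n (exp \<zeta>)))) sums Im (log_neg_prod s \<zeta>)"
    by (intro sums_Im log_neg_prod_sums)
  ultimately show ?thesis by (simp add: sums_iff)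
qed

lemma exp_Im_pi: "Im \<zeta> = pi \<Longrightarrow> exp \<zeta> = - of_real (exp (Re \<zeta>))"
  by (simp add: complex_eq_iff Re_exp Im_exp)

lemma Im_Ln_real: "x \<noteq> 0 \<Longrightarrow> Im (Ln (of_real x)) = (if x < 0 then pi else 0)"
  by (simp add: Im_Ln_eq_pi)

text \<open>On this edge exp \<zeta> is negative and the factors are real; a factor has argument pi
  once it has become negative. The sum therefore counts, in units of pi, the zeros between 0 and exp
  \<zeta>.\<close>

lemma Im_log_neg_prod_pi_sums:
  assumes "Im \<zeta> = pi" and d: "\<zeta> \<in> strip_dom s"
  shows "(\<lambda>n. if s n * exp (Re \<zeta>) > 1 then pi else 0) sums Im (log_neg_prod s \<zeta>)"
proof -
  have "Im (Ln (fac n (exp \<zeta>))) = (if s n * exp (Re \<zeta>) > 1 then pi else 0)" for n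
  proof -
    have "fac n (exp \<zeta>) = of_real (1 - s n * exp (Re \<zeta>))"
      using exp_Im_pi[OF assms(1)] by simp
    moreover from this have "1 - s n * exp (Re \<zeta>) \<noteq> 0"
      using d unfolding strip_dom_def by (metis (mono_tags, lifting) mem_Collect_eq of_real_0)
    ultimately show ?thesis using Im_Ln_real[of "1 - s n * exp (Re \<zeta>)"] by simp
  qed
  moreover have "(\<lambda>n. Im (Ln (fac n (exp \<zeta>)))) sums Im (log_neg_prod s \<zeta>)"
    by (intro sums_Im log_neg_prod_sums)
  ultimately show ?thesis by simp
qed

lemma Im_log_neg_prod_pi_mono:
  assumes "Im \<zeta>1 = pi" "Im \<zeta>2 = pi" "Re \<zeta>1 \<le> Re \<zeta>2" "\<zeta>1 \<in> strip_dom s" "\<zeta>2 \<in> strip_dom s"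
  shows "Im (log_neg_prod s \<zeta>1) \<le> Im (log_neg_prod s \<zeta>2)"
proof (rule sums_le[OF _ Im_log_neg_prod_pi_sums[OF assms(1,4)] Im_log_neg_prod_pi_sums[OF assms(2,5)]])
  fix n
  have "s n * exp (Re \<zeta>1) \<le> s n * exp (Re \<zeta>2)"
    using assms s_nonneg[of n] by (intro mult_left_mono) auto
  thus "(if s n * exp (Re \<zeta>1) > 1 then pi else 0) \<le> (if s n * exp (Re \<zeta>2) > 1 then pi else 0)" by auto
qed

lemma Im_log_neg_prod_pi_int:
  assumes "Im \<zeta> = pi" "\<zeta> \<in> strip_dom s"
  shows "\<exists>k::nat. Im (log_neg_prod s \<zeta>) = of_nat k * pi"
proof -
  define A where "A = {n. s n * exp (Re \<zeta>) > 1}"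
  have "eventually (\<lambda>n. n \<notin> A) sequentially"
    using eventually_small[of "exp (Re \<zeta>)"] by eventually_elim (auto simp: A_def)
  hence fin: "finite A"
    by (metis (mono_tags, lifting) eventually_sequentially finite_nat_set_iff_bounded not_le_imp_less)
  have "(\<lambda>n. if s n * exp (Re \<zeta>) > 1 then pi else 0) sums (\<Sum>n\<in>A. pi)"
    unfolding A_def by (rule sums_If_finite) (use fin A_def in simp)
  hence "Im (log_neg_prod s \<zeta>) = of_nat (card A) * pi"
    using Im_log_neg_prod_pi_sums[OF assms] by (simp add: sums_iff)
  thus ?thesis by blast
qed

lemma Im_log_neg_prod_pi_initial:
  "\<exists>\<rho>0. \<forall>\<zeta>. Im \<zeta> = pi \<longrightarrow> Re \<zeta> \<le> \<rho>0 \<longrightarrow> Im (log_neg_prod s \<zeta>) = 0 \<and> neg_prod s (exp \<zeta>) \<noteq> 0"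
proof -
  \<comment> \<open>The sum bounds every s n; adding 1 makes the bound strict and M positive. For
    exp (Re \<zeta>) \<le> 1 / M no factor has changed sign yet.\<close>
  define M where "M = suminf s + 1"
  have M: "s n < M" for n
    using sum_le_suminf[OF s_summable, of "{n}"] s_nonneg by (simp add: M_def)
  have M0: "M > 0" using M[of 0] s_nonneg[of 0] by linarith
  have le: "s n * exp (Re \<zeta>) < 1" if "Re \<zeta> \<le> - ln M" for n \<zeta>
  proof -
    have "exp (Re \<zeta>) \<le> 1 / M" using that M0 by (metis exp_le_cancel_iff exp_ln exp_minus inverse_eq_divide)
    hence "s n * exp (Re \<zeta>) \<le> s n * (1 / M)" using s_nonneg by (intro mult_left_mono) auto
    also have "\<dots> < 1" using M[of n] M0 by simp
    finally show ?thesis .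
  qed
  show ?thesis
  proof (intro exI[of _ "- ln M"] allI impI conjI)
    fix \<zeta> assume z: "Im \<zeta> = pi" "Re \<zeta> \<le> - ln M"
    show nz: "neg_prod s (exp \<zeta>) \<noteq> 0"
    proof
      assume "neg_prod s (exp \<zeta>) = 0"
      then obtain n where "fac n (exp \<zeta>) = 0" by (auto simp: neg_prod_eq_0_iff)
      hence "of_real (1 - s n * exp (Re \<zeta>)) = (0::complex)" using exp_Im_pi[OF z(1)] by simp
      thus False using le[OF z(2), of n] by (metis diff_eq_eq add_0 less_irrefl of_real_eq_0_iff)
    qed
    have "\<zeta> \<in> strip_dom s" using nz z by (simp add: strip_dom_iff)
    moreover have "\<not> 1 < s n * exp (Re \<zeta>)" for n using le[OF z(2), of n] by linarith
    ultimately show "Im (log_neg_prod s \<zeta>) = 0"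
      using Im_log_neg_prod_pi_sums[OF z(1)] by (simp add: sums_iff)
  qed
qed

lemma neg_prod_nz: "0 \<le> Im \<zeta> \<Longrightarrow> Im \<zeta> < pi \<Longrightarrow> neg_prod s (exp \<zeta>) \<noteq> 0"
proof
  assume I: "0 \<le> Im \<zeta>" "Im \<zeta> < pi" and "neg_prod s (exp \<zeta>) = 0"
  then obtain n where n: "fac n (exp \<zeta>) = 0" by (auto simp: neg_prod_eq_0_iff)
  hence "Im (fac n (exp \<zeta>)) = 0" "s n \<noteq> 0" by auto
  hence "sin (Im \<zeta>) = 0" by (simp add: Im_exp)
  hence "Im \<zeta> = 0" using I sin_gt_zero[of "Im \<zeta>"] by linarith
  hence "Re (fac n (exp \<zeta>)) > 0" using s_nonneg[of n] by (simp add: Re_exp add_pos_nonneg)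
  thus False using n by simp
qed

text \<open>This is \<open>log_neg_prod_pos\<close> on a vertical segment: the conjugated increment
  is -\<i> (\<psi>2 - \<psi>1), which turns the statement into one on the real part of the
  logarithm, that is, on the modulus.\<close>

lemma norm_neg_prod_strict_decreasing:
  assumes ex: "\<exists>n. s n \<noteq> 0" and I: "0 \<le> \<psi>1" "\<psi>1 < \<psi>2" "\<psi>2 \<le> pi"
  shows "norm (neg_prod s (exp (Complex \<rho> \<psi>2))) < norm (neg_prod s (exp (Complex \<rho> \<psi>1)))"
proof -
  have nz1: "neg_prod s (exp (Complex \<rho> \<psi>1)) \<noteq> 0" using I by (intro neg_prod_nz) auto
  show ?thesis
  proof (cases "neg_prod s (exp (Complex \<rho> \<psi>2)) = 0")
    case True thus ?thesis using nz1 by simp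
  next
    case False
    have "Im ((log_neg_prod s (Complex \<rho> \<psi>2) - log_neg_prod s (Complex \<rho> \<psi>1)) * cnj (Complex \<rho> \<psi>2 - Complex \<rho> \<psi>1)) > 0"
      using I nz1 False by (intro log_neg_prod_pos ex) (auto simp: strip_dom_iff)
    hence "(Re (log_neg_prod s (Complex \<rho> \<psi>1)) - Re (log_neg_prod s (Complex \<rho> \<psi>2))) * (\<psi>2 - \<psi>1) > 0"
      by (simp add: algebra_simps)
    hence "Re (log_neg_prod s (Complex \<rho> \<psi>1)) > Re (log_neg_prod s (Complex \<rho> \<psi>2))"
      using I by (simp add: zero_less_mult_iff)
    thus ?thesis
      using exp_log_neg_prod[OF nz1] exp_log_neg_prod[OF False] by (metis exp_less_mono norm_exp_eq_Re)
  qed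
qed

section \<open>Logarithmic derivative of one product\<close>

lemma open_neg_prod_nonzero: "open {w. neg_prod s w \<noteq> 0}"
proof -
  have "continuous_on UNIV (neg_prod s)"
    using holomorphic_neg_prod holomorphic_on_imp_continuous_on by blast
  thus ?thesis by (intro open_Collect_neq continuous_on_const)
qed

lemma log_deriv_summable:
  assumes "neg_prod s w \<noteq> 0"
  shows "(\<lambda>k. of_real (s k) / (fac k w)) sums (deriv (neg_prod s) w / neg_prod s w)"
proof -
  have d: "deriv (\<lambda>w. 1 + of_real a * w) w = of_real a" for a
    by (rule DERIV_imp_deriv) (auto intro!: derivative_eq_intros)
  have "(\<lambda>k. deriv (\<lambda>w. fac k w) w / (fac k w)) sums (deriv (neg_prod s) w / neg_prod s w)"
  proof (rule logderiv_prodinf_complex_uniform_limit[where A = "ball 0 (norm w + 1)"])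
    show "uniform_limit (ball 0 (norm w + 1)) (\<lambda>n x. \<Prod>k<n. fac k x) (neg_prod s) sequentially"
      by (rule uniform_limit_on_subset[OF uniform_limit_neg_prod[of "norm w + 1"]]) auto
  qed (use assms in \<open>auto intro!: holomorphic_intros\<close>)
  thus ?thesis by (simp add: d)
qed

text \<open>The factor w is kept because w d/dw is differentiation with respect to log w, the
  variable of the strip.\<close>

lemma log_deriv_neg_prod_sums:
  assumes "neg_prod s w \<noteq> 0"
  shows "(\<lambda>k. of_real (s k) * w / (fac k w)) sums log_deriv_neg_prod s w"
    and "log_deriv_neg_prod s w = w * deriv (neg_prod s) w / neg_prod s w"
proof -
  have "(\<lambda>k. of_real (s k) * w / (fac k w)) sums (w * deriv (neg_prod s) w / neg_prod s w)"
    using sums_mult[OF log_deriv_summable[OF assms], of w] by (simp add: mult.commute)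
  thus "(\<lambda>k. of_real (s k) * w / (fac k w)) sums log_deriv_neg_prod s w"
    and "log_deriv_neg_prod s w = w * deriv (neg_prod s) w / neg_prod s w"
    by (auto simp: sums_iff log_deriv_neg_prod_def)
qed

lemma norm_log_deriv_term_le:
  assumes "s n * r < 1/2" "norm y \<le> r"
  shows "norm (of_real (s n) * (y::complex) / (fac n y)) \<le> 2 * (s n * r)"
proof -
  have le: "norm (of_real (s n) * y) \<le> s n * r"
    using assms s_nonneg by (auto simp: norm_mult intro!: mult_left_mono)
  have "norm (fac n y) \<ge> 1 - norm (of_real (s n) * y)"
    by (metis norm_diff_ineq norm_one)
  hence "norm (fac n y) \<ge> 1/2" using le assms by linarith
  hence "norm (of_real (s n) * y) / norm (fac n y) \<le> (s n * r) / (1/2)"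
    using le order_trans[OF norm_ge_zero le] by (intro frac_le) auto
  thus ?thesis unfolding norm_divide by simp
qed

text \<open>Termwise differentiation, with a majorant valid on the unit ball around each point. The
  series of the derivative is part of the conclusion because its sign at real points is read off in
  \<open>log_deriv_real\<close>.\<close>

lemma log_deriv_neg_prod_deriv:
  assumes "neg_prod s w \<noteq> 0"
  obtains d where "(log_deriv_neg_prod s has_field_derivative d) (at w)"
    "(\<lambda>n. of_real (s n) / (fac n w)\<^sup>2) sums d"
proof -
  define S where "S = {w. neg_prod s w \<noteq> 0}"
  have S: "open S" unfolding S_def by (rule open_neg_prod_nonzero)
  have nz: "fac n x \<noteq> 0" if "x \<in> S" for n x
    using that by (auto simp: S_def neg_prod_eq_0_iff)
  have "\<exists>g g'. \<forall>x\<in>S. ((\<lambda>n. of_real (s n) * x / (fac n x)) sums g x) \<and>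
      ((\<lambda>n. of_real (s n) / (fac n x)\<^sup>2) sums g' x) \<and> (g has_field_derivative g' x) (at x)"
  proof (rule series_and_derivative_comparison_complex[OF S])
    fix n x assume x: "x \<in> S"
    show "((\<lambda>x. of_real (s n) * x / (fac n x)) has_field_derivative
        of_real (s n) / (fac n x)\<^sup>2) (at x)"
      using nz[OF x, of n] by (auto intro!: derivative_eq_intros simp: field_simps power2_eq_square)
  next
    fix x assume x: "x \<in> S"
    define r where "r = norm x + 1"
    have "\<forall>\<^sub>F n in sequentially. \<forall>y\<in>ball x 1 \<inter> S.
        cmod (of_real (s n) * y / (fac n y)) \<le> cmod (of_real (2 * (s n * r)))"
      using eventually_small[of r]
    proof eventually_elim
      case (elim n)
      show ?case
      proof
        fix y assume y: "y \<in> ball x 1 \<inter> S"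
        hence "norm y \<le> r" using norm_triangle_ineq2[of y x] by (auto simp: r_def dist_norm norm_minus_commute)
        from norm_log_deriv_term_le[OF elim this] show "cmod (of_real (s n) * y / (fac n y)) \<le> cmod (of_real (2 * (s n * r)))"
          by (simp add: norm_of_real del: of_real_mult)
      qed
    qed
    moreover have "summable (\<lambda>n. complex_of_real (2 * (s n * r)))"
      by (intro summable_of_real summable_mult summable_mult2 s_summable)
    moreover have "range (\<lambda>n. complex_of_real (2 * (s n * r))) \<subseteq> \<real>\<^sub>\<ge>\<^sub>0"
      using s_nonneg by (auto simp: r_def simp del: of_real_mult intro!: mult_nonneg_nonneg)
    ultimately show "\<exists>d h. 0 < d \<and> summable h \<and> range h \<subseteq> \<real>\<^sub>\<ge>\<^sub>0 \<and>
        (\<forall>\<^sub>F n in sequentially. \<forall>y\<in>ball x d \<inter> S. cmod (of_real (s n) * y / (fac n y)) \<le> cmod (h n))"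
      by (intro exI[of _ 1] exI[of _ "\<lambda>n. complex_of_real (2 * (s n * r))"]) auto
  qed
  then obtain g g' where g: "\<And>x. x \<in> S \<Longrightarrow> (\<lambda>n. of_real (s n) * x / (fac n x)) sums g x"
    "\<And>x. x \<in> S \<Longrightarrow> (\<lambda>n. of_real (s n) / (fac n x)\<^sup>2) sums g' x"
    "\<And>x. x \<in> S \<Longrightarrow> (g has_field_derivative g' x) (at x)" by blast
  have w: "w \<in> S" using assms by (simp add: S_def)
  have "(log_deriv_neg_prod s has_field_derivative g' w) (at w)"
  proof (rule has_field_derivative_transform_within_open[OF g(3)[OF w] S w])
    fix x assume "x \<in> S"
    thus "g x = log_deriv_neg_prod s x" using g(1) by (simp add: log_deriv_neg_prod_def sums_iff)
  qed
  with g(2)[OF w] show thesis by (rule that[rotated])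
qed

lemma log_deriv_trivial: "\<forall>n. s n = 0 \<Longrightarrow> log_deriv_neg_prod s w = 0"
  by (simp add: log_deriv_neg_prod_def)

text \<open>By \<open>Im_frac_add_one\<close> no term has the sign opposite to that of Im w;
  multiplying by Im w treats both half-planes at once.\<close>

lemma Im_log_deriv_pos:
  assumes nz: "neg_prod s w \<noteq> 0" and ex: "\<exists>n. s n \<noteq> 0" and w: "Im w \<noteq> 0"
  shows "Im w * Im (log_deriv_neg_prod s w) > 0"
proof -
  have nz': "fac n w \<noteq> 0" for n using nz by (auto simp: neg_prod_eq_0_iff)
  have "(\<lambda>n. Im w * Im (of_real (s n) * w / (fac n w))) sums (Im w * Im (log_deriv_neg_prod s w))"
    by (intro sums_mult sums_Im log_deriv_neg_prod_sums nz)
  moreover have "Im w * Im (of_real (s n) * w / (fac n w)) = s n * (Im w)\<^sup>2 / (norm (fac n w))\<^sup>2" for n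
    by (subst Im_frac_add_one[OF nz']) (simp add: power2_eq_square)
  ultimately have S: "(\<lambda>n. s n * (Im w)\<^sup>2 / (norm (fac n w))\<^sup>2) sums (Im w * Im (log_deriv_neg_prod s w))"
    by simp
  obtain i where "s i \<noteq> 0" using ex by blast
  hence i: "s i > 0" using s_nonneg[of i] by linarith
  have "suminf (\<lambda>n. s n * (Im w)\<^sup>2 / (norm (fac n w))\<^sup>2) > 0"
    by (rule suminf_pos2[of _ i]) (use S i s_nonneg nz' w in \<open>auto simp: sums_iff\<close>)
  thus ?thesis using S by (simp add: sums_iff)
qed

text \<open>Here d is the derivative supplied by \<open>log_deriv_neg_prod_deriv\<close>. At a real
  point its terms have squared real denominators, so the logarithmic derivative increases along the
  real axis between zeros of the product. The convexity argument on the real axis rests on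
  this.\<close>

lemma log_deriv_real:
  assumes "(\<lambda>n. of_real (s n) / (1 + of_real (s n) * of_real x)\<^sup>2) sums (d::complex)"
    and nz: "neg_prod s (of_real x) \<noteq> 0"
  shows "Im d = 0" "Re d \<ge> 0" "(\<exists>n. s n \<noteq> 0) \<Longrightarrow> Re d > 0"
proof -
  have eq: "of_real (s n) / (1 + of_real (s n) * of_real x)\<^sup>2 = complex_of_real (s n / (1 + s n * x)\<^sup>2)" for n
    by simp
  have nz': "1 + s n * x \<noteq> 0" for n
    using nz unfolding neg_prod_eq_0_iff by (metis of_real_0 of_real_1 of_real_add of_real_mult)
  have R: "(\<lambda>n. s n / (1 + s n * x)\<^sup>2) sums Re d" and I: "(\<lambda>n. 0) sums Im d"
    using sums_Re[OF assms(1)] sums_Im[OF assms(1)] unfolding eq by simp_all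
  show "Im d = 0" using I by (simp add: sums_iff)
  show "Re d \<ge> 0"
    unfolding sums_unique[OF R] using s_nonneg by (intro suminf_nonneg sums_summable[OF R]) simp
  assume "\<exists>n. s n \<noteq> 0"
  then obtain i where "s i \<noteq> 0" by blast
  hence i: "s i > 0" using s_nonneg[of i] by linarith
  have "suminf (\<lambda>n. s n / (1 + s n * x)\<^sup>2) > 0"
    by (rule suminf_pos2[of _ i]) (use R i s_nonneg nz' in \<open>auto simp: sums_iff\<close>)
  thus "Re d > 0" using R by (simp add: sums_iff)
qed

lemma Im_log_deriv_real:
  assumes nz: "neg_prod s (of_real x) \<noteq> 0"
  shows "Im (log_deriv_neg_prod s (of_real x)) = 0"
proof -
  have eq: "of_real (s n) * of_real x / (1 + of_real (s n) * of_real x) = complex_of_real (s n * x / (1 + s n * x))" for n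
    by simp
  have "(\<lambda>n. 0) sums Im (log_deriv_neg_prod s (of_real x))"
    using sums_Im[OF log_deriv_neg_prod_sums(1)[OF nz]] unfolding eq by simp
  thus ?thesis by (simp add: sums_iff)
qed

end

subsection \<open>The curve of the possible zeros\<close>

text \<open>The case \<open>(p, q) = (0, 1)\<close> is that of the theorem; \<open>(1, 0)\<close> arises from it by the rotation \<open>z = \<i> y\<close>.\<close>

locale prod_pair = S: neg_prod_seq s + T: neg_prod_seq t for s t +
  fixes p q :: nat and \<alpha> :: complex
  assumes pq: "p + q = 1" and alpha_nz: "\<alpha> \<noteq> 0" and nontriv: "\<exists>n. s n \<noteq> 0 \<or> t n \<noteq> 0"
begin

definition U :: "complex \<Rightarrow> complex" where "U z = z ^ p * neg_prod s (z\<^sup>2)"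
definition V :: "complex \<Rightarrow> complex" where "V z = z ^ q * neg_prod t (- z\<^sup>2)"
definition Q :: "complex \<Rightarrow> complex" where "Q z = U z - \<alpha> * V z"
text \<open>U / V is z ^ ee times the quotient of the two products, with ee = 1 or ee = -1.\<close>

definition ee :: real where "ee = real p - real q"
definition Sdom :: "complex set" where "Sdom = {\<zeta>. 0 \<le> Im \<zeta> \<and> Im \<zeta> \<le> pi/2 \<and> neg_prod s (exp (2*\<zeta>)) \<noteq> 0 \<and> neg_prod t (- exp (2*\<zeta>)) \<noteq> 0}"
text \<open>\<open>L\<close> is \<open>log (U / V)\<close> as a function of \<open>\<zeta> = log z\<close>. For \<open>z\<close> in the first quadrant, \<open>- z\<^sup>2\<close> is in the lower
  half-plane, hence the conjugations: the logarithm of the product is used in the closed upper half-plane only.\<close>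

definition L :: "complex \<Rightarrow> complex" where "L \<zeta> = log_neg_prod s (2*\<zeta>) - cnj (log_neg_prod t (2 * cnj \<zeta> + \<i> * pi)) + of_real ee * \<zeta>"
text \<open>\<open>D\<close> is \<open>(\<bar>U\<bar> - \<bar>\<alpha>\<bar> \<bar>V\<bar>) / \<bar>z\<bar> ^ q\<close> at \<open>z = exp (\<rho> + \<i> \<theta>)\<close>, see \<open>norm_UV\<close>.\<close>

abbreviation "normF \<rho> \<theta> \<equiv> norm (neg_prod s (exp (2 * Complex \<rho> \<theta>)))"
abbreviation "normG \<rho> \<theta> \<equiv> norm (neg_prod t (- exp (2 * Complex \<rho> \<theta>)))"

definition D :: "real \<Rightarrow> real \<Rightarrow> real" where "D \<rho> \<theta> = exp (ee * \<rho>) * normF \<rho> \<theta>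
   - norm \<alpha> * normG \<rho> \<theta>"

lemma pq_cases: "(p = 1 \<and> q = 0) \<or> (p = 0 \<and> q = 1)"
  using pq by linarith

lemma exp_ee: "exp (ee * \<zeta>) * exp (\<zeta>) ^ q = exp \<zeta> ^ p" for \<zeta> :: complex
  using pq_cases by (auto simp: ee_def exp_minus)

lemma exp_ee_real: "exp (ee * \<rho>) * exp \<rho> ^ q = exp \<rho> ^ p" for \<rho> :: real
  using pq_cases by (auto simp: ee_def exp_minus)

lemma exp_refl: "exp (2 * cnj (\<zeta>::complex) + \<i> * pi) = cnj (- exp (2 * \<zeta>))"
  by (simp add: exp_add exp_cnj)

lemma neg_prod_t_refl: "neg_prod t (exp (2 * cnj \<zeta> + \<i> * pi)) = cnj (neg_prod t (- exp (2 * \<zeta>)))"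
  by (simp only: exp_refl T.neg_prod_cnj)

lemma dom_s: "\<zeta> \<in> Sdom \<Longrightarrow> 2 * \<zeta> \<in> strip_dom s"
  by (simp add: Sdom_def S.strip_dom_iff)

lemma dom_t: "\<zeta> \<in> Sdom \<Longrightarrow> 2 * cnj \<zeta> + \<i> * pi \<in> strip_dom t"
  unfolding T.strip_dom_iff neg_prod_t_refl by (simp add: Sdom_def)

lemma exp_L: "\<zeta> \<in> Sdom \<Longrightarrow> exp (L \<zeta>) = U (exp \<zeta>) / V (exp \<zeta>)"
proof -
  assume d: "\<zeta> \<in> Sdom"
  have s: "exp (log_neg_prod s (2*\<zeta>)) = neg_prod s (exp (2*\<zeta>))"
    using dom_s[OF d] by (intro S.exp_log_neg_prod) (simp add: S.strip_dom_iff)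
  have "exp (log_neg_prod t (2 * cnj \<zeta> + \<i> * pi)) = cnj (neg_prod t (- exp (2 * \<zeta>)))"
    unfolding neg_prod_t_refl[symmetric]
    using dom_t[OF d] by (intro T.exp_log_neg_prod) (simp add: T.strip_dom_iff)
  hence t: "exp (cnj (log_neg_prod t (2 * cnj \<zeta> + \<i> * pi))) = neg_prod t (- exp (2 * \<zeta>))"
    by (metis exp_cnj complex_cnj_cnj)
  have e: "exp (ee * \<zeta>) = exp \<zeta> ^ p / exp \<zeta> ^ q"
    using exp_ee[of \<zeta>] by (simp add: field_simps)
  have sq: "(exp \<zeta>)\<^sup>2 = exp (2*\<zeta>)" by (simp add: exp_double)
  show ?thesis
    unfolding L_def exp_add exp_diff s t e U_def V_def sq by (simp add: mult_ac)
qed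

lemma V_nz: "\<zeta> \<in> Sdom \<Longrightarrow> V (exp \<zeta>) \<noteq> 0"
  by (simp add: Sdom_def V_def exp_double)

lemma Im_L: "Im (L \<zeta>) = Im (log_neg_prod s (2*\<zeta>)) + Im (log_neg_prod t (2 * cnj \<zeta> + \<i> * pi)) + ee * Im \<zeta>"
  by (simp add: L_def)

text \<open>The two products contribute separately. Conjugation reverses the sign of the inequality
  for the second one, and the minus sign in \<open>L\<close> restores it. The linear term
  contributes ee |\<zeta>2 - \<zeta>1|^2, which is real.\<close>

lemma L_pos:
  assumes ne: "\<zeta>1 \<noteq> \<zeta>2" and d: "\<zeta>1 \<in> Sdom" "\<zeta>2 \<in> Sdom"
    and nb: "\<not> (Im \<zeta>1 = 0 \<and> Im \<zeta>2 = 0)" "\<not> (Im \<zeta>1 = pi/2 \<and> Im \<zeta>2 = pi/2)"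
  shows "Im ((L \<zeta>2 - L \<zeta>1) * cnj (\<zeta>2 - \<zeta>1)) > 0"
proof -
  define A where "A = log_neg_prod s (2*\<zeta>2) - log_neg_prod s (2*\<zeta>1)"
  define B where "B = log_neg_prod t (2*cnj \<zeta>2 + \<i>*pi) - log_neg_prod t (2*cnj \<zeta>1 + \<i>*pi)"
  have A: "Im (A * cnj (2*\<zeta>2 - 2*\<zeta>1)) > 0" if "\<exists>n. s n \<noteq> 0"
    unfolding A_def using that ne dom_s d nb by (intro S.log_neg_prod_pos) auto
  have A0: "A = 0" if "\<not> (\<exists>n. s n \<noteq> 0)"
    unfolding A_def using that by (simp add: S.log_neg_prod_zero)
  have B: "Im (B * cnj ((2*cnj \<zeta>2 + \<i>*pi) - (2*cnj \<zeta>1 + \<i>*pi))) > 0" if "\<exists>n. t n \<noteq> 0"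
    unfolding B_def using that ne dom_t d nb by (intro T.log_neg_prod_pos) auto
  have B0: "B = 0" if "\<not> (\<exists>n. t n \<noteq> 0)"
    unfolding B_def using that by (simp add: T.log_neg_prod_zero)
  have 1: "Im (A * cnj (2*\<zeta>2 - 2*\<zeta>1)) = 2 * Im (A * cnj (\<zeta>2 - \<zeta>1))"
    by (simp add: algebra_simps)
  have 2: "Im (B * cnj ((2*cnj \<zeta>2 + \<i>*pi) - (2*cnj \<zeta>1 + \<i>*pi))) = 2 * Im (- cnj B * cnj (\<zeta>2 - \<zeta>1))"
    by (simp add: algebra_simps)
  have eq: "(L \<zeta>2 - L \<zeta>1) * cnj (\<zeta>2 - \<zeta>1) = A * cnj (\<zeta>2 - \<zeta>1) + (- cnj B * cnj (\<zeta>2 - \<zeta>1))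
      + ee * ((\<zeta>2 - \<zeta>1) * cnj (\<zeta>2 - \<zeta>1))"
    by (simp add: L_def A_def B_def algebra_simps)
  have "Im (ee * ((\<zeta>2 - \<zeta>1) * cnj (\<zeta>2 - \<zeta>1))) = 0"
    by (simp add: algebra_simps)
  hence "Im ((L \<zeta>2 - L \<zeta>1) * cnj (\<zeta>2 - \<zeta>1)) = Im (A * cnj (\<zeta>2 - \<zeta>1)) + Im (- cnj B * cnj (\<zeta>2 - \<zeta>1))"
    unfolding eq plus_complex.sel by linarith
  thus ?thesis using A A0 B B0 1 2 nontriv
    by (cases "\<exists>n. s n \<noteq> 0"; cases "\<exists>n. t n \<noteq> 0") auto
qed

lemma continuous_on_L: "continuous_on Sdom L"
proof -
  have "continuous_on Sdom (\<lambda>\<zeta>. log_neg_prod s (2*\<zeta>))"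
    by (rule continuous_on_compose2[OF S.continuous_on_log_neg_prod]) (use dom_s in \<open>auto intro!: continuous_intros\<close>)
  moreover have "continuous_on Sdom (\<lambda>\<zeta>. log_neg_prod t (2 * cnj \<zeta> + \<i> * pi))"
    by (rule continuous_on_compose2[OF T.continuous_on_log_neg_prod]) (use dom_t in \<open>auto intro!: continuous_intros\<close>)
  ultimately show ?thesis
    unfolding L_def[abs_def] by (intro continuous_intros)
qed

text \<open>On the real axis z^2 is positive, so only the factors of the second product, evaluated
  at - z^2, can be negative. On the imaginary axis the roles are exchanged, and \<open>ee\<close>
  adds its share of the argument.\<close>

lemma Im_L_real:
  assumes "\<zeta> \<in> Sdom" "Im \<zeta> = 0"
  shows "Im (L \<zeta>) = Im (log_neg_prod t (2 * cnj \<zeta> + \<i> * pi))"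
  using S.Im_log_neg_prod_real[of "2*\<zeta>"] assms by (simp add: Im_L)

lemma Im_L_imag:
  assumes "\<zeta> \<in> Sdom" "Im \<zeta> = pi/2"
  shows "Im (L \<zeta>) = Im (log_neg_prod s (2 * \<zeta>)) + ee * pi / 2"
  using T.Im_log_neg_prod_real[of "2 * cnj \<zeta> + \<i> * pi"] assms by (simp add: Im_L)

lemma Im_L_real_int: "\<zeta> \<in> Sdom \<Longrightarrow> Im \<zeta> = 0 \<Longrightarrow> \<exists>k::nat. Im (L \<zeta>) = of_nat k * pi"
  unfolding Im_L_real using dom_t by (intro T.Im_log_neg_prod_pi_int) auto

lemma Im_L_imag_int: "\<zeta> \<in> Sdom \<Longrightarrow> Im \<zeta> = pi/2 \<Longrightarrow> \<exists>k::nat. Im (L \<zeta>) = of_nat k * pi + ee * pi / 2"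
  unfolding Im_L_imag using S.Im_log_neg_prod_pi_int[of "2*\<zeta>"] dom_s by auto

lemma Im_L_boundary_mono:
  assumes "\<zeta>1 \<in> Sdom" "\<zeta>2 \<in> Sdom" "Re \<zeta>1 \<le> Re \<zeta>2"
    and "(Im \<zeta>1 = 0 \<and> Im \<zeta>2 = 0) \<or> (Im \<zeta>1 = pi/2 \<and> Im \<zeta>2 = pi/2)"
  shows "Im (L \<zeta>1) \<le> Im (L \<zeta>2)"
  using assms(4)
proof
  assume I: "Im \<zeta>1 = 0 \<and> Im \<zeta>2 = 0"
  show ?thesis
    using assms dom_t I by (auto simp: Im_L_real intro!: T.Im_log_neg_prod_pi_mono)
next
  assume I: "Im \<zeta>1 = pi/2 \<and> Im \<zeta>2 = pi/2"
  show ?thesis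
    using assms dom_s I by (auto simp: Im_L_imag intro!: S.Im_log_neg_prod_pi_mono)
qed

text \<open>The arguments of z^2 and of - z^2 are 2 \<theta> and 2 \<theta> - pi. As \<theta> grows,
  the first moves away from the positive axis and the second towards it, so \<open>normF\<close>
  falls and \<open>normG\<close> rises, at least one of them strictly.\<close>

lemma D_strict:
  assumes "0 \<le> \<theta>1" "\<theta>1 < \<theta>2" "\<theta>2 \<le> pi/2"
  shows "D \<rho> \<theta>2 < D \<rho> \<theta>1"
proof -
  have c2: "2 * Complex \<rho> \<theta> = Complex (2*\<rho>) (2*\<theta>)" for \<theta> by (simp add: complex_eq_iff)
  have c3: "2 * cnj (Complex \<rho> \<theta>) + \<i> * pi = Complex (2*\<rho>) (pi - 2*\<theta>)" for \<theta> by (simp add: complex_eq_iff)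
  have s: "normF \<rho> \<theta>2 < normF \<rho> \<theta>1"
    if "\<exists>n. s n \<noteq> 0"
    unfolding c2 using assms that by (intro S.norm_neg_prod_strict_decreasing) auto
  have t0: "normG \<rho> \<theta> = norm (neg_prod t (exp (Complex (2*\<rho>) (pi - 2*\<theta>))))" for \<theta>
    using neg_prod_t_refl[of "Complex \<rho> \<theta>"] unfolding c3 by simp
  have t: "normG \<rho> \<theta>1 < normG \<rho> \<theta>2"
    if "\<exists>n. t n \<noteq> 0"
    unfolding t0 using assms that by (intro T.norm_neg_prod_strict_decreasing) auto
  show ?thesis
  proof (cases "\<exists>n. s n \<noteq> 0")
    case True
    have "normG \<rho> \<theta>1 \<le> normG \<rho> \<theta>2"
      using t by (cases "\<exists>n. t n \<noteq> 0") (auto simp: T.neg_prod_trivial)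
    hence "norm \<alpha> * normG \<rho> \<theta>1 \<le> norm \<alpha> * normG \<rho> \<theta>2"
      by (intro mult_left_mono) auto
    moreover have "exp (ee*\<rho>) * normF \<rho> \<theta>2 < exp (ee*\<rho>) * normF \<rho> \<theta>1"
      using s[OF True] by simp
    ultimately show ?thesis unfolding D_def by linarith
  next
    case False
    hence "\<exists>n. t n \<noteq> 0" using nontriv by blast
    from t[OF this] have "norm \<alpha> * normG \<rho> \<theta>1 < norm \<alpha> * normG \<rho> \<theta>2"
      using alpha_nz by simp
    thus ?thesis using False unfolding D_def by (simp add: S.neg_prod_trivial)
  qed
qed

lemma continuous_on_D: "continuous_on UNIV (\<lambda>(\<rho>,\<theta>). D \<rho> \<theta>)"
proof -
  have S: "continuous_on UNIV (neg_prod s)" and T: "continuous_on UNIV (neg_prod t)"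
    using S.holomorphic_neg_prod T.holomorphic_neg_prod holomorphic_on_imp_continuous_on by blast+
  have C: "(\<lambda>x::real \<times> real. Complex (fst x) (snd x)) = (\<lambda>x. of_real (fst x) + \<i> * of_real (snd x))"
    by (simp add: complex_eq_iff fun_eq_iff)
  have c: "continuous_on UNIV (\<lambda>x::real \<times> real. Complex (fst x) (snd x))"
    unfolding C by (intro continuous_intros)
  show ?thesis
    unfolding D_def case_prod_unfold
    by (intro continuous_intros continuous_on_compose2[OF S] continuous_on_compose2[OF T] c) auto
qed

lemma continuous_D_fst: "continuous_on A (\<lambda>\<rho>. D \<rho> \<theta>)"
  using continuous_on_compose2[OF continuous_on_D, of A "\<lambda>\<rho>. (\<rho>, \<theta>)"] by (simp add: continuous_on_Pair)

lemma continuous_D_snd: "continuous_on A (\<lambda>\<theta>. D \<rho> \<theta>)"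
  using continuous_on_compose2[OF continuous_on_D, of A "\<lambda>\<theta>. (\<rho>, \<theta>)"] by (simp add: continuous_on_Pair)

lemma ex_Th:
  "\<exists>\<theta>. 0 \<le> \<theta> \<and> \<theta> \<le> pi/2 \<and> (\<theta> < pi/2 \<longrightarrow> D \<rho> \<theta> \<le> 0) \<and> (0 < \<theta> \<longrightarrow> 0 \<le> D \<rho> \<theta>)"
proof -
  consider "D \<rho> 0 \<le> 0" | "D \<rho> (pi/2) \<ge> 0" | "D \<rho> 0 > 0" "D \<rho> (pi/2) < 0" by linarith
  thus ?thesis
  proof cases
    case 3
    have "\<exists>x\<ge>0. x \<le> pi/2 \<and> D \<rho> x = 0"
      by (rule IVT2') (use 3 continuous_D_snd in auto)
    thus ?thesis by auto
  qed (auto intro: exI[of _ 0] exI[of _ "pi/2"])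
qed

text \<open>The zero of \<open>D \<rho>\<close> in \<open>[0, \<pi>/2]\<close>, or else the end point at which it would leave the interval.\<close>

definition Th :: "real \<Rightarrow> real" where "Th \<rho> = (SOME \<theta>. 0 \<le> \<theta> \<and> \<theta> \<le> pi/2 \<and> (\<theta> < pi/2 \<longrightarrow> D \<rho> \<theta> \<le> 0) \<and> (0 < \<theta> \<longrightarrow> 0 \<le> D \<rho> \<theta>))"

lemma Th: "0 \<le> Th \<rho>" "Th \<rho> \<le> pi/2" "Th \<rho> < pi/2 \<Longrightarrow> D \<rho> (Th \<rho>) \<le> 0" "0 < Th \<rho> \<Longrightarrow> 0 \<le> D \<rho> (Th \<rho>)"
  using someI_ex[OF ex_Th[of \<rho>]] unfolding Th_def[symmetric] by auto

lemma D_pos_below_Th: "0 \<le> \<theta> \<Longrightarrow> \<theta> < Th \<rho> \<Longrightarrow> D \<rho> \<theta> > 0"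
  using D_strict[of \<theta> "Th \<rho>" \<rho>] Th[of \<rho>] by linarith

lemma D_neg_above_Th: "Th \<rho> < \<theta> \<Longrightarrow> \<theta> \<le> pi/2 \<Longrightarrow> D \<rho> \<theta> < 0"
  using D_strict[of "Th \<rho>" \<theta> \<rho>] Th[of \<rho>] by linarith

lemma Th_eqI: "0 \<le> \<theta> \<Longrightarrow> \<theta> \<le> pi/2 \<Longrightarrow> D \<rho> \<theta> = 0 \<Longrightarrow> Th \<rho> = \<theta>"
  using D_pos_below_Th[of \<theta> \<rho>] D_neg_above_Th[of \<rho> \<theta>] by force

lemma Th_eq_0I: "D \<rho> 0 \<le> 0 \<Longrightarrow> Th \<rho> = 0"
  using D_pos_below_Th[of 0 \<rho>] Th(1)[of \<rho>] by force

lemma Th_eq_0D: "Th \<rho> = 0 \<Longrightarrow> D \<rho> 0 \<le> 0"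
  using Th(3)[of \<rho>] pi_gt_zero by force

lemma Th_eq_pi_halfI: "D \<rho> (pi/2) \<ge> 0 \<Longrightarrow> Th \<rho> = pi/2"
  using D_neg_above_Th[of \<rho> "pi/2"] Th(2)[of \<rho>] by force

text \<open>For a fixed angle below or above Th \<rho>0 the sign of D at that angle is strict, hence
  persists for nearby \<rho>; by monotonicity in the angle it keeps Th \<rho> on the same
  side.\<close>

lemma isCont_Th: "isCont Th \<rho>0"
  unfolding isCont_def
proof (rule order_tendstoI)
  have ct: "isCont (\<lambda>\<rho>. D \<rho> \<theta>) \<rho>0" for \<theta>
    using continuous_D_fst[of UNIV \<theta>] by (simp add: continuous_on_eq_continuous_at)
  fix a assume a: "a < Th \<rho>0"
  show "\<forall>\<^sub>F \<rho> in at \<rho>0. a < Th \<rho>"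
  proof (cases "a < 0")
    case True
    thus ?thesis using Th(1) by (intro always_eventually) (meson less_le_trans)
  next
    case False
    define \<theta> where "\<theta> = (a + Th \<rho>0) / 2"
    have th: "a < \<theta>" "\<theta> < Th \<rho>0" "0 \<le> \<theta>" using a False by (auto simp: \<theta>_def)
    have "\<forall>\<^sub>F \<rho> in at \<rho>0. 0 < D \<rho> \<theta>"
      using ct[of \<theta>] D_pos_below_Th[of \<theta> \<rho>0] th by (auto simp: isCont_def dest: order_tendstoD)
    thus ?thesis
    proof eventually_elim
      case (elim \<rho>)
      have "\<theta> \<le> Th \<rho>" using D_neg_above_Th[of \<rho> \<theta>] elim th Th(2)[of \<rho>0] by force
      thus ?case using th by linarith
    qed
  qed
next
  have ct: "isCont (\<lambda>\<rho>. D \<rho> \<theta>) \<rho>0" for \<theta>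
    using continuous_D_fst[of UNIV \<theta>] by (simp add: continuous_on_eq_continuous_at)
  fix a assume a: "Th \<rho>0 < a"
  show "\<forall>\<^sub>F \<rho> in at \<rho>0. Th \<rho> < a"
  proof (cases "pi/2 < a")
    case True
    thus ?thesis using Th(2) by (intro always_eventually) (meson le_less_trans)
  next
    case False
    define \<theta> where "\<theta> = (a + Th \<rho>0) / 2"
    have th: "\<theta> < a" "Th \<rho>0 < \<theta>" "\<theta> \<le> pi/2" using a False by (auto simp: \<theta>_def)
    have "\<forall>\<^sub>F \<rho> in at \<rho>0. D \<rho> \<theta> < 0"
      using ct[of \<theta>] D_neg_above_Th[of \<rho>0 \<theta>] th by (auto simp: isCont_def dest: order_tendstoD)
    thus ?thesis
    proof eventually_elim
      case (elim \<rho>)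
      have "Th \<rho> \<le> \<theta>" using D_pos_below_Th[of \<theta> \<rho>] elim th Th(1)[of \<rho>0] by force
      thus ?case using th by linarith
    qed
  qed
qed

definition cv :: "real \<Rightarrow> complex" where "cv \<rho> = Complex \<rho> (Th \<rho>)"
definition B :: "real \<Rightarrow> real" where "B \<rho> = Im (L (cv \<rho>))"

lemma nz_s: "0 \<le> \<theta> \<Longrightarrow> \<theta> < pi/2 \<Longrightarrow> neg_prod s (exp (2 * Complex \<rho> \<theta>)) \<noteq> 0"
  by (rule S.neg_prod_nz) auto

lemma nz_t: "0 < \<theta> \<Longrightarrow> \<theta> \<le> pi/2 \<Longrightarrow> neg_prod t (- exp (2 * Complex \<rho> \<theta>)) \<noteq> 0"
  using T.neg_prod_nz[of "2 * cnj (Complex \<rho> \<theta>) + \<i> * pi"] neg_prod_t_refl[of "Complex \<rho> \<theta>"] by auto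

text \<open>The first product can vanish only at \<theta> = pi/2, where D would be negative, and the
  second only at \<theta> = 0, where D would be positive. The sign conditions exclude both, so the
  curve avoids the points where L is singular.\<close>

lemma domI:
  assumes "0 \<le> \<theta>" "\<theta> \<le> pi/2" "\<theta> < pi/2 \<Longrightarrow> D \<rho> \<theta> \<le> 0" "0 < \<theta> \<Longrightarrow> 0 \<le> D \<rho> \<theta>"
  shows "Complex \<rho> \<theta> \<in> Sdom"
proof -
  have "neg_prod s (exp (2 * Complex \<rho> \<theta>)) \<noteq> 0"
  proof
    assume z: "neg_prod s (exp (2 * Complex \<rho> \<theta>)) = 0"
    hence th: "\<theta> = pi/2" using nz_s[of \<theta> \<rho>] assms by force
    have "neg_prod t (- exp (2 * Complex \<rho> \<theta>)) \<noteq> 0" using th pi_gt_zero by (intro nz_t) linarith+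
    hence "D \<rho> \<theta> < 0" using z alpha_nz by (simp add: D_def)
    thus False using assms(4) th pi_gt_zero by simp
  qed
  moreover have "neg_prod t (- exp (2 * Complex \<rho> \<theta>)) \<noteq> 0"
  proof
    assume z: "neg_prod t (- exp (2 * Complex \<rho> \<theta>)) = 0"
    hence th: "\<theta> = 0" using nz_t[of \<theta> \<rho>] assms by force
    have "neg_prod s (exp (2 * Complex \<rho> \<theta>)) \<noteq> 0" using th pi_gt_zero by (intro nz_s) linarith+
    hence "D \<rho> \<theta> > 0" using z by (simp add: D_def)
    thus False using assms(3) th pi_gt_zero by simp
  qed
  ultimately show ?thesis using assms by (simp add: Sdom_def)
qed

lemma cv_dom: "cv \<rho> \<in> Sdom"
  unfolding cv_def by (rule domI) (use Th in auto)

lemma cv_sel [simp]: "Re (cv \<rho>) = \<rho>" "Im (cv \<rho>) = Th \<rho>"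
  by (simp_all add: cv_def)

lemma D_eq: 
  assumes "Complex \<rho> \<theta> \<in> Sdom"
  shows "D \<rho> \<theta> = normG \<rho> \<theta> * (exp (Re (L (Complex \<rho> \<theta>))) - norm \<alpha>)"
    and "normG \<rho> \<theta> > 0"
proof -
  let ?z = "Complex \<rho> \<theta>"
  have nzt: "neg_prod t (- exp (2 * ?z)) \<noteq> 0" using assms by (simp add: Sdom_def)
  have "exp (Re (L ?z)) = norm (U (exp ?z) / V (exp ?z))"
    using exp_L[OF assms] by (metis norm_exp_eq_Re)
  also have "\<dots> = (exp \<rho> ^ p / exp \<rho> ^ q) * norm (neg_prod s (exp (2 * ?z))) / norm (neg_prod t (- exp (2 * ?z)))"
    by (simp add: U_def V_def norm_divide norm_mult norm_power exp_double[symmetric])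
  also have "exp \<rho> ^ p / exp \<rho> ^ q = exp (ee * \<rho>)" using exp_ee_real[of \<rho>] by (simp add: field_simps)
  finally show "D \<rho> \<theta> = norm (neg_prod t (- exp (2 * ?z))) * (exp (Re (L ?z)) - norm \<alpha>)"
    using nzt by (simp add: D_def field_simps)
  show "norm (neg_prod t (- exp (2 * ?z))) > 0" using nzt by simp
qed

text \<open>As |U / V| = exp (Re L), the sign of D compares Re L with ln |\<alpha>|.\<close>

lemma Re_L_le_iff:
  assumes "Complex \<rho> \<theta> \<in> Sdom"
  shows "D \<rho> \<theta> \<le> 0 \<longleftrightarrow> Re (L (Complex \<rho> \<theta>)) \<le> ln (norm \<alpha>)"
    "D \<rho> \<theta> \<ge> 0 \<longleftrightarrow> Re (L (Complex \<rho> \<theta>)) \<ge> ln (norm \<alpha>)"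
    "D \<rho> \<theta> = 0 \<longleftrightarrow> exp (Re (L (Complex \<rho> \<theta>))) = norm \<alpha>"
proof -
  have "D \<rho> \<theta> \<le> 0 \<longleftrightarrow> exp (Re (L (Complex \<rho> \<theta>))) \<le> norm \<alpha>"
    unfolding D_eq(1)[OF assms] using D_eq(2)[OF assms] by (simp add: mult_le_0_iff)
  also have "\<dots> \<longleftrightarrow> Re (L (Complex \<rho> \<theta>)) \<le> ln (norm \<alpha>)"
    using alpha_nz by (simp add: ln_ge_iff)
  finally show "D \<rho> \<theta> \<le> 0 \<longleftrightarrow> Re (L (Complex \<rho> \<theta>)) \<le> ln (norm \<alpha>)" .
  have "D \<rho> \<theta> \<ge> 0 \<longleftrightarrow> exp (Re (L (Complex \<rho> \<theta>))) \<ge> norm \<alpha>"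
    unfolding D_eq(1)[OF assms] using D_eq(2)[OF assms] by (simp add: zero_le_mult_iff)
  also have "\<dots> \<longleftrightarrow> Re (L (Complex \<rho> \<theta>)) \<ge> ln (norm \<alpha>)"
    using alpha_nz by (metis exp_le_cancel_iff exp_ln zero_less_norm_iff)
  finally show "D \<rho> \<theta> \<ge> 0 \<longleftrightarrow> Re (L (Complex \<rho> \<theta>)) \<ge> ln (norm \<alpha>)" .
  show "D \<rho> \<theta> = 0 \<longleftrightarrow> exp (Re (L (Complex \<rho> \<theta>))) = norm \<alpha>"
    unfolding D_eq(1)[OF assms] using D_eq(2)[OF assms] by auto
qed

text \<open>Written in coordinates, \<open>L_pos\<close> says that the increments of B and \<rho>
  have a product greater than that of the increments of Re L and Th. The latter is nonnegative: of
  two different angles the smaller is below pi/2 and has Re L \<le> ln |\<alpha>|, the larger is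
  above 0 and has Re L \<ge> ln |\<alpha>|.\<close>

lemma B_strict:
  assumes "\<rho>1 < \<rho>2"
    and nb: "\<not> (Th \<rho>1 = 0 \<and> Th \<rho>2 = 0)" "\<not> (Th \<rho>1 = pi/2 \<and> Th \<rho>2 = pi/2)"
  shows "B \<rho>1 < B \<rho>2"
proof -
  have "Im ((L (cv \<rho>2) - L (cv \<rho>1)) * cnj (cv \<rho>2 - cv \<rho>1)) > 0"
    by (rule L_pos) (use assms cv_dom in \<open>auto simp: complex_eq_iff\<close>)
  hence *: "(B \<rho>2 - B \<rho>1) * (\<rho>2 - \<rho>1) > (Re (L (cv \<rho>2)) - Re (L (cv \<rho>1))) * (Th \<rho>2 - Th \<rho>1)"
    by (simp add: B_def algebra_simps)
  have le: "Re (L (cv \<rho>)) \<le> ln (norm \<alpha>)" if "Th \<rho> < pi/2" for \<rho>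
    using Th(3)[OF that] Re_L_le_iff(1)[of \<rho> "Th \<rho>"] cv_dom[of \<rho>] by (simp add: cv_def)
  have ge: "Re (L (cv \<rho>)) \<ge> ln (norm \<alpha>)" if "0 < Th \<rho>" for \<rho>
    using Th(4)[OF that] Re_L_le_iff(2)[of \<rho> "Th \<rho>"] cv_dom[of \<rho>] by (simp add: cv_def)
  have "(Re (L (cv \<rho>2)) - Re (L (cv \<rho>1))) * (Th \<rho>2 - Th \<rho>1) \<ge> 0"
  proof (cases "Th \<rho>1" "Th \<rho>2" rule: linorder_cases)
    case less
    hence "Re (L (cv \<rho>1)) \<le> Re (L (cv \<rho>2))"
      using le[of \<rho>1] ge[of \<rho>2] Th(1)[of \<rho>1] Th(2)[of \<rho>2] by linarith
    thus ?thesis using less by simp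
  next
    case greater
    hence "Re (L (cv \<rho>2)) \<le> Re (L (cv \<rho>1))"
      using le[of \<rho>2] ge[of \<rho>1] Th(1)[of \<rho>2] Th(2)[of \<rho>1] by linarith
    thus ?thesis using greater by (simp add: mult_nonpos_nonpos)
  qed simp
  hence "(B \<rho>2 - B \<rho>1) * (\<rho>2 - \<rho>1) > 0" using * by linarith
  thus ?thesis using assms(1) by (simp add: zero_less_mult_iff)
qed

lemma B_mono: "\<rho>1 \<le> \<rho>2 \<Longrightarrow> B \<rho>1 \<le> B \<rho>2"
proof -
  assume le: "\<rho>1 \<le> \<rho>2"
  show ?thesis
  proof (cases "(Th \<rho>1 = 0 \<and> Th \<rho>2 = 0) \<or> (Th \<rho>1 = pi/2 \<and> Th \<rho>2 = pi/2)")
    case True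
    thus ?thesis unfolding B_def using le cv_dom by (intro Im_L_boundary_mono) auto
  next
    case False
    thus ?thesis using B_strict[of \<rho>1 \<rho>2] le by (cases "\<rho>1 = \<rho>2") auto
  qed
qed

lemma continuous_B: "continuous_on A B"
proof -
  have T: "continuous_on A Th" using isCont_Th by (simp add: continuous_at_imp_continuous_on)
  have C: "cv = (\<lambda>\<rho>. of_real \<rho> + \<i> * of_real (Th \<rho>))"
    by (simp add: complex_eq_iff fun_eq_iff)
  have "continuous_on A cv" unfolding C using T by (intro continuous_intros)
  hence "continuous_on A (\<lambda>\<rho>. L (cv \<rho>))"
    by (rule continuous_on_compose2[OF continuous_on_L]) (use cv_dom in auto)
  thus ?thesis unfolding B_def[abs_def] by (rule continuous_on_Im)
qed

lemma B_real: "Th \<rho> = 0 \<Longrightarrow> \<exists>k::nat. B \<rho> = of_nat k * pi"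
  unfolding B_def by (rule Im_L_real_int[OF cv_dom]) simp

lemma B_imag: "Th \<rho> = pi/2 \<Longrightarrow> \<exists>k::nat. B \<rho> = of_nat k * pi + ee * pi / 2"
  unfolding B_def by (rule Im_L_imag_int[OF cv_dom]) simp

lemma U_minus: "U (- z) = (-1)^p * U z" by (simp add: U_def power_minus[of z])
lemma V_minus: "V (- z) = (-1)^q * V z" by (simp add: V_def power_minus[of z])
lemma U_cnj: "U (cnj z) = cnj (U z)" by (simp add: U_def S.neg_prod_cnj flip: complex_cnj_power)
lemma V_cnj: "V (cnj z) = cnj (V z)" by (simp add: V_def T.neg_prod_cnj flip: complex_cnj_power complex_cnj_minus)

lemma quotient_minus: "U (- z) / V (- z) = - (U z / V z)"
  using pq_cases by (auto simp: U_minus V_minus)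

lemma norm_UV: "norm (U (exp (Complex \<rho> \<theta>))) - norm \<alpha> * norm (V (exp (Complex \<rho> \<theta>))) = exp \<rho> ^ q * D \<rho> \<theta>"
proof -
  have "norm (U (exp (Complex \<rho> \<theta>))) = exp \<rho> ^ p * normF \<rho> \<theta>"
    "norm (V (exp (Complex \<rho> \<theta>))) = exp \<rho> ^ q * normG \<rho> \<theta>"
    by (simp_all add: U_def V_def norm_mult norm_power exp_double[symmetric])
  thus ?thesis unfolding D_def exp_ee_real[symmetric] by (simp add: algebra_simps)
qed

text \<open>U / V is odd because p + q = 1, and it commutes with conjugation. So at the four
  reflections of a point of the first quadrant it takes the values v, -v and their conjugates; D = 0
  matches the modulus of \<alpha>, the signs \<sigma> and \<tau> its argument.\<close>

lemma zero_iff: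
  assumes st: "\<sigma> \<in> {1,-1}" "\<tau> \<in> {1,-1}" and th: "0 \<le> \<theta>" "\<theta> \<le> pi/2"
  shows "Q (Complex (\<sigma> * (exp \<rho> * cos \<theta>)) (\<tau> * (exp \<rho> * sin \<theta>))) = 0 \<longleftrightarrow>
    D \<rho> \<theta> = 0 \<and> Re \<alpha> = \<sigma> * norm \<alpha> * cos (Im (L (Complex \<rho> \<theta>))) \<and> Im \<alpha> = \<tau> * norm \<alpha> * sin (Im (L (Complex \<rho> \<theta>)))"
    (is "Q ?w = 0 \<longleftrightarrow> _")
proof -
  define w0 where "w0 = exp (Complex \<rho> \<theta>)"
  have w0: "w0 = Complex (exp \<rho> * cos \<theta>) (exp \<rho> * sin \<theta>)"
    by (simp add: w0_def exp_eq_polar complex_eq_iff)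
  have cases: "(\<sigma> = 1 \<and> \<tau> = 1 \<and> ?w = w0) \<or> (\<sigma> = 1 \<and> \<tau> = -1 \<and> ?w = cnj w0) \<or>
     (\<sigma> = -1 \<and> \<tau> = -1 \<and> ?w = - w0) \<or> (\<sigma> = -1 \<and> \<tau> = 1 \<and> ?w = - cnj w0)"
    using st by (auto simp: w0 complex_eq_iff)
  have n: "norm (U ?w) = norm (U w0)" "norm (V ?w) = norm (V w0)"
    using cases by (auto simp: U_minus V_minus U_cnj V_cnj norm_mult norm_power)
  show ?thesis
  proof (cases "D \<rho> \<theta> = 0")
    case False
    hence "norm (U w0) \<noteq> norm \<alpha> * norm (V w0)" using norm_UV[of \<rho> \<theta>] by (auto simp: w0_def)
    hence "Q ?w \<noteq> 0" unfolding Q_def using n by (metis eq_iff_diff_eq_0 norm_mult)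
    thus ?thesis using False by simp
  next
    case True
    hence d: "Complex \<rho> \<theta> \<in> Sdom" using th by (intro domI) auto
    define b where "b = Im (L (Complex \<rho> \<theta>))"
    have Vn: "V w0 \<noteq> 0" using V_nz[OF d] by (simp add: w0_def)
    have "exp (Re (L (Complex \<rho> \<theta>))) = norm \<alpha>" using Re_L_le_iff(3)[OF d] True by simp
    hence "exp (L (Complex \<rho> \<theta>)) = of_real (norm \<alpha>) * cis b"
      by (simp add: exp_eq_polar b_def)
    hence phi: "U w0 / V w0 = of_real (norm \<alpha>) * cis b" using exp_L[OF d] by (simp add: w0_def)
    have "Q ?w = 0 \<longleftrightarrow> U ?w / V ?w = \<alpha>"
      using n(2) Vn by (auto simp: Q_def field_simps)
    also have "U ?w / V ?w = Complex (\<sigma> * norm \<alpha> * cos b) (\<tau> * norm \<alpha> * sin b)"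
    proof -
      have c: "U (cnj w0) / V (cnj w0) = cnj (U w0 / V w0)" by (simp add: U_cnj V_cnj)
      have "U ?w / V ?w = (if \<sigma> = 1 then 1 else -1) * (if \<sigma> = \<tau> then U w0 / V w0 else cnj (U w0 / V w0))"
        using cases quotient_minus[of w0] quotient_minus[of "cnj w0"] c by auto
      thus ?thesis unfolding phi using cases by (auto simp: complex_eq_iff)
    qed
    finally show ?thesis using True by (auto simp: complex_eq_iff b_def)
  qed
qed

section \<open>Logarithmic derivative of the quotient and multiplicities\<close>

definition K :: "complex \<Rightarrow> complex" where
  "K z = of_real ee + 2 * log_deriv_neg_prod s (z\<^sup>2) - 2 * log_deriv_neg_prod t (- z\<^sup>2)"

definition Reg :: "complex set" where
  "Reg = {z. z \<noteq> 0 \<and> neg_prod s (z\<^sup>2) \<noteq> 0 \<and> neg_prod t (- z\<^sup>2) \<noteq> 0}"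

lemma holomorphic_s: "(\<lambda>z. neg_prod s (z\<^sup>2)) holomorphic_on A"
proof -
  have "(\<lambda>z. z\<^sup>2) holomorphic_on A" by (intro holomorphic_intros)
  from holomorphic_on_compose_gen[OF this S.holomorphic_neg_prod[of UNIV]] show ?thesis
    by (simp add: o_def)
qed

lemma holomorphic_t: "(\<lambda>z. neg_prod t (- z\<^sup>2)) holomorphic_on A"
proof -
  have "(\<lambda>z. - z\<^sup>2) holomorphic_on A" by (intro holomorphic_intros)
  from holomorphic_on_compose_gen[OF this T.holomorphic_neg_prod[of UNIV]] show ?thesis
    by (simp add: o_def)
qed

lemma holomorphic_Q: "Q holomorphic_on A"
  unfolding Q_def[abs_def] U_def V_def by (intro holomorphic_intros holomorphic_s holomorphic_t)

lemma open_Reg: "open Reg"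
proof -
  have "continuous_on UNIV (\<lambda>z. neg_prod s (z\<^sup>2))" "continuous_on UNIV (\<lambda>z. neg_prod t (- z\<^sup>2))"
    using holomorphic_s holomorphic_t holomorphic_on_imp_continuous_on by blast+
  thus ?thesis unfolding Reg_def
    by (intro open_Collect_conj open_Collect_neq continuous_on_const continuous_on_id) auto
qed

lemma Q_0: "Q 0 \<noteq> 0"
  using pq_cases alpha_nz by (auto simp: Q_def U_def V_def S.neg_prod_0 T.neg_prod_0)

text \<open>A zero of the first product needs Re (z^2) < 0, one of the second Re (z^2) > 0.\<close>

lemma not_both_zero: "\<not> (neg_prod s (z\<^sup>2) = 0 \<and> neg_prod t (- z\<^sup>2) = 0)"
proof
  assume a: "neg_prod s (z\<^sup>2) = 0 \<and> neg_prod t (- z\<^sup>2) = 0"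
  then obtain n m where "1 + of_real (s n) * z\<^sup>2 = 0" "1 + of_real (t m) * (- z\<^sup>2) = 0"
    by (auto simp: S.neg_prod_eq_0_iff T.neg_prod_eq_0_iff)
  hence "Re (1 + of_real (s n) * z\<^sup>2) = 0" "Re (1 + of_real (t m) * (- z\<^sup>2)) = 0" by simp_all
  hence 1: "s n * Re (z\<^sup>2) = -1" and 2: "t m * Re (z\<^sup>2) = 1" by simp_all
  show False using 1 2 S.s_nonneg[of n] T.s_nonneg[of m]
    by (metis linorder_linear mult_nonneg_nonneg mult_nonneg_nonpos neg_0_le_iff_le not_one_le_zero zero_le_one)
qed

lemma zero_Reg: "Q w = 0 \<Longrightarrow> w \<in> Reg"
proof -
  assume z: "Q w = 0"
  have w: "w \<noteq> 0" using z Q_0 by auto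
  have "U w = \<alpha> * V w" using z by (simp add: Q_def)
  hence "neg_prod s (w\<^sup>2) = 0 \<longleftrightarrow> neg_prod t (- w\<^sup>2) = 0"
    using w alpha_nz unfolding U_def V_def by auto
  thus ?thesis using not_both_zero[of w] w by (auto simp: Reg_def)
qed

lemma DERIV_U:
  assumes "z \<in> Reg"
  shows "(U has_field_derivative U z * (of_nat p + 2 * log_deriv_neg_prod s (z\<^sup>2)) / z) (at z)"
proof -
  have nz: "z \<noteq> 0" "neg_prod s (z\<^sup>2) \<noteq> 0" using assms by (auto simp: Reg_def)
  have 1: "(neg_prod s has_field_derivative deriv (neg_prod s) (z\<^sup>2)) (at (z\<^sup>2))"
    using S.holomorphic_neg_prod[of UNIV] by (intro holomorphic_derivI[where S = UNIV]) auto
  have 2: "((\<lambda>z. z\<^sup>2) has_field_derivative (2 * z)) (at z)"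
    by (auto intro!: derivative_eq_intros)
  have 3: "((\<lambda>z. neg_prod s (z\<^sup>2)) has_field_derivative (deriv (neg_prod s) (z\<^sup>2) * (2 * z))) (at z)"
    using DERIV_chain2[OF 1 2] .
  have "((\<lambda>z. z ^ p * neg_prod s (z\<^sup>2)) has_field_derivative
      (of_nat p * z ^ (p - 1) * neg_prod s (z\<^sup>2) + z ^ p * (deriv (neg_prod s) (z\<^sup>2) * (2 * z)))) (at z)"
    by (rule derivative_eq_intros 3 refl | simp add: mult_ac)+
  moreover have "of_nat p * z ^ (p - 1) * neg_prod s (z\<^sup>2) + z ^ p * (deriv (neg_prod s) (z\<^sup>2) * (2 * z))
      = U z * (of_nat p + 2 * log_deriv_neg_prod s (z\<^sup>2)) / z"
    using pq_cases nz S.log_deriv_neg_prod_sums(2)[OF nz(2)]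
    by (auto simp: U_def field_simps power2_eq_square)
  ultimately show ?thesis by (simp add: U_def[abs_def])
qed

lemma DERIV_V:
  assumes "z \<in> Reg"
  shows "(V has_field_derivative V z * (of_nat q + 2 * log_deriv_neg_prod t (- z\<^sup>2)) / z) (at z)"
proof -
  have nz: "z \<noteq> 0" "neg_prod t (- z\<^sup>2) \<noteq> 0" using assms by (auto simp: Reg_def)
  have 1: "(neg_prod t has_field_derivative deriv (neg_prod t) (- z\<^sup>2)) (at (- z\<^sup>2))"
    using T.holomorphic_neg_prod[of UNIV] by (intro holomorphic_derivI[where S = UNIV]) auto
  have 2: "((\<lambda>z. - z\<^sup>2) has_field_derivative (- 2 * z)) (at z)"
    by (auto intro!: derivative_eq_intros)
  have 3: "((\<lambda>z. neg_prod t (- z\<^sup>2)) has_field_derivative (deriv (neg_prod t) (- z\<^sup>2) * (- 2 * z))) (at z)"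
    using DERIV_chain2[OF 1 2] .
  have "((\<lambda>z. z ^ q * neg_prod t (- z\<^sup>2)) has_field_derivative
      (of_nat q * z ^ (q - 1) * neg_prod t (- z\<^sup>2) + z ^ q * (deriv (neg_prod t) (- z\<^sup>2) * (- 2 * z)))) (at z)"
    by (rule derivative_eq_intros 3 refl | simp add: mult_ac)+
  moreover have "of_nat q * z ^ (q - 1) * neg_prod t (- z\<^sup>2) + z ^ q * (deriv (neg_prod t) (- z\<^sup>2) * (- 2 * z))
      = V z * (of_nat q + 2 * log_deriv_neg_prod t (- z\<^sup>2)) / z"
    using pq_cases nz T.log_deriv_neg_prod_sums(2)[OF nz(2)]
    by (auto simp: V_def field_simps power2_eq_square)
  ultimately show ?thesis by (simp add: V_def[abs_def])
qed

lemma Reg_nz: "z \<in> Reg \<Longrightarrow> z \<noteq> 0" "z \<in> Reg \<Longrightarrow> U z \<noteq> 0" "z \<in> Reg \<Longrightarrow> V z \<noteq> 0"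
  by (auto simp: Reg_def U_def V_def)

text \<open>\<open>K\<close> is z (U / V)' / (U / V), that is, L' in the variable \<zeta>. The
  derivative is arranged so that its first term vanishes with Q: at a zero, z Q' = \<alpha> V K, and
  multiple zeros are the common zeros of Q and K.\<close>

lemma DERIV_Q:
  assumes "z \<in> Reg"
  shows "(Q has_field_derivative
     ((of_nat p + 2 * log_deriv_neg_prod s (z\<^sup>2)) * Q z + \<alpha> * V z * K z) / z) (at z)"
proof -
  have "(Q has_field_derivative (U z * (of_nat p + 2 * log_deriv_neg_prod s (z\<^sup>2)) / z
     - \<alpha> * (V z * (of_nat q + 2 * log_deriv_neg_prod t (- z\<^sup>2)) / z))) (at z)"
    unfolding Q_def[abs_def] by (intro derivative_intros DERIV_U DERIV_V assms DERIV_cmult)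
  moreover have "U z * (of_nat p + 2 * log_deriv_neg_prod s (z\<^sup>2)) / z
     - \<alpha> * (V z * (of_nat q + 2 * log_deriv_neg_prod t (- z\<^sup>2)) / z)
     = ((of_nat p + 2 * log_deriv_neg_prod s (z\<^sup>2)) * Q z + \<alpha> * V z * K z) / z"
    using Reg_nz[OF assms] by (simp add: Q_def K_def ee_def field_simps)
  ultimately show ?thesis by simp
qed

lemma zorder_1:
  assumes "Q w = 0" "K w \<noteq> 0"
  shows "zorder Q w = 1"
proof (rule zorder_zero_eqI'[where n = 1])
  have r: "w \<in> Reg" by (rule zero_Reg) fact
  have "deriv Q w = \<alpha> * V w * K w / w"
    using DERIV_imp_deriv[OF DERIV_Q[OF r]] assms by simp
  hence "deriv Q w \<noteq> 0" using Reg_nz[OF r] assms alpha_nz by simp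
  thus "(deriv ^^ nat 1) Q w \<noteq> 0" by simp
  show "Q analytic_on {w}" using holomorphic_Q[of UNIV] analytic_on_holomorphic by blast
qed (use assms in auto)

lemma zorder_2:
  assumes w: "Q w = 0" and K: "K w = 0" and dK: "(K has_field_derivative d) (at w)" "d \<noteq> 0"
  shows "zorder Q w = 2"
proof (rule zorder_zero_eqI'[where n = 2])
  have r: "w \<in> Reg" by (rule zero_Reg) fact
  have Q1: "deriv Q w = 0"
    using DERIV_imp_deriv[OF DERIV_Q[OF r]] w K by simp
  have Q0: "(Q has_field_derivative 0) (at w)"
    using DERIV_Q[OF r] w K by simp
  obtain a where a: "(log_deriv_neg_prod s has_field_derivative a) (at (w\<^sup>2))"
    using S.log_deriv_neg_prod_deriv[of "w\<^sup>2"] r by (auto simp: Reg_def)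
  have a': "((\<lambda>z. log_deriv_neg_prod s (z\<^sup>2)) has_field_derivative (a * (2 * w))) (at w)"
    by (rule DERIV_chain2[where f = "log_deriv_neg_prod s" and g = "\<lambda>z. z\<^sup>2", OF a])
      (auto intro!: derivative_eq_intros)
  \<comment> \<open>N is z Q' in the form given by \<open>DERIV_Q\<close>. As Q and Q' vanish at w,
    differentiating it there in two ways yields w Q'' = \<alpha> V K'.\<close>
  define N where "N = (\<lambda>z. (of_nat p + 2 * log_deriv_neg_prod s (z\<^sup>2)) * Q z + \<alpha> * V z * K z)"
  have N1: "(N has_field_derivative (\<alpha> * V w * d)) (at w)"
    unfolding N_def by (rule derivative_eq_intros a' Q0 DERIV_V[OF r] dK refl)+ (simp add: w K)
  have "N z = z * deriv Q z" if "z \<in> Reg" for z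
    using DERIV_imp_deriv[OF DERIV_Q[OF that]] Reg_nz[OF that] by (simp add: N_def)
  hence N2: "((\<lambda>z. z * deriv Q z) has_field_derivative (\<alpha> * V w * d)) (at w)"
    by (intro has_field_derivative_transform_within_open[OF N1 open_Reg r]) auto
  have "deriv Q holomorphic_on UNIV" by (intro holomorphic_deriv holomorphic_Q) auto
  hence dd: "(deriv Q has_field_derivative deriv (deriv Q) w) (at w)"
    by (rule holomorphic_derivI[where S = UNIV]) auto
  have "((\<lambda>z. z * deriv Q z) has_field_derivative (w * deriv (deriv Q) w)) (at w)"
    by (rule derivative_eq_intros dd refl)+ (simp add: Q1)
  hence "w * deriv (deriv Q) w = \<alpha> * V w * d" using N2 DERIV_unique by blast
  hence "deriv (deriv Q) w \<noteq> 0" using Reg_nz[OF r] alpha_nz dK by auto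
  thus "(deriv ^^ nat 2) Q w \<noteq> 0" by (simp add: numeral_2_eq_2)
  show "Q analytic_on {w}" using holomorphic_Q[of UNIV] analytic_on_holomorphic by blast
  fix i assume "i < nat 2"
  hence "i = 0 \<or> i = 1" by auto
  thus "(deriv ^^ i) Q w = 0" using w Q1 by auto
qed simp

text \<open>z^2 and - z^2 lie in opposite half-planes, and the two logarithmic derivatives enter
  with opposite signs, so they push Im K in the same direction. Multiple zeros are thus confined to
  the axes.\<close>

lemma K_nonreal:
  assumes "z \<in> Reg" "Im (z\<^sup>2) \<noteq> 0"
  shows "K z \<noteq> 0"
proof
  assume K0: "K z = 0"
  have nz: "neg_prod s (z\<^sup>2) \<noteq> 0" "neg_prod t (- z\<^sup>2) \<noteq> 0" using assms by (auto simp: Reg_def)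
  have 1: "Im (z\<^sup>2) * Im (log_deriv_neg_prod s (z\<^sup>2)) > 0" if "\<exists>n. s n \<noteq> 0"
    using S.Im_log_deriv_pos[OF nz(1) that] assms(2) by simp
  have 10: "log_deriv_neg_prod s (z\<^sup>2) = 0" if "\<not> (\<exists>n. s n \<noteq> 0)"
    using that by (simp add: S.log_deriv_trivial)
  have 2: "Im (z\<^sup>2) * Im (log_deriv_neg_prod t (- z\<^sup>2)) < 0" if "\<exists>n. t n \<noteq> 0"
    using T.Im_log_deriv_pos[OF nz(2) that] assms(2) by simp
  have 20: "log_deriv_neg_prod t (- z\<^sup>2) = 0" if "\<not> (\<exists>n. t n \<noteq> 0)"
    using that by (simp add: T.log_deriv_trivial)
  have "Im (z\<^sup>2) * Im (K z) = 2 * (Im (z\<^sup>2) * Im (log_deriv_neg_prod s (z\<^sup>2))) - 2 * (Im (z\<^sup>2) * Im (log_deriv_neg_prod t (- z\<^sup>2)))"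
    by (simp add: K_def algebra_simps)
  also have "\<dots> > 0"
    using 1 10 2 20 nontriv by (cases "\<exists>n. s n \<noteq> 0"; cases "\<exists>n. t n \<noteq> 0") auto
  finally show False using K0 by simp
qed

text \<open>By the chain rule K' = 4 x (a + b) with the nonnegative derivatives a, b of
  \<open>log_deriv_real\<close>: the minus sign in - z^2 cancels the one in \<open>K\<close>. So
  real zeros of Q have order at most 2.\<close>

lemma K_deriv_real:
  assumes "of_real x \<in> Reg"
  obtains d :: real where "(K has_field_derivative of_real d) (at (of_real x))" "x * d > 0"
proof -
  let ?z = "complex_of_real x"
  have nz: "?z \<noteq> 0" "neg_prod s (?z\<^sup>2) \<noteq> 0" "neg_prod t (- ?z\<^sup>2) \<noteq> 0" using assms by (auto simp: Reg_def)
  have sq: "?z\<^sup>2 = of_real (x\<^sup>2)" "- ?z\<^sup>2 = of_real (- (x\<^sup>2))" by simp_all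
  obtain a where a: "(log_deriv_neg_prod s has_field_derivative a) (at (?z\<^sup>2))"
    "(\<lambda>n. of_real (s n) / (1 + of_real (s n) * ?z\<^sup>2)\<^sup>2) sums a"
    by (rule S.log_deriv_neg_prod_deriv[OF nz(2)])
  obtain b where b: "(log_deriv_neg_prod t has_field_derivative b) (at (- ?z\<^sup>2))"
    "(\<lambda>n. of_real (t n) / (1 + of_real (t n) * (- ?z\<^sup>2))\<^sup>2) sums b"
    by (rule T.log_deriv_neg_prod_deriv[OF nz(3)])
  have ar: "Im a = 0" "Re a \<ge> 0" "(\<exists>n. s n \<noteq> 0) \<Longrightarrow> Re a > 0"
    using S.log_deriv_real[of "x\<^sup>2" a] a(2) nz(2) unfolding sq by blast+
  have br: "Im b = 0" "Re b \<ge> 0" "(\<exists>n. t n \<noteq> 0) \<Longrightarrow> Re b > 0"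
    using T.log_deriv_real[of "- (x\<^sup>2)" b] b(2) nz(3)
    unfolding sq of_real_minus by blast+
  have a': "((\<lambda>z. log_deriv_neg_prod s (z\<^sup>2)) has_field_derivative (a * (2 * ?z))) (at ?z)"
    by (rule DERIV_chain2[where f = "log_deriv_neg_prod s" and g = "\<lambda>z. z\<^sup>2", OF a(1)])
      (auto intro!: derivative_eq_intros)
  have b': "((\<lambda>z. log_deriv_neg_prod t (- z\<^sup>2)) has_field_derivative (b * (- 2 * ?z))) (at ?z)"
    by (rule DERIV_chain2[where f = "log_deriv_neg_prod t" and g = "\<lambda>z. - z\<^sup>2", OF b(1)])
      (auto intro!: derivative_eq_intros)
  have "(K has_field_derivative (2 * (a * (2 * ?z)) - 2 * (b * (- 2 * ?z)))) (at ?z)"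
    unfolding K_def[abs_def] by (rule derivative_eq_intros a' b' refl)+ simp
  moreover have "2 * (a * (2 * ?z)) - 2 * (b * (- 2 * ?z)) = of_real (4 * x * (Re a + Re b))"
    using ar(1) br(1) by (simp add: complex_eq_iff algebra_simps)
  moreover have "x * (4 * x * (Re a + Re b)) > 0"
  proof -
    have "Re a + Re b > 0" using ar br nontriv by (metis add_nonneg_pos add_pos_nonneg)
    moreover have "x * x > 0" using nz(1) by (simp add: zero_less_mult_iff) linarith
    ultimately have "(x * x) * (Re a + Re b) > 0" by (rule mult_pos_pos[rotated])
    moreover have "x * (4 * x * (Re a + Re b)) = 4 * ((x * x) * (Re a + Re b))" by (simp only: mult_ac)
    ultimately show ?thesis by linarith
  qed
  ultimately show thesis using that by metis
qed

lemma zorder_real: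
  assumes "Q (of_real x) = 0"
  shows "zorder Q (of_real x) = (if K (of_real x) = 0 then 2 else 1)"
proof (cases "K (of_real x) = 0")
  case True
  obtain d :: real where d: "(K has_field_derivative of_real d) (at (of_real x))" "x * d > 0"
    using K_deriv_real[OF zero_Reg[OF assms]] by blast
  have "complex_of_real d \<noteq> 0" using d(2) by auto
  thus ?thesis using zorder_2[OF assms True d(1)] True by simp
next
  case False thus ?thesis using zorder_1[OF assms] by simp
qed

section \<open>Zeros in polar coordinates\<close>

definition "lr w = ln (norm (w::complex))"

lemma sincos_abs:
  fixes w :: complex
  assumes "w \<noteq> 0"
  obtains \<theta> where "0 \<le> \<theta>" "\<theta> \<le> pi/2" "\<bar>Re w\<bar> = norm w * cos \<theta>" "\<bar>Im w\<bar> = norm w * sin \<theta>"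
proof -
  have "(\<bar>Re w\<bar> / norm w)\<^sup>2 + (\<bar>Im w\<bar> / norm w)\<^sup>2 = 1"
    using assms cmod_power2[of w] by (auto simp: power_divide complex_eq_iff simp flip: add_divide_distrib)
  then obtain \<theta> where "0 \<le> \<theta>" "\<theta> \<le> pi/2" "\<bar>Re w\<bar> / norm w = cos \<theta>" "\<bar>Im w\<bar> / norm w = sin \<theta>"
    using sincos_total_pi_half[of "\<bar>Re w\<bar> / norm w" "\<bar>Im w\<bar> / norm w"] by auto
  thus thesis using that[of \<theta>] assms by (simp add: field_simps)
qed

text \<open>The signs \<sigma> and \<tau> are left free because on an axis one of them may be chosen
  either way.\<close>

lemma zero_repr:
  assumes "Q w = 0"
  shows "D (lr w) (Th (lr w)) = 0"
    "\<bar>Re w\<bar> = norm w * cos (Th (lr w))" "\<bar>Im w\<bar> = norm w * sin (Th (lr w))"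
    "\<And>\<sigma> \<tau>. \<sigma> \<in> {1,-1} \<Longrightarrow> \<tau> \<in> {1,-1} \<Longrightarrow> Re w = \<sigma> * \<bar>Re w\<bar> \<Longrightarrow> Im w = \<tau> * \<bar>Im w\<bar> \<Longrightarrow>
      Re \<alpha> = \<sigma> * norm \<alpha> * cos (B (lr w)) \<and> Im \<alpha> = \<tau> * norm \<alpha> * sin (B (lr w))"
proof -
  have w: "w \<noteq> 0" using assms Q_0 by auto
  obtain \<theta> where th: "0 \<le> \<theta>" "\<theta> \<le> pi/2" "\<bar>Re w\<bar> = norm w * cos \<theta>" "\<bar>Im w\<bar> = norm w * sin \<theta>"
    using sincos_abs[OF w] by blast
  have e: "exp (lr w) = norm w" using w by (simp add: lr_def)
  have main: "D (lr w) \<theta> = 0 \<and> Re \<alpha> = \<sigma> * norm \<alpha> * cos (Im (L (Complex (lr w) \<theta>))) \<and> Im \<alpha> = \<tau> * norm \<alpha> * sin (Im (L (Complex (lr w) \<theta>)))"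
    if st: "\<sigma> \<in> {1,-1}" "\<tau> \<in> {1,-1}" and r: "Re w = \<sigma> * \<bar>Re w\<bar>" "Im w = \<tau> * \<bar>Im w\<bar>" for \<sigma> \<tau>
  proof -
    have "w = Complex (\<sigma> * (exp (lr w) * cos \<theta>)) (\<tau> * (exp (lr w) * sin \<theta>))"
      using r th(3,4) e by (metis complex.exhaust_sel)
    thus ?thesis using zero_iff[OF st th(1,2), of "lr w"] assms by simp
  qed
  have "Re w = (if Re w \<ge> 0 then 1 else -1) * \<bar>Re w\<bar>" "Im w = (if Im w \<ge> 0 then 1 else -1) * \<bar>Im w\<bar>" by auto
  hence D0: "D (lr w) \<theta> = 0"
    using main[of "if Re w \<ge> 0 then 1 else -1" "if Im w \<ge> 0 then 1 else -1"] by (auto split: if_splits)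
  have T: "Th (lr w) = \<theta>" by (rule Th_eqI) (use th D0 in auto)
  show "D (lr w) (Th (lr w)) = 0" "\<bar>Re w\<bar> = norm w * cos (Th (lr w))" "\<bar>Im w\<bar> = norm w * sin (Th (lr w))"
    using T D0 th by auto
  show "Re \<alpha> = \<sigma> * norm \<alpha> * cos (B (lr w)) \<and> Im \<alpha> = \<tau> * norm \<alpha> * sin (B (lr w))"
    if "\<sigma> \<in> {1,-1}" "\<tau> \<in> {1,-1}" "Re w = \<sigma> * \<bar>Re w\<bar>" "Im w = \<tau> * \<bar>Im w\<bar>" for \<sigma> \<tau>
    using main[OF that] T by (simp add: B_def cv_def)
qed

lemma zero_construct:
  assumes "D \<rho> (Th \<rho>) = 0" "\<sigma> \<in> {1,-1}" "\<tau> \<in> {1,-1}"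
    "Re \<alpha> = \<sigma> * norm \<alpha> * cos (B \<rho>)" "Im \<alpha> = \<tau> * norm \<alpha> * sin (B \<rho>)"
  shows "Q (Complex (\<sigma> * (exp \<rho> * cos (Th \<rho>))) (\<tau> * (exp \<rho> * sin (Th \<rho>)))) = 0"
    and "lr (Complex (\<sigma> * (exp \<rho> * cos (Th \<rho>))) (\<tau> * (exp \<rho> * sin (Th \<rho>)))) = \<rho>"
proof -
  show "Q (Complex (\<sigma> * (exp \<rho> * cos (Th \<rho>))) (\<tau> * (exp \<rho> * sin (Th \<rho>)))) = 0"
    using zero_iff[OF assms(2,3) Th(1,2), of \<rho> \<rho>] assms by (simp add: B_def cv_def)
  have "(\<sigma> * (exp \<rho> * cos (Th \<rho>)))\<^sup>2 + (\<tau> * (exp \<rho> * sin (Th \<rho>)))\<^sup>2 = (exp \<rho>)\<^sup>2"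
  proof -
    have s2: "\<sigma>\<^sup>2 = 1" "\<tau>\<^sup>2 = 1" using assms(2,3) by auto
    show ?thesis unfolding power_mult_distrib s2 by (simp flip: distrib_left)
  qed
  hence "norm (Complex (\<sigma> * (exp \<rho> * cos (Th \<rho>))) (\<tau> * (exp \<rho> * sin (Th \<rho>)))) = exp \<rho>"
    by (simp add: complex_norm)
  thus "lr (Complex (\<sigma> * (exp \<rho> * cos (Th \<rho>))) (\<tau> * (exp \<rho> * sin (Th \<rho>)))) = \<rho>"
    by (simp add: lr_def)
qed

section \<open>The curve near the origin\<close>

lemma exp_imag_axis: "exp (2 * Complex \<rho> (pi/2)) = - of_real ((exp \<rho>)\<^sup>2)"
proof -
  have "2 * Complex \<rho> (pi/2) = Complex (2 * \<rho>) pi" by (simp add: complex_eq_iff)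
  thus ?thesis by (simp add: complex_eq_iff Re_exp Im_exp flip: exp_double of_real_power)
qed

lemma exp_real_axis: "exp (2 * Complex \<rho> 0) = of_real ((exp \<rho>)\<^sup>2)"
proof -
  have "2 * Complex \<rho> 0 = Complex (2 * \<rho>) 0" by (simp add: complex_eq_iff)
  thus ?thesis by (simp add: complex_eq_iff Re_exp Im_exp flip: exp_double of_real_power)
qed

lemma isCont_neg_prod: "isCont (neg_prod s) z" "isCont (neg_prod t) z"
  using S.holomorphic_neg_prod[of UNIV] T.holomorphic_neg_prod[of UNIV]
  by (auto dest!: holomorphic_on_imp_continuous_on simp: continuous_on_eq_continuous_at)

text \<open>As z tends to 0, U tends to 1 and V to 0. So D is positive even at the angle pi/2, the
  curve runs on the imaginary edge, and B is the argument of 1 / z there, no factor having changed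
  sign.\<close>

lemma initial_p0:
  assumes "p = 0"
  shows "\<exists>\<rho>0. \<forall>\<rho>\<le>\<rho>0. Th \<rho> = pi/2 \<and> B \<rho> = - pi/2"
proof -
  \<comment> \<open>This is exp \<rho> * D \<rho> (pi/2); the factor removes the unbounded exp (-
    \<rho>), so that the limit at minus infinity exists.\<close>
  let ?G = "\<lambda>\<rho>. norm (neg_prod s (- of_real ((exp \<rho>)\<^sup>2))) - norm \<alpha> * exp \<rho> * norm (neg_prod t (of_real ((exp \<rho>)\<^sup>2)))"
  have ee: "ee = -1" unfolding ee_def using assms pq by simp
  have e0: "((\<lambda>\<rho>::real. exp \<rho>) \<longlongrightarrow> 0) at_bot" by (rule exp_at_bot)
  have "((\<lambda>\<rho>. ?G \<rho>)
     \<longlongrightarrow> norm (neg_prod s (- of_real (0\<^sup>2))) - norm \<alpha> * 0 * norm (neg_prod t (of_real (0\<^sup>2)))) at_bot"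
    by (intro tendsto_intros isCont_tendsto_compose[OF isCont_neg_prod(1)] isCont_tendsto_compose[OF isCont_neg_prod(2)] e0)
  hence "((\<lambda>\<rho>. ?G \<rho>)
     \<longlongrightarrow> 1) at_bot"
    by (simp add: S.neg_prod_0)
  hence "eventually (\<lambda>\<rho>. ?G \<rho> > 0) at_bot"
    by (rule order_tendstoD) simp
  hence "eventually (\<lambda>\<rho>. D \<rho> (pi/2) \<ge> 0) at_bot"
  proof eventually_elim
    case (elim \<rho>)
    have "exp \<rho> * D \<rho> (pi/2) = ?G \<rho>"
      by (simp add: D_def ee exp_imag_axis algebra_simps flip: exp_add)
    thus ?case using elim by (metis exp_gt_zero less_imp_le zero_less_mult_pos)
  qed
  then obtain \<rho>1 where r1: "\<And>\<rho>. \<rho> \<le> \<rho>1 \<Longrightarrow> D \<rho> (pi/2) \<ge> 0"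
    by (auto simp: eventually_at_bot_linorder)
  obtain \<rho>2 where r2: "\<And>\<zeta>. Im \<zeta> = pi \<Longrightarrow> Re \<zeta> \<le> \<rho>2 \<Longrightarrow> Im (log_neg_prod s \<zeta>) = 0"
    using S.Im_log_neg_prod_pi_initial by blast
  show ?thesis
  proof (intro exI[of _ "min \<rho>1 (\<rho>2/2)"] allI impI)
    fix \<rho> assume r: "\<rho> \<le> min \<rho>1 (\<rho>2/2)"
    have T: "Th \<rho> = pi/2" by (rule Th_eq_pi_halfI) (use r1 r in auto)
    have "B \<rho> = Im (log_neg_prod s (2 * cv \<rho>)) + ee * pi / 2"
      unfolding B_def by (rule Im_L_imag[OF cv_dom]) (simp add: T)
    also have "Im (log_neg_prod s (2 * cv \<rho>)) = 0" by (rule r2) (use r T in auto)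
    finally show "Th \<rho> = pi/2 \<and> B \<rho> = - pi/2" using T by (simp add: ee)
  qed
qed

text \<open>Now U tends to 0 and V to 1, so the curve runs on the real edge and the level B = 0
  extends to minus infinity. This is the origin of the exceptional value 1 of
  \<open>cap\<close>.\<close>

lemma initial_p1:
  assumes "p = 1"
  shows "\<exists>\<rho>0. \<forall>\<rho>\<le>\<rho>0. Th \<rho> = 0 \<and> B \<rho> = 0 \<and> D \<rho> 0 < 0"
proof -
  let ?G = "\<lambda>\<rho>. exp \<rho> * norm (neg_prod s (of_real ((exp \<rho>)\<^sup>2))) - norm \<alpha> * norm (neg_prod t (- of_real ((exp \<rho>)\<^sup>2)))"
  have ee: "ee = 1" unfolding ee_def using assms pq by simp
  have e0: "((\<lambda>\<rho>::real. exp \<rho>) \<longlongrightarrow> 0) at_bot" by (rule exp_at_bot)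
  have "((\<lambda>\<rho>. ?G \<rho>)
     \<longlongrightarrow> 0 * norm (neg_prod s (of_real (0\<^sup>2))) - norm \<alpha> * norm (neg_prod t (- of_real (0\<^sup>2)))) at_bot"
    by (intro tendsto_intros isCont_tendsto_compose[OF isCont_neg_prod(1)] isCont_tendsto_compose[OF isCont_neg_prod(2)] e0)
  hence "((\<lambda>\<rho>. ?G \<rho>)
     \<longlongrightarrow> - norm \<alpha>) at_bot"
    by (simp add: T.neg_prod_0)
  hence "eventually (\<lambda>\<rho>. ?G \<rho> < 0) at_bot"
    by (rule order_tendstoD) (simp add: alpha_nz)
  then obtain \<rho>1 where r1: "\<And>\<rho>. \<rho> \<le> \<rho>1 \<Longrightarrow> D \<rho> 0 < 0"
    by (auto simp: eventually_at_bot_linorder D_def ee exp_real_axis)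
  obtain \<rho>2 where r2: "\<And>\<zeta>. Im \<zeta> = pi \<Longrightarrow> Re \<zeta> \<le> \<rho>2 \<Longrightarrow> Im (log_neg_prod t \<zeta>) = 0"
    using T.Im_log_neg_prod_pi_initial by blast
  show ?thesis
  proof (intro exI[of _ "min \<rho>1 (\<rho>2/2)"] allI impI)
    fix \<rho> assume r: "\<rho> \<le> min \<rho>1 (\<rho>2/2)"
    have T: "Th \<rho> = 0" by (rule Th_eq_0I) (use r1[of \<rho>] r in auto)
    have "B \<rho> = Im (log_neg_prod t (2 * cnj (cv \<rho>) + \<i> * pi))"
      unfolding B_def by (rule Im_L_real[OF cv_dom]) (simp add: T)
    also have "\<dots> = 0" by (rule r2) (use r T in auto)
    finally show "Th \<rho> = 0 \<and> B \<rho> = 0 \<and> D \<rho> 0 < 0" using T r1[of \<rho>] r by simp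
  qed
qed

abbreviation pt :: "real \<Rightarrow> complex" where "pt \<rho> \<equiv> of_real (exp \<rho>)"

text \<open>On the positive axis the quotient \<open>U / V\<close> is real; \<open>Phi\<close> is this quotient as a function of
  \<open>\<rho> = ln x\<close>, where \<open>x = pt \<rho>\<close>.\<close>

definition "Phi \<rho> = Re (U (pt \<rho>) / V (pt \<rho>))"
definition "RK \<rho> = Re (K (pt \<rho>))"

lemma Reg_real_iff: "pt \<rho> \<in> Reg \<longleftrightarrow> neg_prod t (- of_real ((exp \<rho>)\<^sup>2)) \<noteq> 0"
  using nz_s[of 0 \<rho>] by (auto simp: Reg_def exp_real_axis)

lemma Th0_Reg: "Th \<rho> = 0 \<Longrightarrow> pt \<rho> \<in> Reg"
  using cv_dom[of \<rho>] by (simp add: Reg_real_iff Sdom_def cv_def exp_real_axis)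

lemma UV_real: "Im (U (pt \<rho>) / V (pt \<rho>)) = 0"
proof -
  have "U (pt \<rho>) / V (pt \<rho>) = cnj (U (pt \<rho>) / V (pt \<rho>))"
    using U_cnj[of "of_real (exp \<rho>)"] V_cnj[of "of_real (exp \<rho>)"] by simp
  thus ?thesis by (metis Im_complex_of_real Reals_cnj_iff complex_is_Real_iff)
qed

lemma UV_Phi: "U (pt \<rho>) / V (pt \<rho>) = of_real (Phi \<rho>)"
  using UV_real by (simp add: Phi_def complex_eq_iff)

lemma K_real: "pt \<rho> \<in> Reg \<Longrightarrow> K (pt \<rho>) = of_real (RK \<rho>)"
proof -
  assume r: "pt \<rho> \<in> Reg"
  have "Im (log_deriv_neg_prod s (of_real ((exp \<rho>)\<^sup>2))) = 0"
    by (rule S.Im_log_deriv_real) (use r in \<open>simp add: Reg_def\<close>)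
  moreover have "Im (log_deriv_neg_prod t (of_real (- ((exp \<rho>)\<^sup>2)))) = 0"
    by (rule T.Im_log_deriv_real) (use r in \<open>simp add: Reg_def\<close>)
  ultimately show ?thesis by (simp add: complex_eq_iff RK_def K_def)
qed

lemma DERIV_Phi:
  assumes "pt \<rho> \<in> Reg"
  shows "(Phi has_real_derivative Phi \<rho> * RK \<rho>) (at \<rho>)"
proof -
  let ?z = "pt \<rho>"
  note nz = Reg_nz[OF assms]
  have 1: "((\<lambda>z. U z / V z) has_field_derivative (U ?z / V ?z * K ?z / ?z)) (at ?z)"
    by (rule derivative_eq_intros DERIV_U[OF assms] DERIV_V[OF assms] refl nz)+
      (use nz in \<open>simp add: K_def ee_def field_simps\<close>)
  have 2: "((\<lambda>\<rho>. pt \<rho>) has_vector_derivative of_real (exp \<rho>)) (at \<rho>)"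
    by (auto intro!: derivative_eq_intros has_vector_derivative_of_real simp: has_real_derivative_iff_has_vector_derivative[symmetric])
  have "((\<lambda>\<rho>. U (pt \<rho>) / V (pt \<rho>)) has_vector_derivative
      (?z * (U ?z / V ?z * K ?z / ?z))) (at \<rho>)"
    using field_vector_diff_chain_at[OF 2 1] by (simp only: o_def)
  hence "((\<lambda>\<rho>. Re (U (pt \<rho>) / V (pt \<rho>))) has_vector_derivative
      Re (?z * (U ?z / V ?z * K ?z / ?z))) (at \<rho>)"
    by (rule bounded_linear.has_vector_derivative[OF bounded_linear_Re])
  moreover have "Re (?z * (U ?z / V ?z * K ?z / ?z)) = Phi \<rho> * RK \<rho>"
  proof -
    have "?z * (U ?z / V ?z * K ?z / ?z) = of_real (Phi \<rho>) * of_real (RK \<rho>)"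
      unfolding UV_Phi K_real[OF assms] using nz(1) by (simp del: of_real_exp)
    thus ?thesis by simp
  qed
  ultimately show ?thesis
    by (simp add: has_real_derivative_iff_has_vector_derivative Phi_def[abs_def])
qed

text \<open>By \<open>DERIV_Phi\<close>, \<open>RK\<close> is the derivative of ln |Phi| in \<rho>;
  so ln |Phi| is strictly convex on intervals that avoid the zeros of V.\<close>

lemma DERIV_RK:
  assumes "pt \<rho> \<in> Reg"
  obtains d where "(RK has_real_derivative d) (at \<rho>)" "d > 0"
proof -
  obtain d where d: "(K has_field_derivative of_real d) (at (pt \<rho>))" "exp \<rho> * d > 0"
    using K_deriv_real[OF assms] by blast
  have 2: "((\<lambda>\<rho>. pt \<rho>) has_vector_derivative of_real (exp \<rho>)) (at \<rho>)"
    by (auto intro!: derivative_eq_intros has_vector_derivative_of_real simp: has_real_derivative_iff_has_vector_derivative[symmetric])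
  have "((\<lambda>\<rho>. K (pt \<rho>)) has_vector_derivative (of_real (exp \<rho>) * of_real d)) (at \<rho>)"
    using field_vector_diff_chain_at[OF 2 d(1)] by (simp only: o_def)
  hence "((\<lambda>\<rho>. Re (K (pt \<rho>))) has_vector_derivative Re (of_real (exp \<rho>) * of_real d)) (at \<rho>)"
    by (rule bounded_linear.has_vector_derivative[OF bounded_linear_Re])
  hence "(RK has_real_derivative (exp \<rho> * d)) (at \<rho>)"
    by (simp add: has_real_derivative_iff_has_vector_derivative RK_def[abs_def] del: of_real_exp flip: of_real_mult)
  thus thesis using d(2) that by blast
qed

lemma Phi_nz: "pt \<rho> \<in> Reg \<Longrightarrow> Phi \<rho> \<noteq> 0"
  using UV_Phi[of \<rho>] Reg_nz(2,3) by (metis divide_eq_0_iff of_real_0)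

lemma D0_Phi:
  assumes "pt \<rho> \<in> Reg"
  shows "D \<rho> 0 = normG \<rho> 0 * (\<bar>Phi \<rho>\<bar> - norm \<alpha>)"
    and "normG \<rho> 0 > 0"
proof -
  have d: "Complex \<rho> 0 \<in> Sdom"
    using assms nz_s[of 0 \<rho>] by (simp add: Reg_real_iff Sdom_def exp_real_axis)
  have e: "exp (Complex \<rho> 0) = of_real (exp \<rho>)" by (simp add: complex_eq_iff Re_exp Im_exp)
  have "exp (Re (L (Complex \<rho> 0))) = \<bar>Phi \<rho>\<bar>"
    using exp_L[OF d] unfolding e UV_Phi by (metis norm_exp_eq_Re norm_of_real)
  thus "D \<rho> 0 = normG \<rho> 0 * (\<bar>Phi \<rho>\<bar> - norm \<alpha>)"
    using D_eq(1)[OF d] by simp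
  show "normG \<rho> 0 > 0" using D_eq(2)[OF d] .
qed

end

section \<open>Counting an enumeration by levels\<close>

definition level_zeros :: "(complex \<Rightarrow> complex) \<Rightarrow> (complex \<Rightarrow> nat) \<Rightarrow> nat \<Rightarrow> complex set" where
  "level_zeros F lev j = {w. F w = 0 \<and> lev w = j}"

text \<open>Levels are ordered by modulus, and each level below an occupied one holds exactly
  \<open>cap j\<close> zeros by \<open>le\<close> and \<open>ge\<close>. All zeros of lower levels
  precede z n, and the first n zeros lie on levels up to that of z n, which brackets n between two
  partial sums of \<open>cap\<close>. The highest occupied level may be incomplete, hence the form
  of \<open>ge\<close>.\<close>

lemma level_count:
  fixes F :: "complex \<Rightarrow> complex" and lev :: "complex \<Rightarrow> nat" and cap :: "nat \<Rightarrow> nat"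
  assumes en: "enumerates_zeros F N z"
    and pos: "\<And>w. F w = 0 \<Longrightarrow> zorder F w > 0"
    and mono: "\<And>w w'. F w = 0 \<Longrightarrow> F w' = 0 \<Longrightarrow> lev w < lev w' \<Longrightarrow> norm w < norm w'"
    and fin: "\<And>j. finite (level_zeros F lev j)"
    and le: "\<And>j. (\<Sum>w\<in>level_zeros F lev j. nat (zorder F w)) \<le> cap j"
    and ge: "\<And>j w'. F w' = 0 \<Longrightarrow> j < lev w' \<Longrightarrow> cap j \<le> (\<Sum>w\<in>level_zeros F lev j. nat (zorder F w))"
    and n: "1 \<le> n" "enat n \<le> N"
  shows "(\<Sum>j<lev (z n). cap j) < n" "n \<le> (\<Sum>j\<le>lev (z n). cap j)"
proof -
  define I where "I = {n. 1 \<le> n \<and> enat n \<le> N}"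
  define J where "J = (\<lambda>j. {n\<in>I. lev (z n) = j})"
  have zero: "F (z n) = 0" if "n \<in> I" for n
    using en that by (auto simp: enumerates_zeros_def I_def)
  have cardw: "card {n\<in>I. z n = w} = nat (zorder F w)" if "F w = 0" for w
  proof -
    have "int (card {n\<in>I. z n = w}) = zorder F w"
      using en that by (auto simp: enumerates_zeros_def I_def)
    thus ?thesis by linarith
  qed
  have finw: "finite {n\<in>I. z n = w}" if "F w = 0" for w
    using cardw[OF that] pos[OF that] by (metis card.infinite zero_less_nat_eq less_irrefl)
  have Jeq: "J j = (\<Union>w\<in>level_zeros F lev j. {n\<in>I. z n = w})" for j
    using zero by (auto simp: J_def level_zeros_def)
  have Jfin: "finite (J j)" for j
    unfolding Jeq by (intro finite_UN_I fin finw) (auto simp: level_zeros_def)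
  have Jcard: "card (J j) = (\<Sum>w\<in>level_zeros F lev j. nat (zorder F w))" for j
  proof -
    have "card (J j) = (\<Sum>w\<in>level_zeros F lev j. card {n\<in>I. z n = w})"
      unfolding Jeq by (intro card_UN_disjoint fin) (auto simp: level_zeros_def finw)
    also have "\<dots> = (\<Sum>w\<in>level_zeros F lev j. nat (zorder F w))"
      by (intro sum.cong refl) (auto simp: level_zeros_def cardw)
    finally show ?thesis .
  qed
  have norm_mono: "norm (z m) \<le> norm (z k)" if "1 \<le> m" "m \<le> k" "enat k \<le> N" for m k
    using that(2,3)
  proof (induction k rule: dec_induct)
    case (step k)
    have "enat k \<le> N" using step(4) by (meson Suc_ile_eq order_less_imp_le)
    hence "norm (z m) \<le> norm (z k)" using step by blast
    also have "norm (z k) \<le> norm (z (Suc k))"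
      using en step(4) that(1) step(1) unfolding enumerates_zeros_def by (metis Suc_1 Suc_le_mono diff_Suc_1 le_trans)
    finally show ?case .
  qed simp
  have nI: "n \<in> I" using n by (simp add: I_def)
  have below: "m < n" if "m \<in> I" "lev (z m) < lev (z n)" for m
  proof (rule ccontr)
    assume "\<not> m < n"
    hence "norm (z n) \<le> norm (z m)" using norm_mono[of n m] n that by (auto simp: I_def)
    thus False using mono[OF zero[OF that(1)] zero[OF nI] that(2)] by linarith
  qed
  have above: "lev (z m) \<le> lev (z n)" if "1 \<le> m" "m \<le> n" for m
  proof (rule ccontr)
    assume a: "\<not> lev (z m) \<le> lev (z n)"
    have "enat m \<le> N" using n that by (meson enat_ord_simps(1) order_trans)
    hence mI: "m \<in> I" using that by (simp add: I_def)
    have "norm (z n) < norm (z m)" using mono[OF zero[OF nI] zero[OF mI]] a by simp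
    thus False using norm_mono[OF that n(2)] by linarith
  qed
  have "(\<Sum>j<lev (z n). cap j) \<le> (\<Sum>j<lev (z n). card (J j))"
    unfolding Jcard by (intro sum_mono ge[OF zero[OF nI]]) auto
  also have "\<dots> = card (\<Union>j\<in>{..<lev (z n)}. J j)"
    by (rule card_UN_disjoint[symmetric]) (auto simp: Jfin, auto simp: J_def)
  also have "\<dots> \<le> card {1..<n}"
    by (intro card_mono) (use below in \<open>auto simp: J_def I_def\<close>)
  also have "\<dots> < n" using n by simp
  finally show "(\<Sum>j<lev (z n). cap j) < n" .
  have "n = card {1..n}" by simp
  also have "\<dots> \<le> card (\<Union>j\<in>{..lev (z n)}. J j)"
  proof (intro card_mono)
    show "finite (\<Union>j\<in>{..lev (z n)}. J j)" using Jfin by auto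
    show "{1..n} \<subseteq> (\<Union>j\<in>{..lev (z n)}. J j)"
    proof
      fix m assume m: "m \<in> {1..n}"
      hence "enat m \<le> N" using n by (meson atLeastAtMost_iff enat_ord_simps(1) order_trans)
      thus "m \<in> (\<Union>j\<in>{..lev (z n)}. J j)" using m above by (auto simp: J_def I_def)
    qed
  qed
  also have "\<dots> = (\<Sum>j\<le>lev (z n). card (J j))"
    by (rule card_UN_disjoint) (auto simp: Jfin, auto simp: J_def)
  also have "\<dots> \<le> (\<Sum>j\<le>lev (z n). cap j)"
    unfolding Jcard by (intro sum_mono le)
  finally show "n \<le> (\<Sum>j\<le>lev (z n). cap j)" .
qed

lemma enumerates_zeros_zero: "enumerates_zeros F N z \<Longrightarrow> 1 \<le> n \<Longrightarrow> enat n \<le> N \<Longrightarrow> F (z n) = 0"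
  by (simp add: enumerates_zeros_def)

lemma enumerates_zeros_distinct:
  assumes en: "enumerates_zeros F N z" and m: "1 \<le> m" "m < n" "enat n \<le> N" and o: "zorder F (z n) = 1"
  shows "z m \<noteq> z n"
proof
  assume eq: "z m = z n"
  have mN: "enat m \<le> N" using m by (meson enat_ord_simps(2) less_imp_le order_trans)
  have F0: "F (z n) = 0" using en m by (auto intro: enumerates_zeros_zero)
  hence c: "card {k. 1 \<le> k \<and> enat k \<le> N \<and> z k = z n} = 1"
  proof -
    have "int (card {k. 1 \<le> k \<and> enat k \<le> N \<and> z k = z n}) = zorder F (z n)"
      using en F0 unfolding enumerates_zeros_def by blast
    thus ?thesis using o by linarith
  qed
  then obtain x where "{k. 1 \<le> k \<and> enat k \<le> N \<and> z k = z n} = {x}" by (rule card_1_singletonE)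
  moreover have "m \<in> {k. 1 \<le> k \<and> enat k \<le> N \<and> z k = z n}" "n \<in> {k. 1 \<le> k \<and> enat k \<le> N \<and> z k = z n}"
    using m mN eq by auto
  ultimately show False using m by auto
qed

lemma first_zero:
  fixes f :: "real \<Rightarrow> real"
  assumes "a \<le> b" "continuous_on {a..b} f" "f a < 0" "f b \<ge> 0"
  obtains c where "a < c" "c \<le> b" "f c = 0" "\<And>x. a \<le> x \<Longrightarrow> x < c \<Longrightarrow> f x < 0"
proof -
  define S where "S = {x\<in>{a..b}. 0 \<le> f x}"
  have "closed S" unfolding S_def
    by (rule continuous_on_closed_Collect_le[OF continuous_on_const assms(2)]) simp
  moreover have "bounded S" by (rule bounded_subset[of "{a..b}"]) (auto simp: S_def)
  ultimately have "compact S" by (simp add: compact_eq_bounded_closed)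
  moreover have "S \<noteq> {}" using assms by (auto simp: S_def)
  ultimately obtain c where c: "c \<in> S" "\<And>x. x \<in> S \<Longrightarrow> c \<le> x"
    using compact_attains_inf by metis
  have neg: "f x < 0" if "a \<le> x" "x < c" for x
    using c that by (force simp: S_def)
  have ac: "a < c" using c(1) assms by (cases "a = c") (auto simp: S_def)
  have "f c = 0"
  proof (rule ccontr)
    assume "f c \<noteq> 0"
    hence fc: "f c > 0" using c(1) by (auto simp: S_def)
    have "continuous_on {a..c} f" by (rule continuous_on_subset[OF assms(2)]) (use c in \<open>auto simp: S_def\<close>)
    then obtain x where "a \<le> x" "x \<le> c" "f x = 0"
      using IVT'[of f a 0 c] fc assms ac by auto
    thus False using neg[of x] fc by (cases "x = c") auto
  qed
  thus thesis using that[of c] ac neg c(1) by (auto simp: S_def)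
qed

lemma last_zero:
  fixes f :: "real \<Rightarrow> real"
  assumes "a \<le> b" "continuous_on {a..b} f" "f b < 0" "f a \<ge> 0"
  obtains c where "a \<le> c" "c < b" "f c = 0" "\<And>x. c < x \<Longrightarrow> x \<le> b \<Longrightarrow> f x < 0"
proof -
  have "continuous_on {-b..-a} (\<lambda>x. f (- x))"
    by (rule continuous_on_compose2[OF assms(2)]) (auto intro!: continuous_intros)
  then obtain c where c: "-b < c" "c \<le> -a" "f (- c) = 0" "\<And>x. -b \<le> x \<Longrightarrow> x < c \<Longrightarrow> f (- x) < 0"
    using first_zero[of "-b" "-a" "\<lambda>x. f (- x)"] assms by auto
  show thesis
    using that[of "-c"] c(1-3) c(4)[of "- x" for x] by (metis minus_less_iff minus_minus minus_le_iff neg_le_iff_le)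
qed

context prod_pair
begin

lemma lr_less_iff: "Q w = 0 \<Longrightarrow> Q w' = 0 \<Longrightarrow> lr w < lr w' \<longleftrightarrow> norm w < norm w'"
proof -
  assume "Q w = 0" "Q w' = 0"
  hence "0 < norm w" "0 < norm w'" using Q_0 by auto
  thus ?thesis unfolding lr_def by (rule ln_less_cancel_iff)
qed

lemma B_less: "Q w = 0 \<Longrightarrow> Q w' = 0 \<Longrightarrow> B (lr w) < B (lr w') \<Longrightarrow> norm w < norm w'"
  using B_mono[of "lr w'" "lr w"] lr_less_iff by force

text \<open>On the real edge B is a multiple of pi, on the imaginary edge an odd multiple of
  pi/2.\<close>

lemma Th_cos_sin:
  "cos (B \<rho>) \<noteq> 0 \<Longrightarrow> Th \<rho> \<noteq> pi/2" "sin (B \<rho>) \<noteq> 0 \<Longrightarrow> Th \<rho> \<noteq> 0"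
proof -
  have "cos (B \<rho>) = 0" if th: "Th \<rho> = pi/2"
  proof -
    obtain k :: nat where "B \<rho> = of_nat k * pi + ee * pi / 2" using B_imag[OF th] by blast
    moreover have "ee = 1 \<or> ee = -1" using pq_cases by (auto simp: ee_def)
    ultimately show ?thesis by (auto simp: cos_add sin_npi)
  qed
  moreover have "sin (B \<rho>) = 0" if th: "Th \<rho> = 0"
  proof -
    obtain k :: nat where "B \<rho> = of_nat k * pi" using B_real[OF th] by blast
    thus ?thesis by (simp add: sin_npi)
  qed
  ultimately show "cos (B \<rho>) \<noteq> 0 \<Longrightarrow> Th \<rho> \<noteq> pi/2" "sin (B \<rho>) \<noteq> 0 \<Longrightarrow> Th \<rho> \<noteq> 0" by auto
qed

lemma B_IVT:
  assumes "B \<rho>1 \<le> y" "y \<le> B \<rho>2"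
  obtains \<rho> where "B \<rho> = y"
proof -
  have "min \<rho>1 \<rho>2 \<le> max \<rho>1 \<rho>2" by simp
  moreover have "B (min \<rho>1 \<rho>2) \<le> y" using assms B_mono[of "min \<rho>1 \<rho>2" \<rho>1] by linarith
  moreover have "y \<le> B (max \<rho>1 \<rho>2)" using assms B_mono[of \<rho>2 "max \<rho>1 \<rho>2"] by linarith
  ultimately show thesis using IVT'[of B "min \<rho>1 \<rho>2" y "max \<rho>1 \<rho>2"] continuous_B that by blast
qed

end

text \<open>The numbers \<open>b \<ge> - \<pi>/2\<close> with \<open>\<bar>cos b\<bar> = cos a\<close>, in increasing order.\<close>

definition nodal_arg :: "real \<Rightarrow> nat \<Rightarrow> real" where
  "nodal_arg a j = (if even j then of_nat (j div 2) * pi - a else of_nat (j div 2) * pi + a)"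

lemma nodal_arg_Suc:
  assumes "0 < a" "a < pi/2"
  shows "nodal_arg a j < nodal_arg a (Suc j)"
  using assms by (cases "even j") (auto simp: nodal_arg_def algebra_simps elim!: evenE oddE)

lemma strict_mono_nodal_arg: "0 < a \<Longrightarrow> a < pi/2 \<Longrightarrow> strict_mono (nodal_arg a)"
  by (rule strict_monoI_Suc) (rule nodal_arg_Suc)

lemma cos_nodal_arg: "cos (nodal_arg a j) = (-1) ^ (j div 2) * cos a"
  by (simp add: nodal_arg_def cos_add cos_diff cos_npi sin_npi)

lemma sin_nodal_arg: "sin (nodal_arg a j) = - ((-1) ^ ((j + 1) div 2) * sin a)"
  by (auto simp: nodal_arg_def sin_add sin_diff cos_npi sin_npi elim!: evenE oddE)

lemma ex_nodal_arg:
  assumes a: "0 < a" "a < pi/2" and b: "- (pi/2) \<le> b" and c: "\<bar>cos b\<bar> = cos a"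
  shows "\<exists>j. b = nodal_arg a j"
proof -
  \<comment> \<open>The integer nearest to b / pi, so that b - m pi lies in [-pi/2, pi/2], where cos
    is nonnegative.\<close>
  define m where "m = nat \<lfloor>b / pi + 1/2\<rfloor>"
  have "b / pi + 1/2 \<ge> 0" using b by (simp add: field_simps)
  hence m: "of_nat m \<le> b / pi + 1/2" "b / pi + 1/2 < of_nat m + 1"
    unfolding m_def by (auto simp: of_nat_nat le_floor_iff intro: floor_correct[THEN conjunct1] floor_correct[THEN conjunct2, simplified])
  define b' where "b' = b - of_nat m * pi"
  have "of_nat m * pi \<le> b + pi/2" "b + pi/2 < of_nat m * pi + pi"
    using m pi_gt_zero by (auto simp: field_simps)
  hence b': "\<bar>b'\<bar> \<le> pi/2" unfolding b'_def by linarith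
  have "cos b = cos (b' + of_nat m * pi)" by (simp add: b'_def)
  also have "\<dots> = (-1)^m * cos b'" by (simp add: cos_add cos_npi sin_npi)
  finally have "\<bar>cos b\<bar> = \<bar>cos b'\<bar>" by (simp add: abs_mult power_abs)
  moreover have "cos b' \<ge> 0" using b' by (intro cos_ge_zero) auto
  ultimately have "cos \<bar>b'\<bar> = cos a" using c by simp
  hence "\<bar>b'\<bar> = a" using cos_inj_pi[of "\<bar>b'\<bar>" a] b' a pi_gt_zero by linarith
  hence "b = nodal_arg a (2 * m) \<or> b = nodal_arg a (2 * m + 1)"
    by (auto simp: nodal_arg_def b'_def abs_if split: if_splits)
  thus ?thesis by blast
qed

section \<open>Zeros for a parameter off the axes\<close>

context prod_pair
begin

text \<open>The level of a zero is the index of its B among the values of \<open>nodal_arg\<close>.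
  None of these is a multiple of pi/2, so the curve is off the edges there, B is strictly
  increasing, and a level holds at most one zero, a simple one. By continuity B takes all such
  values below an attained one. Hence z n has level n - 1, and the signs of cos and sin at
  \<open>nodal_arg\<close> determine its quadrant.\<close>

theorem zeros_nonreal_square:
  assumes p0: "p = 0" and RI: "Re \<alpha> \<noteq> 0" "Im \<alpha> \<noteq> 0" and en: "enumerates_zeros Q N z"
  shows "\<And>w. Q w = 0 \<Longrightarrow> zorder Q w = 1"
    and "\<And>n. 1 \<le> n \<Longrightarrow> enat n \<le> N \<Longrightarrow> Re (z n) * Re \<alpha> * (-1) ^ ((n - 1) div 2) > 0"
    and "\<And>n. 1 \<le> n \<Longrightarrow> enat n \<le> N \<Longrightarrow> Im (z n) * Im \<alpha> * (-1) ^ (n div 2) < 0"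
    and "\<And>n. 1 \<le> n \<Longrightarrow> enat (Suc n) \<le> N \<Longrightarrow> norm (z n) < norm (z (Suc n))"
proof -
  obtain a where "0 \<le> a" "a \<le> pi/2" and ra: "\<bar>Re \<alpha>\<bar> = norm \<alpha> * cos a" and ia: "\<bar>Im \<alpha>\<bar> = norm \<alpha> * sin a"
    using sincos_abs[OF alpha_nz] by blast
  moreover have "a \<noteq> 0" using RI ia by auto
  moreover have "a \<noteq> pi/2" using RI(1) ra by (metis abs_eq_0 cos_pi_half mult_zero_right)
  ultimately have a: "0 < a" "a < pi/2" by linarith+
  have ca: "cos a > 0" "sin a > 0" using a by (auto intro!: cos_gt_zero sin_gt_zero2)
  note sm = strict_mono_nodal_arg[OF a]
  obtain \<rho>0 where rho0: "\<And>\<rho>. \<rho> \<le> \<rho>0 \<Longrightarrow> B \<rho> = - pi/2" using initial_p0[OF p0] by blast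
  have Bge: "B \<rho> \<ge> - pi/2" for \<rho>
    using rho0[of "min \<rho> \<rho>0"] B_mono[of "min \<rho> \<rho>0" \<rho>] by simp
  define sg where "sg x = (if x \<ge> 0 then 1 else - 1 :: real)" for x :: real
  have sg: "sg x \<in> {1,-1}" "x = sg x * \<bar>x\<bar>" for x by (auto simp: sg_def)
  have rel: "Re \<alpha> = sg (Re w) * norm \<alpha> * cos (B (lr w))" "Im \<alpha> = sg (Im w) * norm \<alpha> * sin (B (lr w))" if "Q w = 0" for w
    using zero_repr(4)[OF that sg(1) sg(1) sg(2) sg(2)] by auto
  have an: "norm \<alpha> > 0" using alpha_nz by simp
  have ex: "\<exists>j. B (lr w) = nodal_arg a j" if "Q w = 0" for w
  proof (rule ex_nodal_arg[OF a])
    show "- (pi/2) \<le> B (lr w)" using Bge[of "lr w"] by simp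
    have "norm \<alpha> * \<bar>cos (B (lr w))\<bar> = norm \<alpha> * cos a"
      using arg_cong[OF rel(1)[OF that], of abs] ra sg(1)[of "Re w"] by (auto simp: abs_mult)
    thus "\<bar>cos (B (lr w))\<bar> = cos a" using an by simp
  qed
  define lev where "lev w = (SOME j. B (lr w) = nodal_arg a j)" for w
  have lev: "B (lr w) = nodal_arg a (lev w)" if "Q w = 0" for w
    unfolding lev_def by (rule someI_ex[OF ex[OF that]])
  have interior: "Th \<rho> \<noteq> 0" "Th \<rho> \<noteq> pi/2" if "B \<rho> = nodal_arg a j" for \<rho> j
  proof -
    have "cos (B \<rho>) \<noteq> 0" "sin (B \<rho>) \<noteq> 0"
      unfolding that cos_nodal_arg sin_nodal_arg using ca by auto
    thus "Th \<rho> \<noteq> 0" "Th \<rho> \<noteq> pi/2" using Th_cos_sin by auto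
  qed
  have ReIm: "Re w * Re \<alpha> * (-1) ^ (lev w div 2) > 0" "Im w * Im \<alpha> * (-1) ^ ((lev w + 1) div 2) < 0" if "Q w = 0" for w
  proof -
    define T where "T = Th (lr w)"
    have T: "0 < T" "T < pi/2"
      using interior[OF lev[OF that]] Th[of "lr w"] by (auto simp: T_def order_less_le)
    have nw: "norm w > 0" using that Q_0 by auto
    have 1: "\<bar>Re w\<bar> > 0" "\<bar>Im w\<bar> > 0"
      unfolding zero_repr(2,3)[OF that] T_def[symmetric] using nw T by (auto intro!: mult_pos_pos cos_gt_zero sin_gt_zero2)
    have "Re \<alpha> * (-1) ^ (lev w div 2) = sg (Re w) * (norm \<alpha> * cos a)"
      using rel(1)[OF that] unfolding lev[OF that] cos_nodal_arg by (simp flip: power_mult_distrib)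
    hence "Re w * Re \<alpha> * (-1) ^ (lev w div 2) = (Re w * sg (Re w)) * (norm \<alpha> * cos a)" by simp
    also have "Re w * sg (Re w) = \<bar>Re w\<bar>" by (auto simp: sg_def)
    finally show "Re w * Re \<alpha> * (-1) ^ (lev w div 2) > 0" using 1 an ca by simp
    have "Im \<alpha> * (-1) ^ ((lev w + 1) div 2) = - sg (Im w) * (norm \<alpha> * sin a)"
      using rel(2)[OF that] unfolding lev[OF that] sin_nodal_arg by (simp flip: power_mult_distrib)
    hence "Im w * Im \<alpha> * (-1) ^ ((lev w + 1) div 2) = - ((Im w * sg (Im w)) * (norm \<alpha> * sin a))"
      by (simp add: mult.assoc)
    also have "Im w * sg (Im w) = \<bar>Im w\<bar>" by (auto simp: sg_def)
    finally show "Im w * Im \<alpha> * (-1) ^ ((lev w + 1) div 2) < 0" using 1 an ca by simp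
  qed
  have zo: "zorder Q w = 1" if "Q w = 0" for w
  proof (rule zorder_1[OF that K_nonreal[OF zero_Reg[OF that]]])
    show "Im (w\<^sup>2) \<noteq> 0" using ReIm[OF that] by (auto simp: power2_eq_square)
  qed
  have uniq: "w = w'" if "Q w = 0" "Q w' = 0" "lev w = lev w'" for w w'
  proof -
    have Beq: "B (lr w) = B (lr w')" using lev that by simp
    have "\<not> lr w < lr w'" "\<not> lr w' < lr w"
      using B_strict[of "lr w" "lr w'"] B_strict[of "lr w'" "lr w"] Beq interior[OF lev[OF that(1)]] by auto
    hence l: "lr w = lr w'" by simp
    hence n: "norm w = norm w'" using lr_less_iff[OF that(1,2)] lr_less_iff[OF that(2,1)] by simp
    have abs: "\<bar>Re w\<bar> = \<bar>Re w'\<bar>" "\<bar>Im w\<bar> = \<bar>Im w'\<bar>" using zero_repr(2,3) that l n by auto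
    have "sg (Re w) = sg (Re w')" "sg (Im w) = sg (Im w')"
      using rel[OF that(1)] rel[OF that(2)] RI l by auto
    thus ?thesis using abs sg(2) by (metis complex_eq_iff)
  qed
  have lz: "level_zeros Q lev j = {} \<or> (\<exists>w. level_zeros Q lev j = {w} \<and> Q w = 0)" for j
  proof (cases "level_zeros Q lev j = {}")
    case False
    then obtain w where w: "Q w = 0" "lev w = j" by (auto simp: level_zeros_def)
    have "x = w" if "Q x = 0" "lev x = j" for x
      using uniq[OF that(1) w(1)] that w by simp
    hence "level_zeros Q lev j = {w}" using w unfolding level_zeros_def by blast
    thus ?thesis using w by blast
  qed simp
  have mono: "norm w < norm w'" if "Q w = 0" "Q w' = 0" "lev w < lev w'" for w w'
    using B_less[OF that(1,2)] lev that sm by (simp add: strict_mono_less)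
  have ge: "\<exists>w. Q w = 0 \<and> lev w = j" if "Q w' = 0" "j < lev w'" for j w'
  proof -
    have "nodal_arg a j \<le> B (lr w')" using lev[OF that(1)] that(2) sm by (simp add: strict_mono_less_eq)
    moreover have "B \<rho>0 \<le> nodal_arg a j"
    proof -
      have "nodal_arg a 0 \<le> nodal_arg a j" using sm by (simp add: strict_mono_less_eq)
      thus ?thesis using rho0[of \<rho>0] a by (simp add: nodal_arg_def)
    qed
    ultimately obtain \<rho> where r: "B \<rho> = nodal_arg a j" using B_IVT by blast
    have "0 < Th \<rho>" "Th \<rho> < pi/2" using interior[OF r] Th[of \<rho>] by auto
    hence D0: "D \<rho> (Th \<rho>) = 0" using Th[of \<rho>] by fastforce
    \<comment> \<open>The signs select the reflection at which U / V, of modulus |\<alpha>| and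
      argument \<open>nodal_arg a j\<close> in the first quadrant, becomes \<alpha>.\<close>
    define \<sigma> where "\<sigma> = sg (Re \<alpha>) * (-1) ^ (j div 2)"
    define \<tau> where "\<tau> = - sg (Im \<alpha>) * (-1) ^ ((j + 1) div 2)"
    have st: "\<sigma> \<in> {1,-1}" "\<tau> \<in> {1,-1}"
      using sg(1)[of "Re \<alpha>"] sg(1)[of "Im \<alpha>"]
      by (auto simp: \<sigma>_def \<tau>_def minus_one_power_iff)
    have "\<sigma> * norm \<alpha> * cos (B \<rho>) = sg (Re \<alpha>) * (norm \<alpha> * cos a)"
      unfolding r cos_nodal_arg \<sigma>_def by (simp flip: power_mult_distrib)
    hence 1: "Re \<alpha> = \<sigma> * norm \<alpha> * cos (B \<rho>)" using sg(2)[of "Re \<alpha>", unfolded ra] by linarith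
    have "\<tau> * norm \<alpha> * sin (B \<rho>) = sg (Im \<alpha>) * (norm \<alpha> * sin a)"
      unfolding r sin_nodal_arg \<tau>_def by (simp flip: power_mult_distrib)
    hence 2: "Im \<alpha> = \<tau> * norm \<alpha> * sin (B \<rho>)" using sg(2)[of "Im \<alpha>", unfolded ia] by linarith
    note zc = zero_construct[OF D0 st 1 2]
    have "nodal_arg a (lev (Complex (\<sigma> * (exp \<rho> * cos (Th \<rho>))) (\<tau> * (exp \<rho> * sin (Th \<rho>))))) = nodal_arg a j"
      using lev[OF zc(1)] r unfolding zc(2) by simp
    thus ?thesis using zc(1) sm by (metis strict_mono_eq)
  qed
  have count: "lev (z n) = n - 1" if n: "1 \<le> n" "enat n \<le> N" for n
  proof -
    have le: "(\<Sum>w\<in>level_zeros Q lev j. nat (zorder Q w)) \<le> 1" for j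
      using lz[of j] zo by auto
    have ge': "1 \<le> (\<Sum>w\<in>level_zeros Q lev j. nat (zorder Q w))" if w: "Q w' = 0" "j < lev w'" for j w'
    proof -
      have "level_zeros Q lev j \<noteq> {}" using ge[OF w] by (auto simp: level_zeros_def)
      thus ?thesis using lz[of j] zo by auto
    qed
    have fin: "finite (level_zeros Q lev j)" for j using lz[of j] by auto
    have pos: "zorder Q w > 0" if "Q w = 0" for w using zo[OF that] by simp
    have "(\<Sum>j<lev (z n). 1) < n"
      by (rule level_count(1)[where F = Q and N = N and cap = "\<lambda>_. 1"]) (fact en pos mono fin le ge' n)+
    moreover have "n \<le> (\<Sum>j\<le>lev (z n). 1)"
      by (rule level_count(2)[where F = Q and N = N and cap = "\<lambda>_. 1"]) (fact en pos mono fin le ge' n)+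
    ultimately have "lev (z n) < n" "n \<le> Suc (lev (z n))" by simp_all
    thus ?thesis by linarith
  qed
  show "\<And>w. Q w = 0 \<Longrightarrow> zorder Q w = 1" by (rule zo)
  fix n :: nat assume n: "1 \<le> n"
  show "Re (z n) * Re \<alpha> * (-1) ^ ((n - 1) div 2) > 0" if "enat n \<le> N"
    using ReIm(1)[OF enumerates_zeros_zero[OF en n that]] count[OF n that] by simp
  show "Im (z n) * Im \<alpha> * (-1) ^ (n div 2) < 0" if "enat n \<le> N"
    using ReIm(2)[OF enumerates_zeros_zero[OF en n that]] count[OF n that] n by simp
  show "norm (z n) < norm (z (Suc n))" if N: "enat (Suc n) \<le> N"
  proof -
    have N': "enat n \<le> N" using N by (meson Suc_ile_eq order_less_imp_le)
    show ?thesis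
      using mono[OF enumerates_zeros_zero[OF en n N'] enumerates_zeros_zero[OF en _ N]]
        count[OF n N'] count[OF _ N] n by simp
  qed
qed

end

subsection \<open>Real quotients\<close>

locale real_prod_pair = prod_pair +
  assumes alpha_real: "Im \<alpha> = 0"
begin

text \<open>At a zero the quotient is a nonnegative integer by \<open>zero_level\<close>, so nothing
  is lost by rounding.\<close>

definition "lev w = nat \<lfloor>B (lr w) / pi\<rfloor>"
text \<open>The common sign of the real parts of the zeros on level k, see \<open>zero_sign\<close>;
  it alternates with k.\<close>

definition "sgk k = sgn (Re \<alpha>) * (-1) ^ k" for k :: nat
text \<open>The number of zeros on the level \<open>B = k \<pi>\<close>, provided that there are zeros on higher levels.\<close>

definition "cap k = (if p = 1 \<and> k = 0 then 1 else 2 :: nat)" for k :: nat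

abbreviation "lz \<equiv> level_zeros Q lev"

lemma Re_alpha: "Re \<alpha> \<noteq> 0" "norm \<alpha> = \<bar>Re \<alpha>\<bar>" "\<alpha> = of_real (Re \<alpha>)"
  using alpha_nz alpha_real by (auto simp: complex_eq_iff cmod_eq_Re)

lemma sgk: "sgk k \<in> {1,-1}" "sgk k * sgk k = 1"
  using Re_alpha(1) by (auto simp: sgk_def sgn_if minus_one_power_iff)

lemma sgk_cos: "sgk k * norm \<alpha> * cos (of_nat k * pi) = Re \<alpha>"
  unfolding Re_alpha(2) by (auto simp: sgk_def sgn_if cos_npi minus_one_power_iff)

lemma B_lower: "B \<rho> \<ge> - pi/2"
proof -
  obtain \<rho>0 where r: "\<And>\<rho>. \<rho> \<le> \<rho>0 \<Longrightarrow> B \<rho> \<ge> - pi/2"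
    using initial_p0 initial_p1 pq_cases pi_gt_zero by (metis divide_nonpos_pos less_imp_le neg_le_0_iff_le order_refl zero_less_numeral)
  have "- pi/2 \<le> B (min \<rho> \<rho>0)" by (rule r) simp
  also have "\<dots> \<le> B \<rho>" by (rule B_mono) simp
  finally show ?thesis .
qed

text \<open>A real \<alpha> forces sin B = 0, and B \<ge> -pi/2 excludes the negative multiples of
  pi.\<close>

lemma zero_level:
  assumes "Q w = 0"
  shows "B (lr w) = of_nat (lev w) * pi"
proof -
  define \<tau> where "\<tau> = (if Im w \<ge> 0 then 1 else -1 :: real)"
  define \<sigma> where "\<sigma> = (if Re w \<ge> 0 then 1 else -1 :: real)"
  have "Im \<alpha> = \<tau> * norm \<alpha> * sin (B (lr w))"
    using zero_repr(4)[OF assms, of \<sigma> \<tau>] by (auto simp: \<tau>_def \<sigma>_def)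
  hence "sin (B (lr w)) = 0" using alpha_real alpha_nz by (auto simp: \<tau>_def split: if_splits)
  then obtain i :: int where i: "B (lr w) = of_int i * pi" using sin_zero_iff_int2 by blast
  have "of_int i * pi \<ge> - pi / 2" using B_lower[of "lr w"] i by simp
  hence "(of_int i + 1/2) * pi \<ge> 0" by (simp add: algebra_simps)
  hence "of_int i + 1/2 \<ge> (0::real)" using pi_gt_zero by (simp add: zero_le_mult_iff)
  hence "i \<ge> 0" by linarith
  thus ?thesis unfolding lev_def i by simp
qed

text \<open>The imaginary edge carries only odd multiples of pi/2. This is why no zero is purely
  imaginary.\<close>

lemma Th_level: "B \<rho> = of_nat k * pi \<Longrightarrow> Th \<rho> < pi/2"
  using Th_cos_sin(1)[of \<rho>] Th(2)[of \<rho>] by (simp add: cos_npi)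

lemma zero_sign:
  assumes "Q w = 0"
  shows "Re w = sgk (lev w) * \<bar>Re w\<bar>" "\<bar>Re w\<bar> > 0"
proof -
  define \<tau> where "\<tau> = (if Im w \<ge> 0 then 1 else -1 :: real)"
  define \<sigma> where "\<sigma> = (if Re w \<ge> 0 then 1 else -1 :: real)"
  have "Re \<alpha> = \<sigma> * norm \<alpha> * cos (B (lr w))"
    using zero_repr(4)[OF assms, of \<sigma> \<tau>] by (auto simp: \<tau>_def \<sigma>_def)
  hence "\<sigma> * norm \<alpha> * cos (of_nat (lev w) * pi) = sgk (lev w) * norm \<alpha> * cos (of_nat (lev w) * pi)"
    using zero_level[OF assms] sgk_cos[of "lev w"] by metis
  hence "\<sigma> = sgk (lev w)" using alpha_nz by (simp add: cos_npi)
  moreover have "Re w = \<sigma> * \<bar>Re w\<bar>" by (auto simp: \<sigma>_def)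
  ultimately show "Re w = sgk (lev w) * \<bar>Re w\<bar>" by simp
  have "cos (Th (lr w)) > 0"
    using Th_level[OF zero_level[OF assms]] Th(1)[of "lr w"] by (intro cos_gt_zero_pi) auto
  moreover have "norm w > 0" using assms Q_0 by auto
  ultimately show "\<bar>Re w\<bar> > 0" using zero_repr(2)[OF assms] by simp
qed

lemma zorder_zero:
  assumes "Q w = 0"
  shows "Im w \<noteq> 0 \<Longrightarrow> zorder Q w = 1" "Im w = 0 \<Longrightarrow> zorder Q w = (if K w = 0 then 2 else 1)"
proof -
  assume "Im w \<noteq> 0"
  moreover have "Re w \<noteq> 0" using zero_sign(2)[OF assms] by simp
  ultimately have "Im (w\<^sup>2) \<noteq> 0" by (simp add: power2_eq_square)
  thus "zorder Q w = 1" by (intro zorder_1 K_nonreal zero_Reg assms)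
next
  assume "Im w = 0"
  hence w: "w = of_real (Re w)" by (simp add: complex_eq_iff)
  show "zorder Q w = (if K w = 0 then 2 else 1)"
    using zorder_real[of "Re w"] assms w by metis
qed

lemma level_zero_eqI:
  assumes "Q w = 0" "Q w' = 0" "lev w = lev w'" "norm w = norm w'"
  shows "w' = w \<or> w' = cnj w"
proof -
  have l: "lr w = lr w'" using assms(4) by (simp add: lr_def)
  have "Re w = Re w'"
    using zero_sign(1)[OF assms(1)] zero_sign(1)[OF assms(2)] assms(3,4)
      zero_repr(2)[OF assms(1)] zero_repr(2)[OF assms(2)] l by metis
  moreover have "\<bar>Im w\<bar> = \<bar>Im w'\<bar>"
    using zero_repr(3)[OF assms(1)] zero_repr(3)[OF assms(2)] l assms(4) by simp
  ultimately show ?thesis by (auto simp: complex_eq_iff abs_if split: if_splits)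
qed

lemma Im_zero_iff: "Q w = 0 \<Longrightarrow> Im w = 0 \<longleftrightarrow> Th (lr w) = 0"
proof -
  assume w: "Q w = 0"
  have "norm w > 0" using w Q_0 by auto
  moreover have "sin (Th (lr w)) = 0 \<longleftrightarrow> Th (lr w) = 0"
    using sin_gt_zero[of "Th (lr w)"] Th[of "lr w"] pi_gt_zero by force
  ultimately show ?thesis using zero_repr(3)[OF w] by auto
qed

text \<open>If \<open>Th\<close> is in the interior of \<open>[0, \<pi>/2]\<close> at a point of the level \<open>B = k \<pi>\<close>, then \<open>B\<close> is strictly
  monotone there, so the level consists of a single pair of conjugate zeros.\<close>

lemma nonreal_level:
  assumes b: "B \<rho> = of_nat k * pi" and th: "Th \<rho> \<noteq> 0"
  obtains w where "lz k = {w, cnj w}" "Im w \<noteq> 0" "Q w = 0" "Q (cnj w) = 0" "\<not> (p = 1 \<and> k = 0)"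
proof -
  have T: "0 < Th \<rho>" "Th \<rho> < pi/2" using th Th(1)[of \<rho>] Th_level[OF b] by auto
  have D0: "D \<rho> (Th \<rho>) = 0" using Th(3,4)[of \<rho>] T by force
  define W where "W \<tau> = Complex (sgk k * (exp \<rho> * cos (Th \<rho>))) (\<tau> * (exp \<rho> * sin (Th \<rho>)))" for \<tau>
  have W: "Q (W \<tau>) = 0" "lr (W \<tau>) = \<rho>" if "\<tau> \<in> {1,-1}" for \<tau>
  proof -
    have "Re \<alpha> = sgk k * norm \<alpha> * cos (B \<rho>)" unfolding b using sgk_cos by simp
    moreover have "Im \<alpha> = \<tau> * norm \<alpha> * sin (B \<rho>)" unfolding b by (simp add: alpha_real sin_npi)
    ultimately show "Q (W \<tau>) = 0" "lr (W \<tau>) = \<rho>"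
      unfolding W_def by (rule zero_construct[OF D0 sgk(1) that])+
  qed
  have lev: "lev w = j \<longleftrightarrow> B (lr w) = of_nat j * pi" if "Q w = 0" for w j
    using zero_level[OF that] by auto
  have cnj: "W (-1) = cnj (W 1)" by (simp add: W_def complex_eq_iff)
  have uniq: "\<rho>' = \<rho>" if "B \<rho>' = of_nat k * pi" for \<rho>'
    using B_strict[of \<rho> \<rho>'] B_strict[of \<rho>' \<rho>] b that T by (cases \<rho> \<rho>' rule: linorder_cases) auto
  have "w = W 1 \<or> w = cnj (W 1)" if "Q w = 0" "lev w = k" for w
  proof -
    have "lr w = \<rho>" using that lev uniq by blast
    hence "norm w = norm (W 1)"
      using W[of 1] lr_less_iff[OF that(1) W(1)[of 1]] lr_less_iff[OF W(1)[of 1] that(1)] by auto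
    thus ?thesis using level_zero_eqI[OF W(1)[of 1] that(1)] that lev[OF W(1)[of 1]] W(2)[of 1] b by auto
  qed
  hence "lz k = {W 1, cnj (W 1)}"
    using W[of 1] W[of "-1"] lev b unfolding cnj level_zeros_def by auto
  moreover have "Im (W 1) \<noteq> 0"
    using T sin_gt_zero2[OF T] by (simp add: W_def)
  \<comment> \<open>For p = 1 the level B = 0 contains a half-line reaching minus infinity, which
    contradicts the uniqueness of \<rho>.\<close>
  moreover have "\<not> (p = 1 \<and> k = 0)"
  proof
    assume "p = 1 \<and> k = 0"
    then obtain \<rho>0 where "\<And>\<rho>. \<rho> \<le> \<rho>0 \<Longrightarrow> B \<rho> = 0" using initial_p1 by blast
    hence "B (min \<rho>0 (\<rho> - 1)) = of_nat k * pi" using \<open>p = 1 \<and> k = 0\<close> by simp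
    from uniq[OF this] show False by linarith
  qed
  ultimately show thesis using that W(1)[of 1] W(1)[of "-1"] cnj by simp
qed

text \<open>The alternative to \<open>nonreal_level\<close>: the whole level lies on the real edge,
  so its zeros are real. A level that B does not reach is flat too.\<close>

definition "flat k \<longleftrightarrow> (\<forall>\<rho>. B \<rho> = of_nat k * pi \<longrightarrow> Th \<rho> = 0)" for k :: nat

text \<open>On a flat level the curve has angle 0, so the angle in D is fixed in advance;
  \<open>flat_lz\<close> identifies these \<rho> with the zeros of the level.\<close>

definition "RZ k = {\<rho>. B \<rho> = of_nat k * pi \<and> D \<rho> 0 = 0}" for k :: nat

abbreviation "mult_RZ k \<equiv> \<Sum>\<rho>\<in>RZ k. if RK \<rho> = 0 then 2 else (1::nat)" for k :: nat

definition "rz k \<rho> = complex_of_real (sgk k * exp \<rho>)" for k :: nat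

lemma rz_zero:
  assumes "flat k" "\<rho> \<in> RZ k"
  shows "Q (rz k \<rho>) = 0" "lr (rz k \<rho>) = \<rho>" "lev (rz k \<rho>) = k"
proof -
  have b: "B \<rho> = of_nat k * pi" and T: "Th \<rho> = 0" and D0: "D \<rho> (Th \<rho>) = 0"
    using assms by (auto simp: flat_def RZ_def)
  have eq: "rz k \<rho> = Complex (sgk k * (exp \<rho> * cos (Th \<rho>))) (1 * (exp \<rho> * sin (Th \<rho>)))"
    by (simp add: rz_def T complex_eq_iff)
  have 1: "Re \<alpha> = sgk k * norm \<alpha> * cos (B \<rho>)" unfolding b using sgk_cos by simp
  have 2: "Im \<alpha> = 1 * norm \<alpha> * sin (B \<rho>)" unfolding b by (simp add: alpha_real sin_npi)
  have 3: "(1::real) \<in> {1,-1}" by simp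
  show Q: "Q (rz k \<rho>) = 0" unfolding eq by (rule zero_construct[OF D0 sgk(1) 3 1 2])
  show l: "lr (rz k \<rho>) = \<rho>" unfolding eq by (rule zero_construct[OF D0 sgk(1) 3 1 2])
  show "lev (rz k \<rho>) = k" using zero_level[OF Q] l b by simp
qed

lemma flat_lz: "flat k \<Longrightarrow> lz k = rz k ` RZ k"
proof (intro equalityI subsetI)
  fix w assume f: "flat k" and "w \<in> lz k"
  hence w: "Q w = 0" "lev w = k" by (auto simp: level_zeros_def)
  have b: "B (lr w) = of_nat k * pi" using zero_level[OF w(1)] w by simp
  hence T: "Th (lr w) = 0" using f by (simp add: flat_def)
  have "lr w \<in> RZ k" using b T zero_repr(1)[OF w(1)] by (simp add: RZ_def)
  moreover have "w = rz k (lr w)"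
  proof -
    have "Im w = 0" using T Im_zero_iff[OF w(1)] by simp
    moreover have "exp (lr w) = norm w" using w Q_0 by (auto simp: lr_def)
    ultimately show ?thesis
      using zero_sign(1)[OF w(1)] zero_repr(2)[OF w(1)] T w(2) by (simp add: rz_def complex_eq_iff)
  qed
  ultimately show "w \<in> rz k ` RZ k" by blast
next
  fix w assume "flat k" "w \<in> rz k ` RZ k"
  thus "w \<in> lz k" using rz_zero by (auto simp: level_zeros_def)
qed

lemma inj_rz: "inj_on (rz k) A"
proof (rule inj_onI)
  fix x y assume "rz k x = rz k y"
  hence "sgk k * exp x = sgk k * exp y" unfolding rz_def by (simp only: of_real_eq_iff)
  moreover have "sgk k \<noteq> 0" using sgk(1)[of k] by auto
  ultimately show "x = y" by simp
qed

lemma flat_Reg: "flat k \<Longrightarrow> B \<rho> = of_nat k * pi \<Longrightarrow> pt \<rho> \<in> Reg"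
  using Th0_Reg by (simp add: flat_def)

lemma zorder_rz:
  assumes "flat k" "\<rho> \<in> RZ k"
  shows "zorder Q (rz k \<rho>) = (if RK \<rho> = 0 then 2 else 1)"
proof -
  have "(sgk k)\<^sup>2 = 1" using sgk(2)[of k] by (simp add: power2_eq_square)
  hence "(rz k \<rho>)\<^sup>2 = (pt \<rho>)\<^sup>2"
    by (simp add: rz_def power_mult_distrib del: of_real_exp flip: of_real_power)
  hence "K (rz k \<rho>) = K (pt \<rho>)" unfolding K_def by simp
  also have "\<dots> = of_real (RK \<rho>)"
    using assms by (intro K_real flat_Reg[of k]) (auto simp: RZ_def)
  finally show ?thesis
    using zorder_zero(2)[OF rz_zero(1)[OF assms]] by (simp add: rz_def)
qed

lemma Phi_RZ:
  assumes "flat k" "\<rho> \<in> RZ k"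
  shows "\<bar>Phi \<rho>\<bar> = norm \<alpha>"
proof -
  have r: "pt \<rho> \<in> Reg" using assms flat_Reg by (auto simp: RZ_def)
  show ?thesis using D0_Phi[OF r] assms by (auto simp: RZ_def)
qed

lemma between: "B \<rho>1 = y \<Longrightarrow> B \<rho>2 = y \<Longrightarrow> \<rho>1 \<le> \<rho> \<Longrightarrow> \<rho> \<le> \<rho>2 \<Longrightarrow> B \<rho> = y"
  using B_mono[of \<rho>1 \<rho>] B_mono[of \<rho> \<rho>2] by linarith

text \<open>The square replaces |Phi|: it is differentiable whatever the sign of Phi, and its
  derivative has the sign of \<open>RK\<close>.\<close>

lemma DERIV_Phi_square:
  assumes "pt \<rho> \<in> Reg"
  shows "((\<lambda>\<rho>. (Phi \<rho>)\<^sup>2) has_real_derivative 2 * (Phi \<rho>)\<^sup>2 * RK \<rho>) (at \<rho>)"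
  by (rule derivative_eq_intros DERIV_Phi[OF assms] refl)+ (simp add: power2_eq_square)

lemma RK_less:
  assumes f: "flat k" and b: "B \<rho>1 = of_nat k * pi" "B \<rho>2 = of_nat k * pi" and l: "\<rho>1 < \<rho>2"
  shows "RK \<rho>1 < RK \<rho>2"
proof (rule DERIV_pos_imp_increasing[OF l])
  fix x assume "\<rho>1 \<le> x" "x \<le> \<rho>2"
  hence "pt x \<in> Reg" using flat_Reg[OF f] between[OF b] by blast
  thus "\<exists>y. (RK has_real_derivative y) (at x) \<and> 0 < y" by (rule DERIV_RK) blast
qed

text \<open>Phi^2 has the same value |\<alpha>|^2 at both points, so by Rolle \<open>RK\<close>
  vanishes in between, and it is strictly increasing along the level.\<close>

lemma RK_signs:
  assumes f: "flat k" and R: "\<rho>1 \<in> RZ k" "\<rho>2 \<in> RZ k" and l: "\<rho>1 < \<rho>2"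
  shows "RK \<rho>1 < 0" "0 < RK \<rho>2"
proof -
  have b: "B \<rho>1 = of_nat k * pi" "B \<rho>2 = of_nat k * pi" using R by (auto simp: RZ_def)
  have reg: "pt x \<in> Reg" if "\<rho>1 \<le> x" "x \<le> \<rho>2" for x
    using that flat_Reg[OF f] between[OF b] by blast
  have "(Phi \<rho>1)\<^sup>2 = (Phi \<rho>2)\<^sup>2" using Phi_RZ[OF f] R by (metis power2_abs)
  moreover have "continuous_on {\<rho>1..\<rho>2} (\<lambda>\<rho>. (Phi \<rho>)\<^sup>2)"
    using reg DERIV_Phi_square by (intro DERIV_atLeastAtMost_imp_continuous_on) blast
  moreover have "(\<lambda>\<rho>. (Phi \<rho>)\<^sup>2) differentiable (at x)" if "\<rho>1 < x" "x < \<rho>2" for x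
    using DERIV_Phi_square[OF reg[of x]] that by (auto simp: real_differentiable_def)
  ultimately obtain x where x: "\<rho>1 < x" "x < \<rho>2" "((\<lambda>\<rho>. (Phi \<rho>)\<^sup>2) has_real_derivative 0) (at x)"
    using Rolle[OF l, of "\<lambda>\<rho>. (Phi \<rho>)\<^sup>2"] by blast
  have rx: "pt x \<in> Reg" using reg x by simp
  have "2 * (Phi x)\<^sup>2 * RK x = 0" using DERIV_unique[OF DERIV_Phi_square[OF rx] x(3)] .
  hence R0: "RK x = 0" using Phi_nz[OF rx] by simp
  have bx: "B x = of_nat k * pi" using between[OF b] x by auto
  show "RK \<rho>1 < 0" using RK_less[OF f b(1) bx x(1)] R0 by simp
  show "0 < RK \<rho>2" using RK_less[OF f bx b(2) x(2)] R0 by simp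
qed

text \<open>Far to the left |Phi| < |\<alpha>|. If \<open>RK\<close> were not positive at \<rho>, it
  would be negative before, and |Phi| would have decreased to its value |\<alpha>| at
  \<rho>.\<close>

lemma RK_initial:
  assumes f: "flat 0" and p: "p = 1" and R: "\<rho> \<in> RZ 0"
  shows "RK \<rho> > 0"
proof (rule ccontr)
  assume neg: "\<not> RK \<rho> > 0"
  obtain \<rho>0 where r0: "\<And>\<rho>. \<rho> \<le> \<rho>0 \<Longrightarrow> B \<rho> = 0 \<and> D \<rho> 0 < 0" using initial_p1[OF p] by blast
  define x where "x = min \<rho>0 (\<rho> - 1)"
  have x: "x < \<rho>" "B x = of_nat 0 * pi" "D x 0 < 0" using r0[of x] by (auto simp: x_def)
  have b: "B \<rho> = of_nat 0 * pi" using R by (simp add: RZ_def)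
  have reg: "pt y \<in> Reg" if "x \<le> y" "y \<le> \<rho>" for y
    using that flat_Reg[OF f] between[OF x(2) b] by blast
  have "(Phi \<rho>)\<^sup>2 < (Phi x)\<^sup>2"
  proof (rule DERIV_neg_imp_decreasing_open[OF x(1)])
    fix y assume y: "x < y" "y < \<rho>"
    hence ry: "pt y \<in> Reg" using reg by simp
    have "B y = of_nat 0 * pi" using between[OF x(2) b, of y] y by simp
    hence "RK y < 0" using RK_less[OF f _ b y(2)] neg by simp
    hence "2 * (Phi y)\<^sup>2 * RK y < 0" using Phi_nz[OF ry] by (simp add: mult_pos_neg)
    thus "\<exists>d. ((\<lambda>\<rho>. (Phi \<rho>)\<^sup>2) has_real_derivative d) (at y) \<and> d < 0"
      using DERIV_Phi_square[OF ry] by blast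
  next
    show "continuous_on {x..\<rho>} (\<lambda>\<rho>. (Phi \<rho>)\<^sup>2)"
      using reg DERIV_Phi_square by (intro DERIV_atLeastAtMost_imp_continuous_on) blast
  qed
  hence "\<bar>Phi x\<bar> > norm \<alpha>" using Phi_RZ[OF f R] by (metis abs_le_square_iff not_le abs_abs)
  moreover have "pt x \<in> Reg" using reg x by simp
  ultimately have "D x 0 > 0" using D0_Phi by simp
  thus False using x by simp
qed

text \<open>Three points are impossible, since the middle one would need both signs of
  \<open>RK\<close>. Two points are simple by \<open>RK_signs\<close>; a single point counts at most
  twice, and only once on the unbounded initial level by \<open>RK_initial\<close>.\<close>

lemma finite_RZ_sum:
  assumes f: "flat k"
  shows "finite (RZ k)" "mult_RZ k \<le> cap k"
proof -
  consider "RZ k = {}" | x where "RZ k = {x}" | x y where "x \<in> RZ k" "y \<in> RZ k" "x < y"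
    by (metis linorder_neqE_linordered_idom equals0I insertI1 is_singletonI' is_singleton_def)
  hence "finite (RZ k) \<and> mult_RZ k \<le> cap k"
  proof cases
    case 2
    have "RK x > 0 \<and> cap k = 1 \<or> cap k = 2"
    proof (cases "p = 1 \<and> k = 0")
      case True
      hence "RK x > 0" using RK_initial[of x] f 2 by blast
      moreover have "cap k = 1" using True unfolding cap_def by (rule if_P)
      ultimately show ?thesis by simp
    next
      case False
      hence "cap k = 2" unfolding cap_def by (rule if_not_P)
      thus ?thesis by simp
    qed
    thus ?thesis using 2 by auto
  next
    case 3
    have "RZ k = {x, y}"
    proof -
      have "v = x \<or> v = y" if v: "v \<in> RZ k" for v
        using RK_signs[OF f _ _] v 3 by (metis linorder_neqE_linordered_idom order_less_asym)
      thus ?thesis using 3 by blast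
    qed
    moreover have "\<not> (p = 1 \<and> k = 0)" using RK_initial[of x] RK_signs(1)[OF f 3] 3 f by fastforce
    hence "cap k = 2" unfolding cap_def by (rule if_not_P)
    ultimately show ?thesis using RK_signs[OF f 3] 3(3) by auto
  qed auto
  thus "finite (RZ k)" "mult_RZ k \<le> cap k" by auto
qed

lemma flat_sum:
  assumes f: "flat k"
  shows "(\<Sum>w\<in>lz k. nat (zorder Q w)) = mult_RZ k"
  unfolding flat_lz[OF f] sum.reindex[OF inj_rz] o_def
  by (intro sum.cong refl) (use zorder_rz[OF f] in auto)

lemma not_flat_sum:
  assumes "\<not> flat k"
  shows "finite (lz k)" "(\<Sum>w\<in>lz k. nat (zorder Q w)) = cap k"
proof -
  obtain \<rho> where r: "B \<rho> = of_nat k * pi" "Th \<rho> \<noteq> 0" using assms by (auto simp: flat_def)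
  obtain w where w: "lz k = {w, cnj w}" "Im w \<noteq> 0" "Q w = 0" "Q (cnj w) = 0" "\<not> (p = 1 \<and> k = 0)"
    using nonreal_level[OF r] by blast
  show "finite (lz k)" using w by simp
  have "w \<noteq> cnj w" using w(2) by (simp add: complex_eq_iff)
  moreover have "zorder Q w = 1" "zorder Q (cnj w) = 1" using zorder_zero(1) w by auto
  ultimately show "(\<Sum>w\<in>lz k. nat (zorder Q w)) = cap k" unfolding w(1) using w(5) by (simp add: cap_def)
qed

lemma finite_lz: "finite (lz k)"
  using not_flat_sum(1)[of k] flat_lz[of k] finite_RZ_sum(1)[of k] by (cases "flat k") auto

lemma sum_le_cap: "(\<Sum>w\<in>lz k. nat (zorder Q w)) \<le> cap k"
  using not_flat_sum(2)[of k] flat_sum[of k] finite_RZ_sum(2)[of k] by (cases "flat k") auto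

text \<open>While \<open>D\<close> is nonpositive on the real axis, \<open>Th = 0\<close> and \<open>B\<close> takes values in \<open>\<pi> \<int>\<close>.\<close>

lemma B_const:
  assumes "\<rho>1 \<le> \<rho>2" "\<And>x. \<rho>1 \<le> x \<Longrightarrow> x \<le> \<rho>2 \<Longrightarrow> D x 0 \<le> 0"
  shows "B \<rho>1 = B \<rho>2"
proof (rule ccontr)
  assume ne: "B \<rho>1 \<noteq> B \<rho>2"
  have int: "\<exists>k::nat. B x = of_nat k * pi" if "\<rho>1 \<le> x" "x \<le> \<rho>2" for x
    using B_real[OF Th_eq_0I[OF assms(2)[OF that]]] .
  obtain m :: nat where m: "B \<rho>1 = of_nat m * pi" using int[of \<rho>1] assms(1) by auto
  obtain n :: nat where n: "B \<rho>2 = of_nat n * pi" using int[of \<rho>2] assms(1) by auto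
  have "B \<rho>1 < B \<rho>2" using ne B_mono[OF assms(1)] by simp
  hence "of_nat m < (of_nat n :: real)" unfolding m n by (simp add: mult_less_cancel_right)
  hence "of_nat m + 1 \<le> (of_nat n :: real)" by (simp add: nat_less_real_le)
  hence "(of_nat m + 1) * pi \<le> B \<rho>2" unfolding n by (intro mult_right_mono) auto
  hence "of_nat m * pi + pi \<le> B \<rho>2" by (simp add: distrib_right)
  hence "of_nat m * pi + pi/2 \<le> B \<rho>2" using pi_gt_zero by linarith
  moreover have "B \<rho>1 \<le> of_nat m * pi + pi/2" using m pi_gt_zero by simp
  \<comment> \<open>If B moved from one multiple of pi to another, it would pass halfway between two
    consecutive ones.\<close>
  ultimately obtain x where x: "\<rho>1 \<le> x" "x \<le> \<rho>2" "B x = of_nat m * pi + pi/2"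
    using IVT'[of B \<rho>1 "of_nat m * pi + pi/2" \<rho>2] continuous_B assms(1) by blast
  obtain k :: nat where "B x = of_nat k * pi" using int x by blast
  hence "cos (of_nat k * pi) = cos (of_nat m * pi + pi/2)" using x by simp
  thus False by (simp add: cos_add cos_npi sin_npi)
qed

text \<open>If D < 0 on the real axis somewhere on a flat level, D must return to 0 on both sides
  before the level is left, which gives two zeros; on the unbounded initial level only the right
  side is available. If D is nowhere negative on the level, any of its points is a local minimum of
  |Phi| with value |\<alpha>|, hence a double zero.\<close>

lemma cap_le_sum:
  assumes w: "Q w' = 0" and k: "k < lev w'"
  shows "cap k \<le> (\<Sum>w\<in>lz k. nat (zorder Q w))"
proof (cases "flat k")
  case False thus ?thesis using not_flat_sum by simp
next
  case f: True
  define y where "y = lr w'"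
  have By: "B y = of_nat (lev w') * pi" unfolding y_def by (rule zero_level[OF w])
  have kl: "of_nat k * pi < B y" unfolding By using k by simp
  have Dy: "D y 0 \<ge> 0"
    using zero_repr(1)[OF w] D_strict[of 0 "Th y" y] Th[of y] by (cases "Th y = 0") (auto simp: y_def)
  \<comment> \<open>At y, where the zero on the higher level lies, D \<ge> 0. Up to the first sign
    change D \<le> 0, so B keeps its value by \<open>B_const\<close>.\<close>
  have right: "\<exists>\<rho>2>\<rho>. \<rho>2 \<in> RZ k" if r: "B \<rho> = of_nat k * pi" "D \<rho> 0 < 0" for \<rho>
  proof -
    have "\<rho> \<le> y" using B_mono[of y \<rho>] r kl by linarith
    then obtain c where c: "\<rho> < c" "c \<le> y" "D c 0 = 0" "\<And>x. \<rho> \<le> x \<Longrightarrow> x < c \<Longrightarrow> D x 0 < 0"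
      using first_zero[of \<rho> y "\<lambda>x. D x 0"] continuous_D_fst r(2) Dy by blast
    have "B \<rho> = B c"
    proof (rule B_const)
      fix x assume "\<rho> \<le> x" "x \<le> c"
      thus "D x 0 \<le> 0" using c(3) c(4)[of x] by (cases "x = c") auto
    qed (use c in simp)
    thus ?thesis using c r by (auto simp: RZ_def)
  qed
  have left: "\<exists>\<rho>1<\<rho>. \<rho>1 \<in> RZ k" if r: "B \<rho> = of_nat k * pi" "D \<rho> 0 < 0" and nk: "\<not> (p = 1 \<and> k = 0)" for \<rho>
  proof -
    \<comment> \<open>To the left B must come through k pi - pi/2, a value that excludes the real
      edge and so gives D \<ge> 0 at angle 0.\<close>
    have low: "\<exists>x. B x \<le> of_nat k * pi - pi/2"
    proof (cases "p = 0")
      case True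
      then obtain \<rho>0 where "\<And>\<rho>. \<rho> \<le> \<rho>0 \<Longrightarrow> B \<rho> = - pi/2" using initial_p0 by blast
      hence "B \<rho>0 = - pi/2" by simp
      thus ?thesis by (intro exI[of _ \<rho>0]) simp
    next
      case False
      hence p: "p = 1" using pq by simp
      then obtain \<rho>0 where "\<And>\<rho>. \<rho> \<le> \<rho>0 \<Longrightarrow> B \<rho> = 0" using initial_p1 by blast
      hence B0: "B \<rho>0 = 0" by simp
      have "1 \<le> real k" using nk p by simp
      hence "1 * pi \<le> real k * pi" by (intro mult_right_mono) auto
      thus ?thesis using pi_gt_zero by (intro exI[of _ \<rho>0]) (simp add: B0)
    qed
    then obtain x0 where "B x0 \<le> of_nat k * pi - pi/2" by blast
    moreover have "of_nat k * pi - pi/2 \<le> B \<rho>" using r pi_gt_zero by simp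
    ultimately obtain x where x: "B x = of_nat k * pi - pi/2" using B_IVT by blast
    have "x < \<rho>" using B_mono[of \<rho> x] x r pi_gt_zero by force
    have "sin (B x) \<noteq> 0" unfolding x by (simp add: sin_diff cos_npi sin_npi)
    hence "Th x \<noteq> 0" by (rule Th_cos_sin(2))
    hence "D x 0 \<ge> 0" using D_pos_below_Th[of 0 x] Th(1)[of x] by simp
    then obtain c where c: "x \<le> c" "c < \<rho>" "D c 0 = 0" "\<And>u. c < u \<Longrightarrow> u \<le> \<rho> \<Longrightarrow> D u 0 < 0"
      using last_zero[of x \<rho> "\<lambda>x. D x 0"] continuous_D_fst r(2) \<open>x < \<rho>\<close> by (metis less_imp_le)
    have "B c = B \<rho>"
    proof (rule B_const)
      fix u assume "c \<le> u" "u \<le> \<rho>"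
      thus "D u 0 \<le> 0" using c(3) c(4)[of u] by (cases "u = c") auto
    qed (use c in simp)
    thus ?thesis using c r by (auto simp: RZ_def)
  qed
  note fin = finite_RZ_sum(1)[OF f]
  have card_le: "card X \<le> mult_RZ k" if "X \<subseteq> RZ k" for X
  proof -
    have "card X \<le> (\<Sum>\<rho>\<in>RZ k. 1)" using card_mono[OF fin that] by simp
    also have "\<dots> \<le> mult_RZ k" by (intro sum_mono) auto
    finally show ?thesis .
  qed
  show ?thesis
    unfolding flat_sum[OF f]
  proof (cases "p = 1 \<and> k = 0")
    case True
    then obtain \<rho>0 where "\<And>\<rho>. \<rho> \<le> \<rho>0 \<Longrightarrow> B \<rho> = 0 \<and> D \<rho> 0 < 0" using initial_p1 by blast
    hence "B \<rho>0 = of_nat k * pi" "D \<rho>0 0 < 0" using True by auto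
    then obtain \<rho>2 where "\<rho>2 \<in> RZ k" using right by blast
    hence "card {\<rho>2} \<le> mult_RZ k" by (intro card_le) auto
    moreover have "cap k = 1" using True unfolding cap_def by (rule if_P)
    ultimately show "cap k \<le> mult_RZ k" by simp
  next
    case nk: False
    hence cap: "cap k = 2" unfolding cap_def by (rule if_not_P)
    show "cap k \<le> mult_RZ k"
    proof (cases "\<exists>\<rho>. B \<rho> = of_nat k * pi \<and> D \<rho> 0 < 0")
      case True
      then obtain \<rho> where r: "B \<rho> = of_nat k * pi" "D \<rho> 0 < 0" by blast
      obtain x1 where x1: "x1 < \<rho>" "x1 \<in> RZ k" using left[OF r nk] by blast
      obtain x2 where x2: "x2 > \<rho>" "x2 \<in> RZ k" using right[OF r] by blast
      have "card {x1, x2} \<le> mult_RZ k" using x1 x2 by (intro card_le) auto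
      moreover have "card {x1, x2} = 2" using x1 x2 by simp
      ultimately show ?thesis using cap by simp
    next
      case no: False
      have "\<exists>x. B x \<le> of_nat k * pi"
      proof -
        obtain \<rho>0 where "B \<rho>0 \<le> 0"
          using initial_p0 initial_p1 pq_cases by (metis divide_nonpos_pos neg_le_0_iff_le order_refl pi_ge_zero zero_less_numeral)
        thus ?thesis by (intro exI[of _ \<rho>0]) (meson mult_nonneg_nonneg of_nat_0_le_iff order_trans pi_ge_zero)
      qed
      then obtain \<rho> where b: "B \<rho> = of_nat k * pi" using B_IVT kl by (metis less_imp_le)
      have T: "Th \<rho> = 0" using f b by (simp add: flat_def)
      have D0: "D \<rho> 0 = 0" using Th_eq_0D[OF T] no b by force
      have R: "\<rho> \<in> RZ k" using b D0 by (simp add: RZ_def)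
      have reg: "pt \<rho> \<in> Reg" by (rule flat_Reg[OF f b])
      have "isCont B \<rho>" using continuous_B[of UNIV] by (simp add: continuous_on_eq_continuous_at)
      hence "(B \<longlongrightarrow> B \<rho>) (nhds \<rho>)" by (simp add: isCont_def tendsto_nhds_iff)
      \<comment> \<open>Where D < 0, B is a multiple of pi; closer than pi to k pi it can only be k
        pi itself, a level on which D is nowhere negative by assumption. So D \<ge> 0 in a full
        neighbourhood of \<rho>.\<close>
      hence near: "\<forall>\<^sub>F x in nhds \<rho>. dist (B x) (B \<rho>) < pi" by (rule tendstoD) simp
      have Dn: "\<forall>\<^sub>F x in nhds \<rho>. D x 0 \<ge> 0"
        using near
      proof eventually_elim
        case (elim x)
        show ?case
        proof (rule ccontr)
          assume n: "\<not> D x 0 \<ge> 0"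
          then obtain m :: nat where m: "B x = of_nat m * pi" using B_real[OF Th_eq_0I] by force
          have "\<bar>(real m - real k) * pi\<bar> < 1 * pi" using elim unfolding m b by (simp add: dist_real_def algebra_simps)
          hence "\<bar>real m - real k\<bar> < 1" by (simp add: abs_mult)
          hence "m = k" by (cases m k rule: linorder_cases) (auto simp: nat_less_real_le)
          thus False using no m n by auto
        qed
      qed
      have "isCont (\<lambda>x. pt x) \<rho>" by (intro continuous_intros)
      hence "((\<lambda>x. pt x) \<longlongrightarrow> of_real (exp \<rho>)) (nhds \<rho>)"
        by (simp add: isCont_def tendsto_nhds_iff)
      hence Rn: "\<forall>\<^sub>F x in nhds \<rho>. pt x \<in> Reg"
        using open_Reg reg by (rule topological_tendstoD)
      have "\<forall>\<^sub>F x in nhds \<rho>. (Phi \<rho>)\<^sup>2 \<le> (Phi x)\<^sup>2"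
        using Dn Rn
      proof eventually_elim
        case (elim x)
        have "\<bar>Phi x\<bar> \<ge> norm \<alpha>" using D0_Phi[OF elim(2)] elim(1) by (simp add: zero_le_mult_iff)
        thus ?case using Phi_RZ[OF f R] by (simp add: abs_le_square_iff[symmetric])
      qed
      then obtain e where e: "e > 0" "\<And>x. dist x \<rho> < e \<Longrightarrow> (Phi \<rho>)\<^sup>2 \<le> (Phi x)\<^sup>2"
        by (auto simp: eventually_nhds_metric)
      have "2 * (Phi \<rho>)\<^sup>2 * RK \<rho> = 0"
        by (rule DERIV_local_min[OF DERIV_Phi_square[OF reg] e(1)]) (use e(2) in \<open>auto simp: dist_real_def abs_minus_commute\<close>)
      hence "RK \<rho> = 0" using Phi_nz[OF reg] by simp
      hence "2 \<le> (\<Sum>\<rho>\<in>{\<rho>}. if RK \<rho> = 0 then 2 else (1::nat))" by simp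
      also have "\<dots> \<le> mult_RZ k"
        using R fin by (intro sum_mono2) auto
      finally show ?thesis using cap by simp
    qed
  qed
qed

lemma lev_mono: "Q w = 0 \<Longrightarrow> Q w' = 0 \<Longrightarrow> lev w < lev w' \<Longrightarrow> norm w < norm w'"
  by (rule B_less) (auto simp: zero_level)

lemma zorder_pos: "Q w = 0 \<Longrightarrow> zorder Q w > 0"
  using zorder_zero[of w] by (cases "Im w = 0") auto

lemma sum_cap: "(\<Sum>j<k. cap j) = 2 * k - (if p = 1 then 1 else 0)"
  by (induction k) (auto simp: cap_def)

text \<open>The capacities are 2, 2, 2, ... for p = 0 and 1, 2, 2, ... for p = 1; inverting their
  partial sums gives the level of the n-th zero.\<close>

lemma lev_enum:
  assumes en: "enumerates_zeros Q N z" and n: "1 \<le> n" "enat n \<le> N"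
  shows "lev (z n) = (if p = 0 then (n - 1) div 2 else n div 2)"
proof -
  have 1: "(\<Sum>j<lev (z n). cap j) < n"
    by (rule level_count(1)[where F = Q and N = N and cap = cap])
      (fact en zorder_pos lev_mono finite_lz sum_le_cap cap_le_sum n)+
  have "n \<le> (\<Sum>j\<le>lev (z n). cap j)"
    by (rule level_count(2)[where F = Q and N = N and cap = cap])
      (fact en zorder_pos lev_mono finite_lz sum_le_cap cap_le_sum n)+
  hence 2: "n \<le> (\<Sum>j<Suc (lev (z n)). cap j)" by (simp only: lessThan_Suc_atMost)
  show ?thesis using 1 2 n pq_cases unfolding sum_cap by (auto split: if_splits)
qed

lemma same_level_real:
  assumes "Q w = 0" "Q w' = 0" "lev w = lev w'" "norm w < norm w'"
  shows "Im w = 0" "Im w' = 0"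
proof -
  have l: "lr w < lr w'" using assms lr_less_iff by blast
  have "B (lr w) = B (lr w')" using assms zero_level by simp
  hence "(Th (lr w) = 0 \<and> Th (lr w') = 0) \<or> (Th (lr w) = pi/2 \<and> Th (lr w') = pi/2)"
    using B_strict[OF l] by auto
  moreover have "Th (lr w) < pi/2" by (rule Th_level[OF zero_level[OF assms(1)]])
  ultimately show "Im w = 0" "Im w' = 0" using Im_zero_iff assms by auto
qed

lemma first_zero_real:
  assumes p: "p = 1" and en: "enumerates_zeros Q N z" and N: "1 \<le> N"
  shows "Im (z 1) = 0"
proof (rule ccontr)
  assume I: "Im (z 1) \<noteq> 0"
  have N': "enat 1 \<le> N" using N by (simp add: one_enat_def)
  note z = enumerates_zeros_zero[OF en order_refl N']
  have "B (lr (z 1)) = of_nat 0 * pi" using zero_level[OF z] lev_enum[OF en order_refl N'] p by simp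
  moreover have "Th (lr (z 1)) \<noteq> 0" using I Im_zero_iff[OF z] by simp
  ultimately show False using nonreal_level[of "lr (z 1)" 0] p by blast
qed

text \<open>\<open>k n\<close> is the level of z n. The statements compare arbitrary m < n by level,
  so that both groupings, (1, 2), (3, 4), ... and 1, (2, 3), (4, 5), ..., can be read off.\<close>

theorem zeros_real_quotient:
  assumes en: "enumerates_zeros Q N z"
  defines "k \<equiv> \<lambda>n. if p = 0 then (n - 1) div 2 else n div 2"
  shows "\<And>w. Q w = 0 \<Longrightarrow> Re w \<noteq> 0"
    and "\<And>w. Q w = 0 \<Longrightarrow> Im w = 0 \<Longrightarrow> zorder Q w = 1 \<or> zorder Q w = 2"
    and "\<And>w. Q w = 0 \<Longrightarrow> Im w \<noteq> 0 \<Longrightarrow> zorder Q w = 1"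
    and "\<And>n. 1 \<le> n \<Longrightarrow> enat n \<le> N \<Longrightarrow> Re (z n) * Re \<alpha> * (-1) ^ k n > 0"
    and "\<And>m n. 1 \<le> m \<Longrightarrow> m < n \<Longrightarrow> enat n \<le> N \<Longrightarrow> k m < k n \<Longrightarrow> norm (z m) < norm (z n)"
    and "\<And>m n. 1 \<le> m \<Longrightarrow> m < n \<Longrightarrow> enat n \<le> N \<Longrightarrow> k m = k n \<Longrightarrow> norm (z m) = norm (z n) \<Longrightarrow> z m = cnj (z n)"
    and "\<And>m n. 1 \<le> m \<Longrightarrow> m < n \<Longrightarrow> enat n \<le> N \<Longrightarrow> k m = k n \<Longrightarrow> norm (z m) < norm (z n) \<Longrightarrow> Im (z m) = 0 \<and> Im (z n) = 0"
proof -
  show "\<And>w. Q w = 0 \<Longrightarrow> Re w \<noteq> 0" using zero_sign(2) by auto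
  show "\<And>w. Q w = 0 \<Longrightarrow> Im w = 0 \<Longrightarrow> zorder Q w = 1 \<or> zorder Q w = 2" using zorder_zero(2) by auto
  show "\<And>w. Q w = 0 \<Longrightarrow> Im w \<noteq> 0 \<Longrightarrow> zorder Q w = 1" using zorder_zero(1) by auto
  have lev: "lev (z n) = k n" if "1 \<le> n" "enat n \<le> N" for n
    using lev_enum[OF en that] by (simp add: k_def)
  note zero = enumerates_zeros_zero[OF en]
  show "Re (z n) * Re \<alpha> * (-1) ^ k n > 0" if n: "1 \<le> n" "enat n \<le> N" for n
  proof -
    note zs = zero_sign[OF zero[OF n]]
    have "Re (z n) * Re \<alpha> * (-1) ^ k n = \<bar>Re (z n)\<bar> * (sgn (Re \<alpha>) * Re \<alpha>) * ((-1) ^ k n * (-1) ^ k n)"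
      using zs(1) unfolding lev[OF n] sgk_def by (metis (no_types, lifting) mult.assoc mult.commute)
    also have "\<dots> = \<bar>Re (z n)\<bar> * \<bar>Re \<alpha>\<bar>" by (simp add: sgn_if flip: power_mult_distrib)
    also have "\<dots> > 0" using zs(2) Re_alpha(1) by simp
    finally show ?thesis .
  qed
  fix m n :: nat assume m: "1 \<le> m" and mn: "m < n" and nN: "enat n \<le> N"
  have n: "1 \<le> n" using m mn by simp
  have mN: "enat m \<le> N" using mn nN by (meson enat_ord_simps(2) less_imp_le order_trans)
  note zm = zero[OF m mN] and zn = zero[OF n nN] and lm = lev[OF m mN] and ln = lev[OF n nN]
  show "norm (z m) < norm (z n)" if "k m < k n"
    using lev_mono[OF zm zn] lm ln that by simp
  show "z m = cnj (z n)" if k: "k m = k n" and nn: "norm (z m) = norm (z n)"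
  proof (cases "Im (z n) = 0")
    case True
    hence "cnj (z n) = z n" by (simp add: complex_eq_iff)
    thus ?thesis using level_zero_eqI[OF zn zm] lm ln k nn by auto
  next
    case False
    \<comment> \<open>A nonreal zero is simple and listed only once, which leaves the
      conjugate.\<close>
    have "z m \<noteq> z n"
      by (rule enumerates_zeros_distinct[OF en m mn nN zorder_zero(1)[OF zn False]])
    thus ?thesis using level_zero_eqI[OF zn zm] lm ln k nn by auto
  qed
  show "Im (z m) = 0 \<and> Im (z n) = 0" if k: "k m = k n" and nn: "norm (z m) < norm (z n)"
    using same_level_real[OF zm zn _ nn] lm ln k by simp
qed

end

subsection \<open>From the products to the power series\<close>

text \<open>Common shape of the conclusions: \<open>interlaced\<close> covers \<open>Im (\<alpha>\<^sup>2) \<noteq> 0\<close>, while \<open>paired\<close> covers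
  real \<open>\<alpha> = r\<close> (and imaginary \<open>\<alpha>\<close> after a rotation by \<open>\<i>\<close>), the zeros \<open>z n\<close> with the same value \<open>k n\<close> forming a pair.\<close>

definition interlaced :: "(complex \<Rightarrow> complex) \<Rightarrow> enat \<Rightarrow> (nat \<Rightarrow> complex) \<Rightarrow> complex \<Rightarrow> bool" where
  "interlaced F N z \<alpha> \<longleftrightarrow>
     (\<forall>w. F w = 0 \<longrightarrow> zorder F w = 1) \<and>
     (\<forall>n\<ge>1. enat n \<le> N \<longrightarrow> Re (z n) * Re \<alpha> * (-1) ^ ((n - 1) div 2) > 0 \<and> Im (z n) * Im \<alpha> * (-1) ^ (n div 2) < 0) \<and>
     (\<forall>n\<ge>1. enat (Suc n) \<le> N \<longrightarrow> norm (z n) < norm (z (Suc n)))"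

definition paired :: "(complex \<Rightarrow> complex) \<Rightarrow> enat \<Rightarrow> (nat \<Rightarrow> complex) \<Rightarrow> real \<Rightarrow> (nat \<Rightarrow> nat) \<Rightarrow> bool" where
  "paired F N z r k \<longleftrightarrow>
     (\<forall>w. F w = 0 \<longrightarrow> Re w \<noteq> 0) \<and>
     (\<forall>w. F w = 0 \<longrightarrow> Im w = 0 \<longrightarrow> zorder F w = 1 \<or> zorder F w = 2) \<and>
     (\<forall>w. F w = 0 \<longrightarrow> Im w \<noteq> 0 \<longrightarrow> zorder F w = 1) \<and>
     (\<forall>n\<ge>1. enat n \<le> N \<longrightarrow> Re (z n) * r * (-1) ^ k n > 0) \<and>
     (\<forall>m\<ge>1. \<forall>n>m. enat n \<le> N \<longrightarrow> k m < k n \<longrightarrow> norm (z m) < norm (z n)) \<and>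
     (\<forall>m\<ge>1. \<forall>n>m. enat n \<le> N \<longrightarrow> k m = k n \<longrightarrow> norm (z m) = norm (z n) \<longrightarrow> z m = cnj (z n)) \<and>
     (\<forall>m\<ge>1. \<forall>n>m. enat n \<le> N \<longrightarrow> k m = k n \<longrightarrow> norm (z m) < norm (z n) \<longrightarrow> Im (z m) = 0 \<and> Im (z n) = 0)"

lemma enumerates_zeros_cmult:
  assumes "C \<noteq> 0" and eq: "\<And>w. F w = C * G w" and en: "enumerates_zeros F N z"
  shows "enumerates_zeros G N z" "zorder F w = zorder G w" "F w = 0 \<longleftrightarrow> G w = 0"
proof -
  have F: "F = (\<lambda>w. C * G w)" using eq by (simp add: fun_eq_iff)
  show z: "zorder F w = zorder G w" for w unfolding F by (rule zorder_cmult[OF assms(1)])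
  show "F w = 0 \<longleftrightarrow> G w = 0" for w using eq assms(1) by simp
  show "enumerates_zeros G N z"
    using en z eq assms(1) unfolding enumerates_zeros_def by simp
qed

lemma enumerates_zeros_rotate:
  assumes en: "enumerates_zeros F N z" and hol: "F holomorphic_on UNIV"
  shows "zorder (\<lambda>y. F (\<i> * y)) y = zorder F (\<i> * y)"
    and "enumerates_zeros (\<lambda>y. F (\<i> * y)) N (\<lambda>n. - \<i> * z n)"
proof -
  have "F analytic_on {\<i> * y}" for y using hol analytic_on_holomorphic by blast
  hence "F meromorphic_on {\<i> * y}" for y by (rule analytic_on_imp_meromorphic_on)
  thus z: "zorder (\<lambda>y. F (\<i> * y)) y = zorder F (\<i> * y)" for y
    by (rule zorder_scale) simp
  have eq: "- \<i> * u = y \<longleftrightarrow> u = \<i> * y" for u y :: complex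
    by (auto simp: complex_eq_iff)
  show "enumerates_zeros (\<lambda>y. F (\<i> * y)) N (\<lambda>n. - \<i> * z n)"
    unfolding enumerates_zeros_def z eq
    using en unfolding enumerates_zeros_def by (simp add: norm_mult mult.assoc[symmetric])
qed

lemma single_zero:
  assumes en: "enumerates_zeros F N z" and F: "\<And>w. F w = 0 \<longleftrightarrow> w = w0" and o: "zorder F w0 = 1"
    and n: "1 \<le> n" "enat n \<le> N"
  shows "n = 1" "z n = w0"
proof -
  have z: "z m = w0" if "1 \<le> m" "enat m \<le> N" for m
    using enumerates_zeros_zero[OF en that] F by simp
  show "z n = w0" by (rule z[OF n])
  show "n = 1"
  proof (rule ccontr)
    assume "n \<noteq> 1"
    hence "1 < n" using n by simp
    have "z 1 \<noteq> z n" by (rule enumerates_zeros_distinct[OF en _ \<open>1 < n\<close> n(2)]) (use z[OF n] o in auto)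
    moreover have "enat 1 \<le> N" using n by (meson enat_ord_simps(1) order_trans)
    ultimately show False using z[OF n] z[of 1] by simp
  qed
qed

text \<open>For the degenerate case in which both products are 1: with one simple zero there are no
  two indices to compare.\<close>

lemma single_zero_paired:
  assumes en: "enumerates_zeros F N z" and F: "\<And>w. F w = 0 \<longleftrightarrow> w = w0" and o: "zorder F w0 = 1"
    and "Im w0 = 0" "Re w0 * r > 0" "k 1 = 0"
  shows "paired F N z r k"
proof -
  note s = single_zero[OF en F o]
  have nz: "Re w0 \<noteq> 0" using assms(5) by auto
  have "\<not> enat n \<le> N" if "1 \<le> m" "m < n" for m n using s(1)[of n] that by auto
  moreover have "Re (z n) * r * (-1) ^ k n > 0" if "1 \<le> n" "enat n \<le> N" for n
    using s(1)[OF that] s(2)[OF that] assms(5,6) by simp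
  ultimately show ?thesis unfolding paired_def using F o nz assms(4) by auto
qed

lemma linear_zero:
  assumes "\<alpha> \<noteq> 0"
  shows "1 - \<alpha> * w = 0 \<longleftrightarrow> w = 1 / \<alpha>" "zorder (\<lambda>w. 1 - \<alpha> * w) (1 / \<alpha>) = 1"
proof -
  show "1 - \<alpha> * w = 0 \<longleftrightarrow> w = 1 / \<alpha>" using assms by (auto simp: field_simps)
  have d: "deriv (\<lambda>w. 1 - \<alpha> * w) z = - \<alpha>" for z
    by (rule DERIV_imp_deriv) (auto intro!: derivative_eq_intros)
  show "zorder (\<lambda>w. 1 - \<alpha> * w) (1 / \<alpha>) = 1"
  proof (rule zorder_zero_eqI'[where n = 1])
    show "(\<lambda>w. 1 - \<alpha> * w) analytic_on {1 / \<alpha>}" by (intro analytic_intros)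
    show "(deriv ^^ nat 1) (\<lambda>w. 1 - \<alpha> * w) (1 / \<alpha>) \<noteq> 0" using d assms by simp
  qed (use assms in auto)
qed

locale entire_pair = S: neg_prod_seq s + T: neg_prod_seq t for s t +
  fixes \<alpha> c0 :: complex and H :: "complex \<Rightarrow> complex" and N :: enat and z :: "nat \<Rightarrow> complex"
  assumes alpha_nz: "\<alpha> \<noteq> 0" and c0_nz: "c0 \<noteq> 0"
    and H: "\<And>w. H w = c0 * (neg_prod s (w\<^sup>2) - \<alpha> * (w * neg_prod t (- w\<^sup>2)))"
    and en: "enumerates_zeros H N z"
begin

lemma trivial:
  assumes "\<not> (\<exists>n. s n \<noteq> 0 \<or> t n \<noteq> 0)"
  shows "H w = c0 * (1 - \<alpha> * w)"
  using assms H by (simp add: S.neg_prod_trivial T.neg_prod_trivial)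

lemma trivial_zeros:
  assumes "\<not> (\<exists>n. s n \<noteq> 0 \<or> t n \<noteq> 0)"
  shows "H w = 0 \<longleftrightarrow> w = 1 / \<alpha>" "zorder H (1 / \<alpha>) = 1"
  using enumerates_zeros_cmult(2,3)[OF c0_nz trivial[OF assms] en] linear_zero[OF alpha_nz] by simp_all

lemma Re_Im_inverse: "Re (1 / \<alpha>) = Re \<alpha> / (norm \<alpha>)\<^sup>2" "Im (1 / \<alpha>) = - Im \<alpha> / (norm \<alpha>)\<^sup>2"
  by (simp_all add: Re_divide Im_divide cmod_power2)

lemma interlaced_H:
  assumes "Re \<alpha> \<noteq> 0" "Im \<alpha> \<noteq> 0"
  shows "interlaced H N z \<alpha>"
proof (cases "\<exists>n. s n \<noteq> 0 \<or> t n \<noteq> 0")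
  case True
  interpret P: prod_pair s t 0 1 \<alpha> by unfold_locales (use True alpha_nz in auto)
  have HQ: "H w = c0 * P.Q w" for w unfolding H P.Q_def P.U_def P.V_def by simp
  note e = enumerates_zeros_cmult[OF c0_nz HQ en]
  show ?thesis
    unfolding interlaced_def e(2,3) using P.zeros_nonreal_square[OF refl assms e(1)] by blast
next
  case False
  note t = trivial_zeros[OF False]
  note s = single_zero[OF en t]
  have "norm \<alpha> > 0" using alpha_nz by simp
  hence "Re (1 / \<alpha>) * Re \<alpha> > 0" "Im (1 / \<alpha>) * Im \<alpha> < 0"
    unfolding Re_Im_inverse using assms by (simp_all add: zero_less_divide_iff divide_less_0_iff zero_less_mult_iff not_le, linarith+)
  hence "Re (z n) * Re \<alpha> * (-1) ^ ((n - 1) div 2) > 0 \<and> Im (z n) * Im \<alpha> * (-1) ^ (n div 2) < 0"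
    if "1 \<le> n" "enat n \<le> N" for n
    using s[OF that] by simp
  moreover have "\<not> enat (Suc n) \<le> N" if "1 \<le> n" for n using s(1)[of "Suc n"] that by auto
  ultimately show ?thesis unfolding interlaced_def using t by auto
qed

lemma paired_H:
  assumes "Im \<alpha> = 0"
  shows "paired H N z (Re \<alpha>) (\<lambda>n. (n - 1) div 2)"
proof (cases "\<exists>n. s n \<noteq> 0 \<or> t n \<noteq> 0")
  case True
  interpret P: real_prod_pair s t 0 1 \<alpha> by unfold_locales (use True alpha_nz assms in auto)
  have HQ: "H w = c0 * P.Q w" for w unfolding H P.Q_def P.U_def P.V_def by simp
  note e = enumerates_zeros_cmult[OF c0_nz HQ en]
  show ?thesis
    unfolding paired_def e(2,3) using P.zeros_real_quotient[OF e(1)] by simp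
next
  case False
  have "Re \<alpha> \<noteq> 0" using alpha_nz assms by (auto simp: complex_eq_iff)
  show ?thesis
    by (rule single_zero_paired[OF en trivial_zeros[OF False]])
      (use assms alpha_nz \<open>Re \<alpha> \<noteq> 0\<close> in \<open>auto simp: Re_Im_inverse zero_less_divide_iff zero_less_mult_iff\<close>)
qed

lemma holomorphic_H: "H holomorphic_on UNIV"
proof -
  have 1: "(\<lambda>z. z\<^sup>2) holomorphic_on UNIV" "(\<lambda>z. - z\<^sup>2) holomorphic_on UNIV" by (intro holomorphic_intros)+
  have 2: "(\<lambda>z. neg_prod s (z\<^sup>2)) holomorphic_on UNIV" "(\<lambda>z. neg_prod t (- z\<^sup>2)) holomorphic_on UNIV"
    using holomorphic_on_compose_gen[OF 1(1) S.holomorphic_neg_prod[of UNIV]]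
      holomorphic_on_compose_gen[OF 1(2) T.holomorphic_neg_prod[of UNIV]] by (simp_all add: o_def)
  have "(\<lambda>w. c0 * (neg_prod s (w\<^sup>2) - \<alpha> * (w * neg_prod t (- w\<^sup>2)))) holomorphic_on UNIV"
    by (intro holomorphic_intros 2)
  thus ?thesis by (simp add: H[symmetric])
qed

text \<open>The substitution \<open>w = \<i> y\<close> exchanges the two products and replaces \<open>\<alpha>\<close> by \<open>1 / (\<i> \<alpha>)\<close>.\<close>

lemma paired_H_imag:
  assumes "Re \<alpha> = 0"
  shows "paired (\<lambda>y. H (\<i> * y)) N (\<lambda>n. - \<i> * z n) (- Im \<alpha>) (\<lambda>n. n div 2)"
    and "1 \<le> N \<Longrightarrow> Im (- \<i> * z 1) = 0"
proof -
  define \<beta> where "\<beta> = 1 / (\<i> * \<alpha>)"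
  have Ia: "Im \<alpha> \<noteq> 0" using alpha_nz assms by (auto simp: complex_eq_iff)
  have a: "\<alpha> = \<i> * of_real (Im \<alpha>)" using assms by (simp add: complex_eq_iff)
  have beta: "\<beta> = of_real (- 1 / Im \<alpha>)"
    unfolding \<beta>_def by (subst a) (use Ia in \<open>simp add: field_simps flip: mult.assoc\<close>)
  have bnz: "\<beta> \<noteq> 0" using alpha_nz by (simp add: \<beta>_def)
  note r = enumerates_zeros_rotate[OF en holomorphic_H]
  \<comment> \<open>The coefficient of y times the second product in H (\<i> * y); after division by
    it the first product has the coefficient - \<beta>.\<close>
  define C where "C = - c0 * \<alpha> * \<i>"
  have C: "C \<noteq> 0" using c0_nz alpha_nz by (simp add: C_def)
  have "paired (\<lambda>y. H (\<i> * y)) N (\<lambda>n. - \<i> * z n) (- Im \<alpha>) (\<lambda>n. n div 2) \<and> (1 \<le> N \<longrightarrow> Im (- \<i> * z 1) = 0)"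
  proof (cases "\<exists>n. s n \<noteq> 0 \<or> t n \<noteq> 0")
    case True
    interpret P: real_prod_pair t s 1 0 \<beta>
      by unfold_locales (use True bnz beta in auto)
    have HQ: "H (\<i> * y) = C * P.Q y" for y
    proof -
      have sq: "(\<i> * y)\<^sup>2 = - (y\<^sup>2)" by (simp add: power_mult_distrib)
      have "C * P.Q y = C * (y * neg_prod t (y\<^sup>2)) - (C * \<beta>) * neg_prod s (- y\<^sup>2)"
        unfolding P.Q_def P.U_def P.V_def by (simp add: algebra_simps)
      also have "C * \<beta> = - c0" using alpha_nz by (simp add: C_def \<beta>_def)
      finally show ?thesis unfolding H sq by (simp add: C_def algebra_simps)
    qed
    note e = enumerates_zeros_cmult[OF C HQ r(2)]
    \<comment> \<open>\<beta> = -1 / Im \<alpha> has the same sign as - Im \<alpha>, so either may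
      express the sign pattern.\<close>
    have sg: "x * - Im \<alpha> * y > 0 \<longleftrightarrow> x * Re \<beta> * y > 0" for x y
      unfolding beta using Ia by (auto simp: zero_less_mult_iff divide_less_0_iff zero_less_divide_iff mult_less_0_iff)
    show ?thesis
      unfolding paired_def e(2,3) sg
      using P.zeros_real_quotient[OF e(1)] P.first_zero_real[OF refl e(1)] by simp
  next
    case False
    note t = trivial_zeros[OF False]
    have w0: "H (\<i> * y) = 0 \<longleftrightarrow> y = \<beta>" for y
      unfolding t(1) \<beta>_def using alpha_nz by (auto simp: field_simps)
    have "\<i> * \<beta> = 1 / \<alpha>" using alpha_nz by (simp add: \<beta>_def)
    hence o: "zorder (\<lambda>y. H (\<i> * y)) \<beta> = 1" unfolding r(1) using t(2) by simp
    have "paired (\<lambda>y. H (\<i> * y)) N (\<lambda>n. - \<i> * z n) (- Im \<alpha>) (\<lambda>n. n div 2)"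
      by (rule single_zero_paired[OF r(2) w0 o]) (use Ia in \<open>auto simp: beta\<close>)
    moreover have "Im (- \<i> * z 1) = 0" if "1 \<le> N"
      using single_zero(2)[OF r(2) w0 o, of 1] that beta by (simp add: one_enat_def)
    ultimately show ?thesis by blast
  qed
  thus "paired (\<lambda>y. H (\<i> * y)) N (\<lambda>n. - \<i> * z n) (- Im \<alpha>) (\<lambda>n. n div 2)"
    and "1 \<le> N \<Longrightarrow> Im (- \<i> * z 1) = 0" by auto
qed

end

section \<open>Quadrants, power series and genus zero\<close>

lemma i_powi_cases: "\<i> powi l \<in> {1, \<i>, -1, -\<i>}"
proof (induction l rule: int_induct[where k = 0])
  case (step1 i)
  thus ?case by (auto simp: power_int_add)
next
  case (step2 i)
  thus ?case by (auto simp: power_int_diff)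
qed simp

lemma quadrant_iff: "w \<in> quadrant l \<longleftrightarrow> 0 < Re (w * \<i> powi (- l)) \<and> 0 < Im (w * \<i> powi (- l))"
proof -
  define u where "u = w * \<i> powi (- l)"
  have "w \<noteq> 0 \<longleftrightarrow> u \<noteq> 0" by (simp add: u_def)
  hence "w \<in> quadrant l \<longleftrightarrow> u \<noteq> 0 \<and> 0 < Arg u \<and> Arg u < pi/2" by (simp add: quadrant_def u_def)
  also have "\<dots> \<longleftrightarrow> 0 < Re u \<and> 0 < Im u"
    using Arg_lt_pi[of u] Arg_Re_pos[of u] pi_gt_zero by (cases "u = 0") (auto simp: abs_less_iff)
  finally show ?thesis by (simp add: u_def)
qed

text \<open>The sign conditions say that the coordinates of w' have the signs of those of d \<i> w,
  so w' is a quarter turn away from w, in the direction given by d.\<close>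

lemma quadrant_step:
  assumes w: "w \<in> quadrant l" and d: "d \<in> {1, -1 :: real}"
    and s: "d * (Re w' * Im w) < 0" "d * (Im w' * Re w) > 0"
  shows "w' \<in> quadrant (l + \<lfloor>d\<rfloor>)"
proof -
  have "\<i> powi (- (l + \<lfloor>d\<rfloor>)) = \<i> powi (- l) * (if d = 1 then - \<i> else \<i>)"
  proof -
    have "\<lfloor>d\<rfloor> = (if d = 1 then 1 else -1)" using d by (auto simp: floor_eq_iff)
    thus ?thesis using d by (auto simp: power_int_diff power_int_add power_int_minus)
  qed
  moreover have "\<i> powi (- l) \<in> {1, \<i>, -1, -\<i>}" by (rule i_powi_cases)
  ultimately show ?thesis
    using w d s unfolding quadrant_iff by (auto simp: zero_less_mult_iff mult_less_0_iff)
qed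

text \<open>Modulo 4 the exponents k (k - 1) / 2 at k = 2 n and k = 2 n + 1 are n and 3 n.\<close>

lemma nat_prod_arith:
  fixes n :: nat
  shows
  "2 * n * (2 * n - 1) div 2 = n + 4 * (n * (n - 1) div 2)"
  "(2 * n + 1) * (2 * n + 1 - 1) div 2 = 3 * n + 4 * (n * (n - 1) div 2)"
proof -
  have "even (n * (n - 1))" by auto
  then obtain q where q: "n * (n - 1) = 2 * q" by blast
  have n2: "n * n = n + 2 * q"
    using q by (cases n) (auto simp: algebra_simps)
  have "2 * n * (2 * n - 1) = 2 * (n + 4 * q)" using n2 by (simp add: diff_mult_distrib2)
  thus "2 * n * (2 * n - 1) div 2 = n + 4 * (n * (n - 1) div 2)" unfolding q by simp
  have "(2 * n + 1) * (2 * n + 1 - 1) = 2 * (3 * n + 4 * q)" using n2 by simp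
  thus "(2 * n + 1) * (2 * n + 1 - 1) div 2 = 3 * n + 4 * (n * (n - 1) div 2)" unfolding q by simp
qed

lemma sums_even_odd:
  fixes t :: "nat \<Rightarrow> complex"
  assumes "(\<lambda>n. t (2 * n)) sums a" "(\<lambda>n. t (2 * n + 1)) sums b"
  shows "t sums (a + b)"
proof -
  have eq: "(if even n then f (2 * (n div 2)) else f (2 * ((n - 1) div 2) + 1)) = f n" for f :: "nat \<Rightarrow> real" and n
    by (auto elim!: evenE oddE)
  have "(\<lambda>n. Re (t n)) sums (Re a + Re b)"
    using sums_if[OF sums_Re[OF assms(2)] sums_Re[OF assms(1)]]
    unfolding eq[where f = "\<lambda>n. Re (t n)"] by (simp only: add.commute)
  moreover have "(\<lambda>n. Im (t n)) sums (Im a + Im b)"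
    using sums_if[OF sums_Im[OF assms(2)] sums_Im[OF assms(1)]]
    unfolding eq[where f = "\<lambda>n. Im (t n)"] by (simp only: add.commute)
  ultimately show ?thesis by (simp add: sums_complex_iff)
qed

text \<open>For j = \<i> or j = -\<i> the even terms carry (j \<nu>^2)^n = 1 and the odd ones \<nu>
  (j^3 \<nu>^2)^n = \<nu> (-1)^n. This is where the argument - w^2 of g comes from, and why h is
  rotated by an eighth of a turn.\<close>

lemma twisted_series:
  fixes j \<nu> :: complex
  assumes f: "\<And>w. (\<lambda>n. c (2 * n) * w ^ n) sums f w" and g: "\<And>w. (\<lambda>n. c (2 * n + 1) * w ^ n) sums g w"
    and j: "j\<^sup>2 = -1" and nu: "\<nu>\<^sup>2 = - j"
  shows "(\<lambda>k. j ^ (k * (k - 1) div 2) * c k * (\<nu> * w) ^ k) sums (f (w\<^sup>2) + \<nu> * w * g (- w\<^sup>2))"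
proof (rule sums_even_odd)
  have j4: "j ^ (4 * m) = 1" for m
  proof -
    have "j ^ 4 = (j\<^sup>2)\<^sup>2" by (simp flip: power_mult)
    thus ?thesis by (simp add: power_mult j)
  qed
  have vw: "(\<nu> * w) ^ (2 * n) = (\<nu>\<^sup>2) ^ n * (w\<^sup>2) ^ n" for n
    by (metis power_mult power_mult_distrib)
  have jj: "j * j = -1" using j by (simp add: power2_eq_square)
  have "j ^ (2 * n * (2 * n - 1) div 2) * c (2 * n) * (\<nu> * w) ^ (2 * n) = c (2 * n) * (w\<^sup>2) ^ n" for n
  proof -
    have "j ^ (2 * n * (2 * n - 1) div 2) * (\<nu> * w) ^ (2 * n) = (j * \<nu>\<^sup>2) ^ n * (w\<^sup>2) ^ n"
      unfolding nat_prod_arith power_add j4 vw by (simp only: power_mult_distrib mult_1_right mult.assoc)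
    also have "j * \<nu>\<^sup>2 = 1" by (simp add: nu jj)
    finally show ?thesis by (simp add: mult_ac)
  qed
  thus "(\<lambda>n. j ^ (2 * n * (2 * n - 1) div 2) * c (2 * n) * (\<nu> * w) ^ (2 * n)) sums f (w\<^sup>2)"
    using f[of "w\<^sup>2"] by presburger
  have "j ^ ((2 * n + 1) * (2 * n + 1 - 1) div 2) * c (2 * n + 1) * (\<nu> * w) ^ (2 * n + 1)
      = \<nu> * w * (c (2 * n + 1) * (- w\<^sup>2) ^ n)" for n
  proof -
    have "j ^ ((2 * n + 1) * (2 * n + 1 - 1) div 2) * (\<nu> * w) ^ (2 * n + 1) = \<nu> * w * (j ^ 3 * \<nu>\<^sup>2 * w\<^sup>2) ^ n"
      unfolding nat_prod_arith power_add j4 vw power_mult[of j 3 n]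
      by (simp add: power_mult_distrib mult_ac)
    also have "j ^ 3 * \<nu>\<^sup>2 * w\<^sup>2 = - w\<^sup>2"
      by (simp add: nu power3_eq_cube jj)
    finally show ?thesis by (auto simp: mult_ac)
  qed
  moreover have "(\<lambda>n. \<nu> * w * (c (2 * n + 1) * (- w\<^sup>2) ^ n)) sums (\<nu> * w * g (- w\<^sup>2))"
    by (intro sums_mult g)
  ultimately show "(\<lambda>n. j ^ ((2 * n + 1) * (2 * n + 1 - 1) div 2) * c (2 * n + 1) * (\<nu> * w) ^ (2 * n + 1))
      sums (\<nu> * w * g (- w\<^sup>2))" by presburger
qed

text \<open>All zeros a n are negative, so 1 - w / a n = 1 + w / |a n|. Indices outside I get s n =
  0, that is, the factor 1, which covers finite and empty products. F 0 is nonzero because 0 is not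
  negative.\<close>

lemma genus_zero_neg_prod:
  assumes F: "genus_zero F" and neg: "\<And>w. F w = 0 \<Longrightarrow> Im w = 0 \<and> Re w < 0"
  obtains s where "neg_prod_seq s" "\<And>w. F w = F 0 * neg_prod s w" "F 0 \<noteq> 0"
proof -
  obtain C m and I :: "nat set" and a :: "nat \<Rightarrow> complex" where C: "C \<noteq> 0" and anz: "\<And>n. n \<in> I \<Longrightarrow> a n \<noteq> 0"
    and sm: "(\<lambda>n. 1 / norm (a n)) summable_on I"
    and Feq: "\<And>w. F w = C * w ^ m * (\<Prod>n. if n \<in> I then 1 - w / a n else 1)"
    using F unfolding genus_zero_def by blast
  have F0: "F 0 \<noteq> 0" using neg[of 0] by auto
  have m: "m = 0" using F0 unfolding Feq by (cases m) auto
  have "(\<lambda>n. if n \<in> I then 1 / norm (a n) else 0) summable_on UNIV"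
    using sm by (subst summable_on_cong_neutral[where T = I and g = "\<lambda>n. 1 / norm (a n)"]) auto
  hence sm': "summable (\<lambda>n. if n \<in> I then 1 / norm (a n) else 0)"
    by (rule summable_on_imp_summable)
  have conv: "convergent_prod (\<lambda>n. if n \<in> I then 1 - w / a n else 1)" for w
  proof (rule abs_convergent_prod_imp_convergent_prod)
    have "summable (\<lambda>n. norm w * (if n \<in> I then 1 / norm (a n) else 0))" by (intro summable_mult sm')
    also have "(\<lambda>n. norm w * (if n \<in> I then 1 / norm (a n) else 0)) = (\<lambda>n. norm ((if n \<in> I then 1 - w / a n else 1) - 1))"
      by (auto simp: fun_eq_iff norm_divide)
    finally show "abs_convergent_prod (\<lambda>n. if n \<in> I then 1 - w / a n else 1)"
      by (simp add: abs_convergent_prod_conv_summable)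
  qed
  have aneg: "Im (a n) = 0 \<and> Re (a n) < 0" if n: "n \<in> I" for n
  proof (rule neg)
    have "0 \<in> range (\<lambda>k. if k \<in> I then 1 - a n / a k else 1)"
      using n anz by (intro range_eqI[where x = n]) simp
    hence "(\<Prod>k. if k \<in> I then 1 - a n / a k else 1) = 0"
      using has_prod_eq_0_iff[OF convergent_prod_has_prod[OF conv[of "a n"]]] by simp
    thus "F (a n) = 0" by (simp add: Feq)
  qed
  define s where "s n = (if n \<in> I then 1 / norm (a n) else 0)" for n
  have "neg_prod_seq s" by unfold_locales (use sm' in \<open>auto simp: s_def[abs_def]\<close>)
  moreover have "F w = F 0 * neg_prod s w" for w
  proof -
    have "(if n \<in> I then 1 - w / a n else 1) = 1 + of_real (s n) * w" for n w
    proof (cases "n \<in> I")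
      case True
      have "a n = - of_real (norm (a n))" using aneg[OF True] by (simp add: complex_eq_iff cmod_eq_Re)
      hence "- w / a n = w / of_real (norm (a n))" by (metis minus_divide_divide minus_minus)
      thus ?thesis using True by (simp add: s_def)
    qed (simp add: s_def)
    hence "F w = C * neg_prod s w" for w unfolding Feq m neg_prod_def by simp
    from this[of w] this[of 0] show ?thesis by (simp add: neg_prod_def)
  qed
  ultimately show thesis using F0 that by blast
qed

section \<open>From sign patterns to the stated conclusions\<close>

lemma enat_le_trans: "m \<le> n \<Longrightarrow> enat n \<le> N \<Longrightarrow> enat m \<le> N"
  by (meson enat_ord_simps(1) order_trans)

lemma enumerates_zeros_norm_mono:
  "enumerates_zeros F N z \<Longrightarrow> 2 \<le> n \<Longrightarrow> enat n \<le> N \<Longrightarrow> norm (z (n - 1)) \<le> norm (z n)"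
  by (simp add: enumerates_zeros_def)

lemma minus_one_power_cases: "(-1::real) ^ n = 1 \<or> (-1::real) ^ n = -1"
  by (simp add: minus_one_power_iff)

lemma interlaced_quadrants:
  assumes i: "interlaced H N z \<alpha>" and a: "Im (\<alpha>\<^sup>2) \<noteq> 0"
  shows "(\<forall>w. H w = 0 \<longrightarrow> zorder H w = 1) \<and>
        (1 \<le> N \<longrightarrow> 0 < norm (z 1)) \<and>
        (\<forall>n\<ge>1. enat (n + 1) \<le> N \<longrightarrow> norm (z n) < norm (z (n + 1))) \<and>
        (\<forall>n\<ge>1. enat n \<le> N \<longrightarrow> Im ((z n)\<^sup>2) \<noteq> 0) \<and>
        (\<forall>n\<ge>1. \<forall>l. enat (n + 1) \<le> N \<longrightarrow> z n \<in> quadrant l \<longrightarrow>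
            z (n + 1) \<in> quadrant (l + \<lfloor>sgn (Im (\<alpha>\<^sup>2))\<rfloor>)) \<and>
        (1 \<le> N \<longrightarrow> Im \<alpha> * Im (z 1) < 0 \<and> Im (\<alpha>\<^sup>2) * Re (z 1) * Im (z 1) < 0)"
proof -
  have sgn: "Re (z n) * Re \<alpha> * (-1) ^ ((n - 1) div 2) > 0" "Im (z n) * Im \<alpha> * (-1) ^ (n div 2) < 0"
    if "1 \<le> n" "enat n \<le> N" for n
    using i that unfolding interlaced_def by blast+
  have a2: "Im (\<alpha>\<^sup>2) = 2 * (Re \<alpha> * Im \<alpha>)" by (simp add: power2_eq_square)
  have nz: "Im ((z n)\<^sup>2) \<noteq> 0" if "1 \<le> n" "enat n \<le> N" for n
    using sgn[OF that] by (auto simp: power2_eq_square)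
  have first: "Re (z 1) * Re \<alpha> > 0" "Im (z 1) * Im \<alpha> < 0" if "1 \<le> N"
    using sgn[of 1] that by (simp_all add: one_enat_def)
  have "Im (\<alpha>\<^sup>2) * Re (z 1) * Im (z 1) < 0" if "1 \<le> N"
  proof -
    have "(Re (z 1) * Re \<alpha>) * (Im (z 1) * Im \<alpha>) < 0" using first[OF that] by (rule mult_pos_neg)
    moreover have "Im (\<alpha>\<^sup>2) * Re (z 1) * Im (z 1) = 2 * ((Re (z 1) * Re \<alpha>) * (Im (z 1) * Im \<alpha>))"
      unfolding a2 by (simp only: mult_ac)
    ultimately show ?thesis by linarith
  qed
  moreover have "z (n + 1) \<in> quadrant (l + \<lfloor>sgn (Im (\<alpha>\<^sup>2))\<rfloor>)"
    if n: "1 \<le> n" "enat (n + 1) \<le> N" and q: "z n \<in> quadrant l" for n l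
  proof (rule quadrant_step[OF q])
    show "sgn (Im (\<alpha>\<^sup>2)) \<in> {1, -1}" using a by (auto simp: sgn_if)
    \<comment> \<open>A and B are the sign factors of Re (z n) and Im (z n). At n + 1 they become B
      and -A, which is the quarter turn.\<close>
    define A B :: real where "A = (-1) ^ ((n - 1) div 2)" and "B = (-1) ^ (n div 2)"
    have AB: "A * A = 1" "B * B = 1"
      using minus_one_power_cases[of "(n - 1) div 2"] minus_one_power_cases[of "n div 2"] by (auto simp: A_def B_def)
    have "(n + 1) div 2 = Suc ((n - 1) div 2)" using n by presburger
    hence "(-1::real) ^ ((n + 1) div 2) = - A" by (simp add: A_def)
    moreover have "(-1::real) ^ ((n + 1 - 1) div 2) = B" by (simp add: B_def)
    ultimately have 2: "Re (z (n + 1)) * Re \<alpha> * B > 0" "Im (z (n + 1)) * Im \<alpha> * A > 0"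
      using sgn[of "n + 1"] n by auto
    have 1: "Re (z n) * Re \<alpha> * A > 0" "Im (z n) * Im \<alpha> * B < 0"
      using sgn[OF n(1) enat_le_trans[OF _ n(2)]] by (simp_all add: A_def B_def)
    have "Re (z (n + 1)) * Im (z n) * (Re \<alpha> * Im \<alpha>) = (Re (z (n + 1)) * Re \<alpha> * B) * (Im (z n) * Im \<alpha> * B)"
      using AB(2) by (simp add: mult_ac)
    also have "\<dots> < 0" using 2(1) 1(2) by (rule mult_pos_neg)
    finally show "sgn (Im (\<alpha>\<^sup>2)) * (Re (z (n + 1)) * Im (z n)) < 0"
      unfolding a2 by (auto simp: sgn_if mult_less_0_iff zero_less_mult_iff)
    have "Im (z (n + 1)) * Re (z n) * (Re \<alpha> * Im \<alpha>) = (Im (z (n + 1)) * Im \<alpha> * A) * (Re (z n) * Re \<alpha> * A)"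
      using AB(1) by (simp add: mult_ac)
    also have "\<dots> > 0" using 2(2) 1(1) by (rule mult_pos_pos)
    finally show "sgn (Im (\<alpha>\<^sup>2)) * (Im (z (n + 1)) * Re (z n)) > 0"
      unfolding a2 by (auto simp: sgn_if mult_less_0_iff zero_less_mult_iff)
  qed
  moreover have "0 < norm (z 1)" if "1 \<le> N" using first(1)[OF that] by auto
  moreover have "\<forall>w. H w = 0 \<longrightarrow> zorder H w = 1"
    and "\<forall>n\<ge>1. enat (n + 1) \<le> N \<longrightarrow> norm (z n) < norm (z (n + 1))"
    using i by (simp_all add: interlaced_def)
  ultimately show ?thesis using nz first(2) by (simp add: mult.commute)
qed

lemma Arg_eq_of_real_axis:
  assumes "Im u = 0" "Im v = 0" "Re u * Re v > 0"
  shows "Arg u = Arg v \<and> Arg v \<in> {0, pi}"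
proof -
  have "Arg w = (if Re w < 0 then pi else 0)" if "Im w = 0" for w
  proof -
    have "w = of_real (Re w)" using that by (simp add: complex_eq_iff)
    thus ?thesis by (metis Arg_of_real)
  qed
  thus ?thesis using assms by (auto simp: zero_less_mult_iff)
qed

lemma Arg_eq_of_imag_axis:
  assumes "Re u = 0" "Re v = 0" "Im u * Im v > 0"
  shows "Arg u = Arg v \<and> Arg v \<in> {- (pi/2), pi/2}"
proof -
  have "Arg w = (if Im w > 0 then pi/2 else - (pi/2))" if "Re w = 0" "Im w \<noteq> 0" for w
  proof (rule Arg_unique'[of "\<bar>Im w\<bar>"])
    have "- pi < - (pi / 2)" "- (pi / 2) \<le> pi" using pi_gt_zero by linarith+
    thus "(if Im w > 0 then pi/2 else - (pi/2)) \<in> {- pi<..pi}" by auto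
  qed (use that in \<open>auto simp: complex_eq_iff\<close>)
  thus ?thesis using assms by (auto simp: zero_less_mult_iff)
qed

lemma paired_same_sign:
  assumes p: "paired F N z r k" and m: "1 \<le> m" "enat m \<le> N" and n: "1 \<le> n" "enat n \<le> N"
  shows "k m = k n \<Longrightarrow> Re (z m) * Re (z n) > 0" "k n = Suc (k m) \<Longrightarrow> Re (z m) * Re (z n) < 0"
proof -
  have s: "Re (z i) * r * (-1) ^ k i > 0" if "1 \<le> i" "enat i \<le> N" for i
    using p that unfolding paired_def by blast
  show "Re (z m) * Re (z n) > 0" if "k m = k n"
    using s[OF m] s[OF n] that minus_one_power_cases[of "k n"]
    by (auto simp: zero_less_mult_iff mult_less_0_iff)
  show "Re (z m) * Re (z n) < 0" if "k n = Suc (k m)"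
    using s[OF m] s[OF n] that minus_one_power_cases[of "k m"]
    by (auto simp: zero_less_mult_iff mult_less_0_iff)
qed

lemma paired_real:
  assumes p: "paired H N z (Re \<alpha>) (\<lambda>n. (n - 1) div 2)" and en: "enumerates_zeros H N z"
  shows "(1 \<le> N \<longrightarrow> 0 < norm (z 1)) \<and>
        (\<forall>n\<ge>1. enat (2 * n) \<le> N \<longrightarrow> norm (z (2 * n - 1)) \<le> norm (z (2 * n))) \<and>
        (\<forall>n\<ge>1. enat (2 * n + 1) \<le> N \<longrightarrow> norm (z (2 * n)) < norm (z (2 * n + 1))) \<and>
        (\<forall>w. H w = 0 \<longrightarrow> Re w \<noteq> 0) \<and>
        (\<forall>w. H w = 0 \<and> Im w = 0 \<longrightarrow> zorder H w = 1 \<or> zorder H w = 2) \<and>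
        (\<forall>w. H w = 0 \<and> Im w \<noteq> 0 \<longrightarrow> zorder H w = 1) \<and>
        (\<forall>n\<ge>1. enat (2 * n) \<le> N \<longrightarrow>
            (norm (z (2 * n - 1)) = norm (z (2 * n)) \<longrightarrow> z (2 * n - 1) = cnj (z (2 * n))) \<and>
            (norm (z (2 * n - 1)) < norm (z (2 * n)) \<longrightarrow>
               Arg (z (2 * n - 1)) = Arg (z (2 * n)) \<and> Arg (z (2 * n)) \<in> {0, pi})) \<and>
        (\<forall>n\<ge>1. enat (2 * n + 1) \<le> N \<longrightarrow> Re (z (2 * n)) * Re (z (2 * n + 1)) < 0) \<and>
        (1 \<le> N \<longrightarrow> Re \<alpha> * Re (z 1) > 0)"
proof -
  have first: "Re (z 1) * Re \<alpha> > 0" if "1 \<le> N"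
    using p that unfolding paired_def by (auto simp: one_enat_def)
  moreover have "0 < norm (z 1)" if "1 \<le> N" using first[OF that] by auto
  moreover have "norm (z (2 * n - 1)) \<le> norm (z (2 * n))" if "1 \<le> n" "enat (2 * n) \<le> N" for n
    using enumerates_zeros_norm_mono[OF en, of "2 * n"] that by simp
  moreover have "norm (z (2 * n)) < norm (z (2 * n + 1))" "Re (z (2 * n)) * Re (z (2 * n + 1)) < 0"
    if n: "1 \<le> n" "enat (2 * n + 1) \<le> N" for n
  proof -
    have k: "(2 * n + 1 - 1) div 2 = Suc ((2 * n - 1) div 2)" using n by presburger
    show "norm (z (2 * n)) < norm (z (2 * n + 1))"
      using p k n unfolding paired_def by (metis (no_types, lifting) One_nat_def Suc_eq_plus1 lessI one_le_mult_iff one_le_numeral)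
    show "Re (z (2 * n)) * Re (z (2 * n + 1)) < 0"
      by (rule paired_same_sign(2)[OF p]) (use n k enat_le_trans[OF _ n(2)] in auto)
  qed
  moreover have "(norm (z (2 * n - 1)) = norm (z (2 * n)) \<longrightarrow> z (2 * n - 1) = cnj (z (2 * n))) \<and>
            (norm (z (2 * n - 1)) < norm (z (2 * n)) \<longrightarrow>
               Arg (z (2 * n - 1)) = Arg (z (2 * n)) \<and> Arg (z (2 * n)) \<in> {0, pi})"
    if n: "1 \<le> n" "enat (2 * n) \<le> N" for n
  proof -
    have k: "(2 * n - 1 - 1) div 2 = (2 * n - 1) div 2" using n by presburger
    have m: "1 \<le> 2 * n - 1" "2 * n - 1 < 2 * n" "1 \<le> 2 * n" using n by auto
    have mN: "enat (2 * n - 1) \<le> N" by (rule enat_le_trans[OF _ n(2)]) simp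
    have "Re (z (2 * n - 1)) * Re (z (2 * n)) > 0"
      by (rule paired_same_sign(1)[OF p m(1) mN m(3) n(2)]) (rule k)
    moreover have "norm (z (2 * n - 1)) = norm (z (2 * n)) \<longrightarrow> z (2 * n - 1) = cnj (z (2 * n))"
      "norm (z (2 * n - 1)) < norm (z (2 * n)) \<longrightarrow> Im (z (2 * n - 1)) = 0 \<and> Im (z (2 * n)) = 0"
      using p m n(2) k unfolding paired_def by blast+
    ultimately show ?thesis using Arg_eq_of_real_axis by blast
  qed
  moreover have "\<forall>w. H w = 0 \<longrightarrow> Re w \<noteq> 0"
    "\<forall>w. H w = 0 \<and> Im w = 0 \<longrightarrow> zorder H w = 1 \<or> zorder H w = 2"
    "\<forall>w. H w = 0 \<and> Im w \<noteq> 0 \<longrightarrow> zorder H w = 1"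
    using p by (simp_all add: paired_def)
  ultimately show ?thesis by (simp add: mult.commute)
qed

text \<open>In y = -\<i> z the real axis of y is the imaginary axis of z, and conjugation of y is
  the reflection of z to - cnj z.\<close>

lemma paired_imag:
  assumes p: "paired (\<lambda>y. H (\<i> * y)) N (\<lambda>n. - \<i> * z n) (- Im \<alpha>) (\<lambda>n. n div 2)"
    and en: "enumerates_zeros H N z" and hol: "H holomorphic_on UNIV" and first: "1 \<le> N \<Longrightarrow> Im (- \<i> * z 1) = 0"
  shows "(1 \<le> N \<longrightarrow> 0 < norm (z 1)) \<and>
        (\<forall>n\<ge>1. enat (2 * n) \<le> N \<longrightarrow> norm (z (2 * n - 1)) < norm (z (2 * n))) \<and>
        (\<forall>n\<ge>1. enat (2 * n + 1) \<le> N \<longrightarrow> norm (z (2 * n)) \<le> norm (z (2 * n + 1))) \<and>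
        (\<forall>w. H w = 0 \<longrightarrow> Im w \<noteq> 0) \<and>
        (\<forall>w. H w = 0 \<and> Re w = 0 \<longrightarrow> zorder H w = 1 \<or> zorder H w = 2) \<and>
        (\<forall>w. H w = 0 \<and> Re w \<noteq> 0 \<longrightarrow> zorder H w = 1) \<and>
        (\<forall>n\<ge>1. enat (2 * n + 1) \<le> N \<longrightarrow>
            (norm (z (2 * n)) = norm (z (2 * n + 1)) \<longrightarrow> z (2 * n) = - cnj (z (2 * n + 1))) \<and>
            (norm (z (2 * n)) < norm (z (2 * n + 1)) \<longrightarrow>
               Arg (z (2 * n)) = Arg (z (2 * n + 1)) \<and> Arg (z (2 * n + 1)) \<in> {- (pi / 2), pi / 2})) \<and>
        (\<forall>n\<ge>1. enat (2 * n) \<le> N \<longrightarrow> Im (z (2 * n - 1)) * Im (z (2 * n)) < 0) \<and>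
        (1 \<le> N \<longrightarrow> Im \<alpha> * Im (z 1) < 0 \<and> Re (z 1) = 0)"
proof -
  define y where "y n = - \<i> * z n" for n
  have y: "Re (y n) = Im (z n)" "Im (y n) = - Re (z n)" "norm (y n) = norm (z n)" for n
    by (simp_all add: y_def norm_mult)
  have p: "paired (\<lambda>y. H (\<i> * y)) N y (- Im \<alpha>) (\<lambda>n. n div 2)"
    using p by (simp add: y_def[abs_def])
  have rot: "\<i> * (- \<i> * w) = w" for w by (simp add: mult.assoc[symmetric])
  have zo: "zorder (\<lambda>y. H (\<i> * y)) (- \<i> * w) = zorder H w" for w
    using enumerates_zeros_rotate(1)[OF en hol, of "- \<i> * w"] unfolding rot .
  have "Im w \<noteq> 0" if "H w = 0" for w
    using p that rot[of w] unfolding paired_def by (metis Re_i_times complex.sel(1) minus_mult_left neg_equal_0_iff_equal uminus_complex.sel(1) neg_0_equal_iff_equal)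
  moreover have "zorder H w = 1 \<or> zorder H w = 2" if "H w = 0" "Re w = 0" for w
  proof -
    have "H (\<i> * (- \<i> * w)) = 0" "Im (- \<i> * w) = 0" using that rot[of w] by simp_all
    thus ?thesis using p zo[of w] unfolding paired_def by metis
  qed
  moreover have "zorder H w = 1" if "H w = 0" "Re w \<noteq> 0" for w
  proof -
    have "H (\<i> * (- \<i> * w)) = 0" "Im (- \<i> * w) \<noteq> 0" using that rot[of w] by simp_all
    thus ?thesis using p zo[of w] unfolding paired_def by metis
  qed
  moreover have first': "Im (z 1) * - Im \<alpha> > 0" if "1 \<le> N"
    using p that unfolding paired_def y by (auto simp: one_enat_def)
  moreover have "0 < norm (z 1)" if "1 \<le> N" using first'[OF that] by auto
  moreover have "Re (z 1) = 0" if "1 \<le> N" using first[OF that] by simp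
  moreover have "norm (z (2 * n)) \<le> norm (z (2 * n + 1))" if "1 \<le> n" "enat (2 * n + 1) \<le> N" for n
    using enumerates_zeros_norm_mono[OF en, of "2 * n + 1"] that by simp
  moreover have "norm (z (2 * n - 1)) < norm (z (2 * n))" "Im (z (2 * n - 1)) * Im (z (2 * n)) < 0"
    if n: "1 \<le> n" "enat (2 * n) \<le> N" for n
  proof -
    have k: "2 * n div 2 = Suc ((2 * n - 1) div 2)" using n by presburger
    have m: "1 \<le> 2 * n - 1" "2 * n - 1 < 2 * n" "1 \<le> 2 * n" using n by auto
    have mN: "enat (2 * n - 1) \<le> N" by (rule enat_le_trans[OF _ n(2)]) simp
    have "(2 * n - 1) div 2 < 2 * n div 2" using k by linarith
    thus "norm (z (2 * n - 1)) < norm (z (2 * n))"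
      using p m n(2) unfolding paired_def y by blast
    show "Im (z (2 * n - 1)) * Im (z (2 * n)) < 0"
      using paired_same_sign(2)[OF p m(1) mN m(3) n(2) k] unfolding y .
  qed
  moreover have "(norm (z (2 * n)) = norm (z (2 * n + 1)) \<longrightarrow> z (2 * n) = - cnj (z (2 * n + 1))) \<and>
            (norm (z (2 * n)) < norm (z (2 * n + 1)) \<longrightarrow>
               Arg (z (2 * n)) = Arg (z (2 * n + 1)) \<and> Arg (z (2 * n + 1)) \<in> {- (pi / 2), pi / 2})"
    if n: "1 \<le> n" "enat (2 * n + 1) \<le> N" for n
  proof -
    have k: "2 * n div 2 = (2 * n + 1) div 2" by presburger
    have m: "1 \<le> 2 * n" "2 * n < 2 * n + 1" "1 \<le> 2 * n + 1" using n by auto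
    have mN: "enat (2 * n) \<le> N" by (rule enat_le_trans[OF _ n(2)]) simp
    have "Im (z (2 * n)) * Im (z (2 * n + 1)) > 0"
      using paired_same_sign(1)[OF p m(1) mN m(3) n(2) k] unfolding y .
    moreover have "norm (y (2 * n)) = norm (y (2 * n + 1)) \<longrightarrow> y (2 * n) = cnj (y (2 * n + 1))"
      "norm (y (2 * n)) < norm (y (2 * n + 1)) \<longrightarrow> Im (y (2 * n)) = 0 \<and> Im (y (2 * n + 1)) = 0"
      using p m n(2) k unfolding paired_def by blast+
    moreover have "z a = - cnj (z b)" if "y a = cnj (y b)" for a b
      using that by (simp add: y_def complex_eq_iff)
    ultimately show ?thesis unfolding y neg_equal_0_iff_equal using Arg_eq_of_imag_axis by blast
  qed
  ultimately show ?thesis by (simp add: mult.commute)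
qed

theorem corollary32:
  fixes c :: "nat \<Rightarrow> complex" and f g H :: "complex \<Rightarrow> complex"
    and \<mu> \<alpha> :: complex and N :: enat and z :: "nat \<Rightarrow> complex"
  assumes f_series: "\<And>w. (\<lambda>n. c (2 * n) * w ^ n) sums f w"
    and g_series: "\<And>w. (\<lambda>n. c (2 * n + 1) * w ^ n) sums g w"
    and f_genus: "genus_zero f" and f_neg: "\<And>w. f w = 0 \<Longrightarrow> Im w = 0 \<and> Re w < 0"
    and g_genus: "genus_zero g" and g_neg: "\<And>w. g w = 0 \<Longrightarrow> Im w = 0 \<and> Re w < 0"
    and mu: "\<mu> = exp (\<i> * complex_of_real pi / 4)"
    and H_alpha: "(H = (\<lambda>w. h_series c (cnj \<mu> * w)) \<and> \<alpha> = - cnj \<mu> * c 1 / c 0) \<or>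
                  (H = (\<lambda>w. hbar_series c (\<mu> * w)) \<and> \<alpha> = - \<mu> * c 1 / c 0)"
    and zeros: "enumerates_zeros H N z"
  shows
    "(Im (\<alpha>\<^sup>2) \<noteq> 0 \<longrightarrow>
        (\<forall>w. H w = 0 \<longrightarrow> zorder H w = 1) \<and>
        (1 \<le> N \<longrightarrow> 0 < norm (z 1)) \<and>
        (\<forall>n\<ge>1. enat (n + 1) \<le> N \<longrightarrow> norm (z n) < norm (z (n + 1))) \<and>
        (\<forall>n\<ge>1. enat n \<le> N \<longrightarrow> Im ((z n)\<^sup>2) \<noteq> 0) \<and>
        (\<forall>n\<ge>1. \<forall>l. enat (n + 1) \<le> N \<longrightarrow> z n \<in> quadrant l \<longrightarrow>
            z (n + 1) \<in> quadrant (l + \<lfloor>sgn (Im (\<alpha>\<^sup>2))\<rfloor>)) \<and>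
        (1 \<le> N \<longrightarrow> Im \<alpha> * Im (z 1) < 0 \<and> Im (\<alpha>\<^sup>2) * Re (z 1) * Im (z 1) < 0))
     \<and>
     (Im \<alpha> = 0 \<longrightarrow>
        (1 \<le> N \<longrightarrow> 0 < norm (z 1)) \<and>
        (\<forall>n\<ge>1. enat (2 * n) \<le> N \<longrightarrow> norm (z (2 * n - 1)) \<le> norm (z (2 * n))) \<and>
        (\<forall>n\<ge>1. enat (2 * n + 1) \<le> N \<longrightarrow> norm (z (2 * n)) < norm (z (2 * n + 1))) \<and>
        (\<forall>w. H w = 0 \<longrightarrow> Re w \<noteq> 0) \<and>
        (\<forall>w. H w = 0 \<and> Im w = 0 \<longrightarrow> zorder H w = 1 \<or> zorder H w = 2) \<and>
        (\<forall>w. H w = 0 \<and> Im w \<noteq> 0 \<longrightarrow> zorder H w = 1) \<and>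
        (\<forall>n\<ge>1. enat (2 * n) \<le> N \<longrightarrow>
            (norm (z (2 * n - 1)) = norm (z (2 * n)) \<longrightarrow> z (2 * n - 1) = cnj (z (2 * n))) \<and>
            (norm (z (2 * n - 1)) < norm (z (2 * n)) \<longrightarrow>
               Arg (z (2 * n - 1)) = Arg (z (2 * n)) \<and> Arg (z (2 * n)) \<in> {0, pi})) \<and>
        (\<forall>n\<ge>1. enat (2 * n + 1) \<le> N \<longrightarrow> Re (z (2 * n)) * Re (z (2 * n + 1)) < 0) \<and>
        (1 \<le> N \<longrightarrow> Re \<alpha> * Re (z 1) > 0))
     \<and>
     (Re \<alpha> = 0 \<longrightarrow>
        (1 \<le> N \<longrightarrow> 0 < norm (z 1)) \<and>
        (\<forall>n\<ge>1. enat (2 * n) \<le> N \<longrightarrow> norm (z (2 * n - 1)) < norm (z (2 * n))) \<and>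
        (\<forall>n\<ge>1. enat (2 * n + 1) \<le> N \<longrightarrow> norm (z (2 * n)) \<le> norm (z (2 * n + 1))) \<and>
        (\<forall>w. H w = 0 \<longrightarrow> Im w \<noteq> 0) \<and>
        (\<forall>w. H w = 0 \<and> Re w = 0 \<longrightarrow> zorder H w = 1 \<or> zorder H w = 2) \<and>
        (\<forall>w. H w = 0 \<and> Re w \<noteq> 0 \<longrightarrow> zorder H w = 1) \<and>
        (\<forall>n\<ge>1. enat (2 * n + 1) \<le> N \<longrightarrow>
            (norm (z (2 * n)) = norm (z (2 * n + 1)) \<longrightarrow> z (2 * n) = - cnj (z (2 * n + 1))) \<and>
            (norm (z (2 * n)) < norm (z (2 * n + 1)) \<longrightarrow>
               Arg (z (2 * n)) = Arg (z (2 * n + 1)) \<and> Arg (z (2 * n + 1)) \<in> {- (pi / 2), pi / 2})) \<and>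
        (\<forall>n\<ge>1. enat (2 * n) \<le> N \<longrightarrow> Im (z (2 * n - 1)) * Im (z (2 * n)) < 0) \<and>
        (1 \<le> N \<longrightarrow> Im \<alpha> * Im (z 1) < 0 \<and> Re (z 1) = 0))"
proof -
  obtain s where s: "neg_prod_seq s" "\<And>w. f w = f 0 * neg_prod s w" "f 0 \<noteq> 0"
    using genus_zero_neg_prod[OF f_genus f_neg] by blast
  obtain t where t: "neg_prod_seq t" "\<And>w. g w = g 0 * neg_prod t w" "g 0 \<noteq> 0"
    using genus_zero_neg_prod[OF g_genus g_neg] by blast
  have f0: "f 0 = c 0"
    using f_series[of 0] powser_sums_zero[of "\<lambda>n. c (2 * n)"] sums_unique2 by force
  have g0: "g 0 = c 1"
    using g_series[of 0] powser_sums_zero[of "\<lambda>n. c (2 * n + 1)"] sums_unique2 by force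
  have mu2: "\<mu>\<^sup>2 = \<i>"
  proof -
    have "\<mu>\<^sup>2 = exp (\<i> * of_real (pi / 2))" unfolding mu by (simp flip: exp_double)
    also have "\<dots> = cis (pi / 2)" by (rule cis_conv_exp[symmetric])
    finally show ?thesis by simp
  qed
  hence nu2: "(cnj \<mu>)\<^sup>2 = - \<i>" by (metis complex_cnj_i complex_cnj_power)
  \<comment> \<open>The two versions of H differ only in \<nu>, which is cnj \<mu> or \<mu>; with
    this form they are treated together.\<close>
  have "\<exists>\<nu>. \<nu> \<noteq> 0 \<and> \<alpha> = - \<nu> * c 1 / c 0 \<and> (\<forall>w. H w = f (w\<^sup>2) + \<nu> * w * g (- w\<^sup>2))"
    using H_alpha
  proof
    assume a: "H = (\<lambda>w. h_series c (cnj \<mu> * w)) \<and> \<alpha> = - cnj \<mu> * c 1 / c 0"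
    have "H w = f (w\<^sup>2) + cnj \<mu> * w * g (- w\<^sup>2)" for w
    proof -
      have "(\<lambda>k. \<i> ^ (k * (k - 1) div 2) * c k * (cnj \<mu> * w) ^ k) sums (f (w\<^sup>2) + cnj \<mu> * w * g (- w\<^sup>2))"
        by (rule twisted_series[OF f_series g_series _ nu2]) simp
      thus ?thesis using a by (simp add: h_series_def sums_iff)
    qed
    moreover have "cnj \<mu> \<noteq> 0" using mu by simp
    ultimately show ?thesis using a by blast
  next
    assume a: "H = (\<lambda>w. hbar_series c (\<mu> * w)) \<and> \<alpha> = - \<mu> * c 1 / c 0"
    \<comment> \<open>Negative powers of \<i> are powers of -\<i>, so this series is the case j =
      -\<i>.\<close>
    have pw: "\<i> powi (- int n) = (- \<i>) ^ n" for n
      by (simp add: power_int_minus flip: power_inverse)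
    have "H w = f (w\<^sup>2) + \<mu> * w * g (- w\<^sup>2)" for w
    proof -
      have "(\<lambda>k. (- \<i>) ^ (k * (k - 1) div 2) * c k * (\<mu> * w) ^ k) sums (f (w\<^sup>2) + \<mu> * w * g (- w\<^sup>2))"
        by (rule twisted_series[OF f_series g_series]) (simp_all add: mu2)
      thus ?thesis using a unfolding hbar_series_def pw by (simp add: sums_iff)
    qed
    moreover have "\<mu> \<noteq> 0" using mu by simp
    ultimately show ?thesis using a by blast
  qed
  then obtain \<nu> where nu: "\<nu> \<noteq> 0" "\<alpha> = - \<nu> * c 1 / c 0" "\<And>w. H w = f (w\<^sup>2) + \<nu> * w * g (- w\<^sup>2)" by blast
  have c: "c 0 \<noteq> 0" "c 1 \<noteq> 0" using s(3) t(3) f0 g0 by auto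
  interpret E: entire_pair s t \<alpha> "c 0" H N z
  proof (intro entire_pair.intro entire_pair_axioms.intro s(1) t(1) zeros c(1))
    show "\<alpha> \<noteq> 0" using nu c by simp
    show "H w = c 0 * (neg_prod s (w\<^sup>2) - \<alpha> * (w * neg_prod t (- w\<^sup>2)))" for w
      unfolding nu(3) s(2)[of "w\<^sup>2"] t(2)[of "- w\<^sup>2"] f0 g0 nu(2) using c(1) by (simp add: field_simps)
  qed
  \<comment> \<open>Im (\<alpha>^2) = 2 Re \<alpha> Im \<alpha>, so the assumption says that
    \<alpha> is off both axes.\<close>
  have i: "interlaced H N z \<alpha>" if "Im (\<alpha>\<^sup>2) \<noteq> 0"
    by (rule E.interlaced_H) (use that in \<open>auto simp: power2_eq_square\<close>)
  show ?thesis
    by (rule conjI[OF impI conjI[OF impI impI]], rule interlaced_quadrants[OF i],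
        assumption, assumption, rule paired_real[OF E.paired_H zeros], assumption,
        rule paired_imag[OF E.paired_H_imag(1) zeros E.holomorphic_H E.paired_H_imag(2)])
qed

end
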